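(* Let $C\subseteq\mathbb R^d$ be a $p$-convex set ($p\in\mathbb N$) with $|C|=1$, let $\mathbf c_n=(c_{n,1},\dots,c_{n,d})$ be vectors with $0<c_{n,\ell}\to\infty$ for each $\ell$, and let $D_n=(\mathbf c_nC)\cap\mathbb Z^d$. Let $(\xi_v)_{v\in\mathbb Z^d}$ be a stationary real-valued random field satisfying condition $\mathcal D(x_n;K_n)$ for some real sequence $(x_n)_{n\in\mathbb N}$, with associated vectors $\boldsymbol\gamma_n$ and constants $\alpha_n$. Let $(k_n)$ be a sequence of integers satisfying $k_n\to\infty$, $k_n\alpha_n\to0$ and $k_n^{1/d}\boldsymbol\gamma_n=o(\mathbf c_n)$ as $n\to\infty$, such that condition $\mathcal D^\ell(x_n;k_n;\theta)$ is satisfied for some $\theta\in(0,1]$. Assume for some $0<\tau<\infty$ that $|D_n|\,\mathbb P(\xi_0>x_n)\to\tau$. Then, as $n\to\infty$, $$\mathbb E\bigl(Y_0^{n,k_n}\mid Y_0^{n,k_n}>0\bigr)\to 1/\theta.$$ If furthermore condition $\overline{\mathcal D}(x_n;k_n;K_n)$ is satisfied, then, as $n\to\infty$, $$\mathbb E\bigl(|\mathcal C|\mid\tilde N_n(C)>0\bigr)\to1/\theta,$$ and additionally $$\max_{z\in Q_{n,k_n}^-}\Bigl|\mathbb E\bigl(Y_z^{n,k_n}\mid Y_z^{n,k_n}>0,\,N_n(C)=\ell\bigr)-1/\theta\Bigr|\to0 \qquad\text{and}\qquad \mathbb E\bigl(|\mathcal C|\mid\tilde N_n(C)=\ell\bigr)\to1/\theta$$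 for all $\ell\in\mathbb N$.
   Context: Notation: $d\in\mathbb N$; $|\cdot|$ denotes the Euclidean norm of a point, Lebesgue measure of a full-dimensional subset of $\mathbb R^d$, and cardinality of a subset of $\mathbb Z^d$ (or of a finite set of points). For vectors $\mathbf r=(r_1,\dots,r_d)$ and $A\subseteq\mathbb R^d$, $\mathbf rA=\{(r_1a_1,\dots,r_da_d):a\in A\}$; products and quotients of vectors are coordinate-wise. $A\oplus B$ is the Minkowski sum, $B(1)$ the closed Euclidean unit ball. $\mathbf r_n=o(\mathbf c_n)$ means $r_{n,\ell}/c_{n,\ell}\to0$ for each $\ell$. $M_\xi(A)=\max_{v\in A}\xi_v$, with $M_\xi(\emptyset)=-\infty$. A convex body is a compact convex subset of $\mathbb R^d$ with non-empty interior; a set is $p$-convex if it is a union of $p$ convex bodies. Write $C_n=\mathbf c_nC$. Boxes: every sequence $(k_n)$ considered consists of positive integers with $k_n\to\infty$ and $k_n^{1/d}=o(c_{n,\ell})$ for all $\ell$. Put $t_{n,k_n}^\ell=\lfloor c_{n,\ell}/k_n^{1/d}\rfloor$, $\mathbf t_{n,k_n}=(t_{n,k_n}^1,\dots,t_{n,k_n}^d)$, and for $z\in\mathbb Z^d$, $I_z^{n,k_n}=\mathbf t_{n,k_n}(z+[0,1)^d)$, $J_z^{n,k_n}=I_z^{n,k_n}\cap\mathbb Z^d$, and $D_{n,k_n}^+=\bigcup\{J_z^{n,k_n}: I_z^{n,k_n}\cap C_n\ne\emptyset\}$. $K_n=\mathbb Z^d\cap\mathbf c_n[-c,c]^d$,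 where $0<c<\infty$ is a fixed constant (which can be chosen independently of $(k_n)$) such that $D_{n,k_n}^+\subseteq K_n$ for all $n$. Condition $\mathcal D(x_n;K_n)$: sets $A,B\subseteq\mathbb Z^d$ are $\boldsymbol\gamma$-separated if $B\subseteq(A\oplus\boldsymbol\gamma B(1))^c$. The condition holds for $(\xi_v)$ if there is an increasing sequence of $d$-dimensional vectors $\boldsymbol\gamma_n$ with $\boldsymbol\gamma_n=o(\mathbf c_n)$ and constants $\alpha_n\to0$ such that for all $n$ and all $\boldsymbol\gamma_n$-separated $A,B\subseteq K_n$, at least one of which is a box, $|\mathbb P(M_\xi(A\cup B)\le x_n)-\mathbb P(M_\xi(A)\le x_n)\mathbb P(M_\xi(B)\le x_n)|\le\alpha_n$. Condition $\overline{\mathcal D}(x_n;k_n;K_n)$: there is an increasing sequence of $d$-dimensional vectors $\boldsymbol\gamma_n$ with $k_n^{1/d}\boldsymbol\gamma_n=o(\mathbf c_n)$ and sequences $\alpha_n,\tilde\alpha_n$ with $k_n\alpha_n\to0$ and $\tilde\alpha_n=o(\mathbb P(\xi_0>x_n))$ such that: (1) for all $\boldsymbol\gamma_n$-separated $A,B\subseteq K_n$ and all $\mathcal B\in\sigma(\{\xi_{v'}>x_n\}:v'\in B)$, $|\mathbb P(\{M_\xi(A)\le x_n\}\cap\mathcal B)-\mathbb P(M_\xi(A)\le x_n)\mathbb P(\mathcal B)|\le\alpha_n$; (2) for all $v\in K_n$ and $B\subseteq K_n$ with $\{v\}$ and $B$ $\boldsymbol\gamma_n$-separated and all $\mathcal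 B\in\sigma(\{\xi_{v'}>x_n\}:v'\in B)$, $|\mathbb P(\{\xi_v>x_n\}\cap\mathcal B)-\mathbb P(\xi_v>x_n)\mathbb P(\mathcal B)|\le\tilde\alpha_n$. Order: $\preceq$ is an arbitrary fixed translation invariant total order on $\mathbb Z^d$, and $A_v^{n,k_n}=\{z\in(v+\mathbf t_{n,k_n}[-1,1]^d)\cap\mathbb Z^d: v\prec z\}$. Condition $\mathcal D^\ell(x_n;k_n;\theta)$: $\mathbb P(M_\xi(A_0^{n,k_n})\le x_n\mid\xi_0>x_n)\to\theta$ as $n\to\infty$. Cluster processes: $N_n(A)=\sum_{z\in\mathbb Z^d}\mathbf 1_A\bigl(z\,\mathbf t_{n,k_n}/\mathbf c_n\bigr)\mathbf 1_{\{M_\xi(J_z^{n,k_n})>x_n\}}$ for Borel $A\subseteq C$, and $Y_z^{n,k_n}=|\{v\in J_z^{n,k_n}:\xi_v>x_n\}|$. Let $Q_{n,k_n}^-=\{z\in\mathbb Z^d: z\,\mathbf t_{n,k_n}/\mathbf c_n\in C\}$, $\tilde D_{n,k_n}=\bigcup_{z\in Q_{n,k_n}^-}J_z^{n,k_n}$ and $\Phi_n=\{v/\mathbf c_n: v\in\tilde D_{n,k_n},\ \xi_v>x_n\}$. Two points $u,u'\in\Phi_n$ are in the same cluster if there is a sequence of distinct elements $u=u_0,u_1,\dots,u_R=u'$ of that cluster (i.e. of $\Phi_n$) with $|u_i-u_{i-1}|\le\sqrt d/k_n^{1/d}$ for all $i$. This divides $\Phi_n$ uniquely into $X_{n,k_n}$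 disjoint clusters $\mathcal C_1^{n,k_n},\dots,\mathcal C_{X_{n,k_n}}^{n,k_n}$; the cluster point of $\mathcal C_i^{n,k_n}$ is $x_i^{n,k_n}=\arg\min_{x\in\mathcal C_i^{n,k_n}}\sum_{x'\in\mathcal C_i^{n,k_n}}|x-x'|^2$, and $\tilde N_n(A)=\sum_{i=1}^{X_{n,k_n}}\mathbf 1_A(x_i^{n,k_n})$ for Borel $A\subseteq C$. Random cluster: on $\{\tilde N_n(C)>0\}$, $\mathcal C$ is a cluster chosen uniformly among the $\tilde N_n(C)$ clusters counted by $\tilde N_n$ (those with cluster point in $C$, listed first in the enumeration): $\mathcal C=\mathcal C_S^{n,k_n}$, where, conditioned on $\tilde N_n(C)=\ell$, $S$ is uniform on $\{1,\dots,\ell\}$ and independent of everything else. $|\mathcal C|$ is its number of points. *)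

theory Defs
  imports "HOL-Probability.Probability" "HOL-Library.Landau_Symbols"
begin

text \<open>
  The dimension is \<open>d = CARD('d)\<close>; points of \<open>\<int>\<^sup>d\<close> are of type \<^typ>\<open>int ^ 'd\<close> and points of
  \<open>\<real>\<^sup>d\<close> of type \<^typ>\<open>real ^ 'd\<close>. Multiplication on \<^typ>\<open>real ^ 'd\<close> is the library's
  coordinate-wise product.
\<close>

definition real_vec :: "int ^ 'd \<Rightarrow> real ^ 'd" where
  "real_vec v = (\<chi> i. real_of_int (v $ i))"

text \<open>\<open>A \<inter> \<int>\<^sup>d\<close>, as a set of integer vectors.\<close>

definition lattice_points :: "(real ^ 'd) set \<Rightarrow> (int ^ 'd) set" where
  "lattice_points A = {v. real_vec v \<in> A}"

definition scale_set :: "real ^ 'd \<Rightarrow> (real ^ 'd) set \<Rightarrow> (real ^ 'd) set" where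
  "scale_set r A = (\<lambda>a. r * a) ` A"

definition vec_divide :: "real ^ 'd \<Rightarrow> real ^ 'd \<Rightarrow> real ^ 'd" where
  "vec_divide u w = (\<chi> i. u $ i / w $ i)"

definition vec_smallo :: "(nat \<Rightarrow> real ^ 'd) \<Rightarrow> (nat \<Rightarrow> real ^ 'd) \<Rightarrow> bool" where
  "vec_smallo r c \<longleftrightarrow> (\<forall>l. (\<lambda>n. r n $ l / c n $ l) \<longlonglongrightarrow> 0)"

definition convex_body :: "(real ^ 'd) set \<Rightarrow> bool" where
  "convex_body K \<longleftrightarrow> compact K \<and> convex K \<and> interior K \<noteq> {}"

definition p_convex :: "nat \<Rightarrow> (real ^ 'd) set \<Rightarrow> bool" where
  "p_convex p C \<longleftrightarrow> (\<exists>K. (\<forall>i<p. convex_body (K i)) \<and> C = (\<Union>i<p. K i))"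

definition translation_invariant_total_order :: "(int ^ 'd) rel \<Rightarrow> bool" where
  "translation_invariant_total_order R \<longleftrightarrow>
     linear_order_on UNIV R \<and> (\<forall>u v w. (u, v) \<in> R \<longrightarrow> (u + w, v + w) \<in> R)"

definition stationary_field :: "'a measure \<Rightarrow> (int ^ 'd \<Rightarrow> 'a \<Rightarrow> real) \<Rightarrow> bool" where
  "stationary_field M \<xi> \<longleftrightarrow>
     (\<forall>v. \<xi> v \<in> borel_measurable M) \<and>
     (\<forall>w. distr M (PiM UNIV (\<lambda>_. borel)) (\<lambda>\<omega> v. \<xi> (v + w) \<omega>)
        = distr M (PiM UNIV (\<lambda>_. borel)) (\<lambda>\<omega> v. \<xi> v \<omega>))"

definition field_sigma :: "'a measure \<Rightarrow> (int ^ 'd \<Rightarrow> 'a \<Rightarrow> real) \<Rightarrow> 'a set set" where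
  "field_sigma M \<xi> =
     sets (vimage_algebra (space M) (\<lambda>\<omega> v. \<xi> v \<omega>) (PiM UNIV (\<lambda>_. borel)))"

text \<open>\<open>M\<^sub>\<xi>(A)\<close>. In \<^typ>\<open>ereal\<close> the supremum of the empty set is \<open>-\<infinity>\<close>, and on the finite nonempty
  sets \<open>A\<close> to which it is applied the supremum is a maximum.\<close>

definition field_max :: "(int ^ 'd \<Rightarrow> 'a \<Rightarrow> real) \<Rightarrow> (int ^ 'd) set \<Rightarrow> 'a \<Rightarrow> ereal" where
  "field_max \<xi> A \<omega> = (SUP v\<in>A. ereal (\<xi> v \<omega>))"

text \<open>\<open>\<sigma>({\<xi>\<^sub>v > x} : v \<in> B)\<close>.\<close>

definition exceedance_sigma ::
  "'a measure \<Rightarrow> (int ^ 'd \<Rightarrow> 'a \<Rightarrow> real) \<Rightarrow> real \<Rightarrow> (int ^ 'd) set \<Rightarrow> 'a set set" where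
  "exceedance_sigma M \<xi> x B = sigma_sets (space M) ((\<lambda>v. {\<omega> \<in> space M. \<xi> v \<omega> > x}) ` B)"

text \<open>Conditional expectation \<open>E(X | P)\<close> given an event, companion of \<^const>\<open>cond_prob\<close>; it is
  \<open>0\<close> if the event is null.\<close>

definition cond_expect :: "'a measure \<Rightarrow> ('a \<Rightarrow> real) \<Rightarrow> ('a \<Rightarrow> bool) \<Rightarrow> real" where
  "cond_expect M X P =
     (LINT \<omega>:{\<omega> \<in> space M. P \<omega>}|M. X \<omega>) / measure M {\<omega> \<in> space M. P \<omega>}"

definition side_vec :: "(nat \<Rightarrow> real ^ 'd) \<Rightarrow> (nat \<Rightarrow> nat) \<Rightarrow> nat \<Rightarrow> real ^ 'd" where
  "side_vec c k n = (\<chi> l. real_of_int \<lfloor>c n $ l / root CARD('d) (real (k n))\<rfloor>)"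

definition Ibox :: "(nat \<Rightarrow> real ^ 'd) \<Rightarrow> (nat \<Rightarrow> nat) \<Rightarrow> nat \<Rightarrow> int ^ 'd \<Rightarrow> (real ^ 'd) set" where
  "Ibox c k n z =
     scale_set (side_vec c k n) ((\<lambda>u. real_vec z + u) ` {u. \<forall>i. 0 \<le> u $ i \<and> u $ i < 1})"

definition Jbox :: "(nat \<Rightarrow> real ^ 'd) \<Rightarrow> (nat \<Rightarrow> nat) \<Rightarrow> nat \<Rightarrow> int ^ 'd \<Rightarrow> (int ^ 'd) set" where
  "Jbox c k n z = lattice_points (Ibox c k n z)"

definition Dplus ::
  "(real ^ 'd) set \<Rightarrow> (nat \<Rightarrow> real ^ 'd) \<Rightarrow> (nat \<Rightarrow> nat) \<Rightarrow> nat \<Rightarrow> (int ^ 'd) set" where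
  "Dplus C c k n = \<Union> (Jbox c k n ` {z. Ibox c k n z \<inter> scale_set (c n) C \<noteq> {}})"

definition Kset :: "(nat \<Rightarrow> real ^ 'd) \<Rightarrow> real \<Rightarrow> nat \<Rightarrow> (int ^ 'd) set" where
  "Kset c \<kappa> n = lattice_points (scale_set (c n) {y. \<forall>i. -\<kappa> \<le> y $ i \<and> y $ i \<le> \<kappa>})"

definition Aset ::
  "(int ^ 'd) rel \<Rightarrow> (nat \<Rightarrow> real ^ 'd) \<Rightarrow> (nat \<Rightarrow> nat) \<Rightarrow> nat \<Rightarrow> int ^ 'd \<Rightarrow> (int ^ 'd) set" where
  "Aset R c k n v =
     {z \<in> lattice_points ((\<lambda>y. real_vec v + y) `
              scale_set (side_vec c k n) {y. \<forall>i. -1 \<le> y $ i \<and> y $ i \<le> 1}).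
        (v, z) \<in> R \<and> v \<noteq> z}"

definition is_lattice_box :: "(int ^ 'd) set \<Rightarrow> bool" where
  "is_lattice_box A \<longleftrightarrow> (\<exists>a b. A = {v. \<forall>i. a $ i \<le> v $ i \<and> v $ i \<le> b $ i})"

definition separated :: "real ^ 'd \<Rightarrow> (int ^ 'd) set \<Rightarrow> (int ^ 'd) set \<Rightarrow> bool" where
  "separated g A B \<longleftrightarrow>
     real_vec ` B \<subseteq> - {a + b |a b. a \<in> real_vec ` A \<and> b \<in> scale_set g (cball 0 1)}"

text \<open>The condition \<open>\<D>(x\<^sub>n; K\<^sub>n)\<close> with witnesses \<open>\<gamma>\<close> and \<open>\<alpha>\<close>.\<close>

definition cond_D ::
  "'a measure \<Rightarrow> (int ^ 'd \<Rightarrow> 'a \<Rightarrow> real) \<Rightarrow> (nat \<Rightarrow> real ^ 'd) \<Rightarrow> (nat \<Rightarrow> real)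
     \<Rightarrow> (nat \<Rightarrow> (int ^ 'd) set) \<Rightarrow> (nat \<Rightarrow> real ^ 'd) \<Rightarrow> (nat \<Rightarrow> real) \<Rightarrow> bool" where
  "cond_D M \<xi> c x K \<gamma> \<alpha> \<longleftrightarrow>
     (\<forall>l. incseq (\<lambda>n. \<gamma> n $ l)) \<and> vec_smallo \<gamma> c \<and> \<alpha> \<longlonglongrightarrow> 0 \<and>
     (\<forall>n A B. A \<subseteq> K n \<and> B \<subseteq> K n \<and> separated (\<gamma> n) A B \<and> (is_lattice_box A \<or> is_lattice_box B) \<longrightarrow>
        \<bar>measure M {\<omega> \<in> space M. field_max \<xi> (A \<union> B) \<omega> \<le> ereal (x n)}
          - measure M {\<omega> \<in> space M. field_max \<xi> A \<omega> \<le> ereal (x n)}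
            * measure M {\<omega> \<in> space M. field_max \<xi> B \<omega> \<le> ereal (x n)}\<bar> \<le> \<alpha> n)"

text \<open>The condition \<open>\<D>\<close>-bar. Its witnesses need not be those of \<^const>\<open>cond_D\<close>.\<close>

definition cond_Dbar ::
  "'a measure \<Rightarrow> (int ^ 'd \<Rightarrow> 'a \<Rightarrow> real) \<Rightarrow> (nat \<Rightarrow> real ^ 'd) \<Rightarrow> (nat \<Rightarrow> real)
     \<Rightarrow> (nat \<Rightarrow> nat) \<Rightarrow> (nat \<Rightarrow> (int ^ 'd) set) \<Rightarrow> bool" where
  "cond_Dbar M \<xi> c x k K \<longleftrightarrow>
     (\<exists>\<gamma> \<alpha> \<alpha>'.
        (\<forall>l. incseq (\<lambda>n. \<gamma> n $ l)) \<and>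
        vec_smallo (\<lambda>n. root CARD('d) (real (k n)) *\<^sub>R \<gamma> n) c \<and>
        (\<lambda>n. real (k n) * \<alpha> n) \<longlonglongrightarrow> 0 \<and>
        \<alpha>' \<in> o(\<lambda>n. measure M {\<omega> \<in> space M. \<xi> 0 \<omega> > x n}) \<and>
        (\<forall>n A B E. A \<subseteq> K n \<and> B \<subseteq> K n \<and> separated (\<gamma> n) A B \<and>
             E \<in> exceedance_sigma M \<xi> (x n) B \<longrightarrow>
           \<bar>measure M ({\<omega> \<in> space M. field_max \<xi> A \<omega> \<le> ereal (x n)} \<inter> E)
             - measure M {\<omega> \<in> space M. field_max \<xi> A \<omega> \<le> ereal (x n)} * measure M E\<bar> \<le> \<alpha> n) \<and>
        (\<forall>n v B E. v \<in> K n \<and> B \<subseteq> K n \<and> separated (\<gamma> n) {v} B \<and>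
             E \<in> exceedance_sigma M \<xi> (x n) B \<longrightarrow>
           \<bar>measure M ({\<omega> \<in> space M. \<xi> v \<omega> > x n} \<inter> E)
             - measure M {\<omega> \<in> space M. \<xi> v \<omega> > x n} * measure M E\<bar> \<le> \<alpha>' n))"

definition cond_Dl ::
  "'a measure \<Rightarrow> (int ^ 'd \<Rightarrow> 'a \<Rightarrow> real) \<Rightarrow> (int ^ 'd) rel \<Rightarrow> (nat \<Rightarrow> real ^ 'd)
     \<Rightarrow> (nat \<Rightarrow> real) \<Rightarrow> (nat \<Rightarrow> nat) \<Rightarrow> real \<Rightarrow> bool" where
  "cond_Dl M \<xi> R c x k \<theta> \<longleftrightarrow>
     (\<lambda>n. cond_prob M (\<lambda>\<omega>. field_max \<xi> (Aset R c k n 0) \<omega> \<le> ereal (x n)) (\<lambda>\<omega>. \<xi> 0 \<omega> > x n))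
       \<longlonglongrightarrow> \<theta>"

definition grid_point :: "(nat \<Rightarrow> real ^ 'd) \<Rightarrow> (nat \<Rightarrow> nat) \<Rightarrow> nat \<Rightarrow> int ^ 'd \<Rightarrow> real ^ 'd" where
  "grid_point c k n z = vec_divide (real_vec z * side_vec c k n) (c n)"

text \<open>For bounded \<open>A\<close> the index set is finite as soon as all coordinates of \<^term>\<open>side_vec c k n\<close>
  are positive, hence for all but finitely many \<open>n\<close>.\<close>

definition Ncount ::
  "(int ^ 'd \<Rightarrow> 'a \<Rightarrow> real) \<Rightarrow> (nat \<Rightarrow> real ^ 'd) \<Rightarrow> (nat \<Rightarrow> real) \<Rightarrow> (nat \<Rightarrow> nat)
     \<Rightarrow> nat \<Rightarrow> (real ^ 'd) set \<Rightarrow> 'a \<Rightarrow> nat" where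
  "Ncount \<xi> c x k n A \<omega> =
     (\<Sum>z | grid_point c k n z \<in> A. of_bool (field_max \<xi> (Jbox c k n z) \<omega> > ereal (x n)))"

definition Ycount ::
  "(int ^ 'd \<Rightarrow> 'a \<Rightarrow> real) \<Rightarrow> (nat \<Rightarrow> real ^ 'd) \<Rightarrow> (nat \<Rightarrow> real) \<Rightarrow> (nat \<Rightarrow> nat)
     \<Rightarrow> nat \<Rightarrow> int ^ 'd \<Rightarrow> 'a \<Rightarrow> nat" where
  "Ycount \<xi> c x k n z \<omega> = card {v \<in> Jbox c k n z. \<xi> v \<omega> > x n}"

definition Qminus ::
  "(real ^ 'd) set \<Rightarrow> (nat \<Rightarrow> real ^ 'd) \<Rightarrow> (nat \<Rightarrow> nat) \<Rightarrow> nat \<Rightarrow> (int ^ 'd) set" where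
  "Qminus C c k n = {z. grid_point c k n z \<in> C}"

definition Dtilde ::
  "(real ^ 'd) set \<Rightarrow> (nat \<Rightarrow> real ^ 'd) \<Rightarrow> (nat \<Rightarrow> nat) \<Rightarrow> nat \<Rightarrow> (int ^ 'd) set" where
  "Dtilde C c k n = (\<Union>z\<in>Qminus C c k n. Jbox c k n z)"

definition Phi ::
  "(int ^ 'd \<Rightarrow> 'a \<Rightarrow> real) \<Rightarrow> (real ^ 'd) set \<Rightarrow> (nat \<Rightarrow> real ^ 'd) \<Rightarrow> (nat \<Rightarrow> real)
     \<Rightarrow> (nat \<Rightarrow> nat) \<Rightarrow> nat \<Rightarrow> 'a \<Rightarrow> (real ^ 'd) set" where
  "Phi \<xi> C c x k n \<omega> =
     (\<lambda>v. vec_divide (real_vec v) (c n)) ` {v \<in> Dtilde C c k n. \<xi> v \<omega> > x n}"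

definition linked :: "real \<Rightarrow> (real ^ 'd) set \<Rightarrow> real ^ 'd \<Rightarrow> real ^ 'd \<Rightarrow> bool" where
  "linked r P u u' \<longleftrightarrow>
     (\<exists>us. us \<noteq> [] \<and> hd us = u \<and> last us = u' \<and> distinct us \<and> set us \<subseteq> P \<and>
           (\<forall>i. Suc i < length us \<longrightarrow> norm (us ! Suc i - us ! i) \<le> r))"

definition clusters :: "(nat \<Rightarrow> nat) \<Rightarrow> nat \<Rightarrow> (real ^ 'd) set \<Rightarrow> (real ^ 'd) set set" where
  "clusters k n P =
     P // {(u, u'). linked (sqrt (real CARD('d)) / root CARD('d) (real (k n))) P u u'}"

text \<open>The minimiser defining the cluster point need not be unique; \<open>q n\<close> is a rule choosing one
  for every possible cluster.\<close>

definition cluster_point_rule :: "(nat \<Rightarrow> (real ^ 'd) set \<Rightarrow> real ^ 'd) \<Rightarrow> bool" where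
  "cluster_point_rule q \<longleftrightarrow>
     (\<forall>n K. finite K \<and> K \<noteq> {} \<longrightarrow>
        is_arg_min (\<lambda>y. \<Sum>y'\<in>K. (norm (y - y'))\<^sup>2) (\<lambda>y. y \<in> K) (q n K))"

text \<open>The number of clusters of a point configuration \<open>P\<close> whose cluster point is in \<open>A\<close>; the
  process \<open>N\<close>-tilde at \<open>A\<close> is its value at \<^const>\<open>Phi\<close>.\<close>

definition cluster_count ::
  "(nat \<Rightarrow> (real ^ 'd) set \<Rightarrow> real ^ 'd) \<Rightarrow> (nat \<Rightarrow> nat) \<Rightarrow> nat \<Rightarrow> (real ^ 'd) set
     \<Rightarrow> (real ^ 'd) set \<Rightarrow> nat" where
  "cluster_count q k n A P = (\<Sum>K\<in>clusters k n P. indicator A (q n K))"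

definition Ntilde ::
  "(nat \<Rightarrow> (real ^ 'd) set \<Rightarrow> real ^ 'd) \<Rightarrow> (int ^ 'd \<Rightarrow> 'a \<Rightarrow> real) \<Rightarrow> (real ^ 'd) set
     \<Rightarrow> (nat \<Rightarrow> real ^ 'd) \<Rightarrow> (nat \<Rightarrow> real) \<Rightarrow> (nat \<Rightarrow> nat) \<Rightarrow> nat \<Rightarrow> (real ^ 'd) set \<Rightarrow> 'a \<Rightarrow> nat" where
  "Ntilde q \<xi> C c x k n A \<omega> = cluster_count q k n A (Phi \<xi> C c x k n \<omega>)"

text \<open>\<open>e n P 1, \<dots>, e n P X\<close> lists the clusters of \<open>P\<close> without repetition, those with cluster
  point in \<open>C\<close> first.\<close>

definition cluster_enumeration ::
  "(nat \<Rightarrow> (real ^ 'd) set \<Rightarrow> real ^ 'd) \<Rightarrow> (real ^ 'd) set \<Rightarrow> (nat \<Rightarrow> nat)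
     \<Rightarrow> (nat \<Rightarrow> (real ^ 'd) set \<Rightarrow> nat \<Rightarrow> (real ^ 'd) set) \<Rightarrow> bool" where
  "cluster_enumeration q C k e \<longleftrightarrow>
     (\<forall>n P. finite P \<longrightarrow>
        bij_betw (e n P) {1..card (clusters k n P)} (clusters k n P) \<and>
        (\<forall>i\<in>{1..card (clusters k n P)}. q n (e n P i) \<in> C \<longleftrightarrow> i \<le> cluster_count q k n C P))"

text \<open>Conditioned on \<open>N = \<ell>\<close> (that is, under the uniform measure of this event), the index \<open>S\<close> is
  uniform on \<open>{1..\<ell>}\<close> and independent of the field, which determines all other random objects.\<close>

definition uniform_index ::
  "'a measure \<Rightarrow> (int ^ 'd \<Rightarrow> 'a \<Rightarrow> real) \<Rightarrow> ('a \<Rightarrow> nat) \<Rightarrow> ('a \<Rightarrow> nat) \<Rightarrow> bool" where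
  "uniform_index M \<xi> N S \<longleftrightarrow>
     S \<in> measurable M (count_space UNIV) \<and>
     (\<forall>l\<ge>1. measure M {\<omega> \<in> space M. N \<omega> = l} > 0 \<longrightarrow>
        (let M' = uniform_measure M {\<omega> \<in> space M. N \<omega> = l} in
           distr M' (count_space UNIV) S = measure_pmf (pmf_of_set {1..l}) \<and>
           prob_space.indep_set M'
             (sets (vimage_algebra (space M) S (count_space UNIV))) (field_sigma M \<xi>)))"

definition random_cluster_size ::
  "(nat \<Rightarrow> (real ^ 'd) set \<Rightarrow> nat \<Rightarrow> (real ^ 'd) set) \<Rightarrow> (nat \<Rightarrow> 'a \<Rightarrow> nat)
     \<Rightarrow> (int ^ 'd \<Rightarrow> 'a \<Rightarrow> real) \<Rightarrow> (real ^ 'd) set \<Rightarrow> (nat \<Rightarrow> real ^ 'd) \<Rightarrow> (nat \<Rightarrow> real)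
     \<Rightarrow> (nat \<Rightarrow> nat) \<Rightarrow> nat \<Rightarrow> 'a \<Rightarrow> nat" where
  "random_cluster_size e S \<xi> C c x k n \<omega> = card (e n (Phi \<xi> C c x k n \<omega>) (S n \<omega>))"

end

theory Submission
  imports Defs
begin

text \<open>
  Let \<open>p\<close> be the exceedance probability of one site, \<open>m\<close> the number of sites of a box \<open>J\<close>, and \<open>h\<close> the
  probability that \<open>J\<close> contains an exceedance, so that \<open>E(Y | Y > 0) = m p / h\<close>. Decomposing according
  to the last exceedance in \<open>J\<close> shows that \<open>h\<close> differs from \<open>m p \<theta>\<close> by at most the probability that \<open>J\<close>
  and one of its neighbours are both hit. Removing from \<open>J\<close> a layer of thickness \<open>\<gamma>\<close>, which costs only
  \<open>o(1/k)\<close>, makes the two events nearly independent, so this probability is \<open>o(1/k)\<close>.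

  Under the stronger mixing condition the same removal decouples a box from all others. For the number
  \<open>N\<close> of hit boxes this gives \<open>(j + 1) P(N = j + 1) = |Q| h P(N = j) + o(1)\<close>, hence all \<open>P(N = j)\<close> stay
  bounded away from \<open>0\<close>, and it gives \<open>E(Y; Y > 0, N = l) = P(Y > 0, N = l) / \<theta> + o(1/k)\<close>.
  Clusters coincide with hit boxes unless two nearby boxes or a box at the boundary of \<open>C\<close> are hit; this
  exceptional event, and the expected number of exceedances on it, tend to \<open>0\<close>.
\<close>

section \<open>Counting lattice points\<close>

text \<open>The scale \<open>1/k\<close> governs the estimates. There are of the order of
  \<open>k\<close> boxes, and \<open>h\<close> and \<open>m p\<close> are of exact order
  \<open>1/k\<close>; an error per box therefore has to be o(1/k), both to vanish after summation
  over all boxes and to vanish relative to the probability that one given box is hit. The orders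
  come as two-sided bounds. The lower bounds matter as much as the upper ones, since a conditional
  expectation divides an error by a probability.

  Adjacent boxes touch, so separation by \<gamma> is obtained only between the core of one box and
  the remaining boxes.

  That the exceptional event has small probability does not control the exceedances on it, because
  their number in a box is not bounded uniformly in \<open>n\<close>. There the mixing of a single
  site with an event of other boxes is used a second time. For the mean cluster size given at least
  one cluster, the possible numbers of clusters are treated one at a time, and large numbers are cut
  off by means of the expected total number of exceedances.\<close>

lemma bij_betw_vec_PiE:
  "bij_betw vec_nth {v :: 'b ^ 'd. \<forall>i. v $ i \<in> S i} (PiE UNIV S)"
  by (rule bij_betwI[where g = vec_lambda]) (auto simp: PiE_def)

lemma finite_vec_Collect:
  fixes S :: "'d::finite \<Rightarrow> 'b set"
  assumes "\<And>i. finite (S i)"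
  shows "finite {v :: 'b ^ 'd. \<forall>i. v $ i \<in> S i}"
  using bij_betw_finite[OF bij_betw_vec_PiE, of S] finite_PiE[of UNIV S] assms by auto

lemma card_vec_Collect:
  fixes S :: "'d::finite \<Rightarrow> 'b set"
  shows "card {v :: 'b ^ 'd. \<forall>i. v $ i \<in> S i} = (\<Prod>i\<in>UNIV. card (S i))"
  using bij_betw_same_card[OF bij_betw_vec_PiE, of S] by (simp add: card_PiE)

lemma finite_int_vec_bounded:
  "finite {v :: int ^ 'd. \<forall>i. a i \<le> v $ i \<and> v $ i < b i}"
  using finite_vec_Collect[of "\<lambda>i. {a i..<b i}"] by (simp add: conj_commute)

lemma card_int_vec_bounded:
  "card {v :: int ^ 'd. \<forall>i. a i \<le> v $ i \<and> v $ i < b i} = (\<Prod>i\<in>UNIV. nat (b i - a i))"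
  using card_vec_Collect[of "\<lambda>i. {a i..<b i}"] by simp

lemma int_multiples_between:
  fixes a b h :: real
  assumes "0 < h"
  shows "{z :: int. a \<le> z * h \<and> z * h \<le> b} = {\<lceil>a / h\<rceil>..\<lfloor>b / h\<rfloor>}"
  using assms by (auto simp: ceiling_le_iff le_floor_iff field_simps)

lemma card_int_multiples_le:
  fixes a b h :: real
  assumes "0 < h" "a \<le> b"
  shows "real (card {z :: int. a \<le> z * h \<and> z * h \<le> b}) * h \<le> b - a + h"
proof -
  have "real (card {z :: int. a \<le> z * h \<and> z * h \<le> b}) \<le> b / h - a / h + 1"
    unfolding int_multiples_between[OF assms(1)] card_atLeastAtMost_int
    using divide_right_mono[OF assms(2), of h] assms(1) by linarith
  then show ?thesis
    using assms by (simp add: field_simps)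
qed

lemma card_int_multiples_ge:
  fixes a b h :: real
  assumes "0 < h"
  shows "b - a - h \<le> real (card {z :: int. a \<le> z * h \<and> z * h \<le> b}) * h"
proof -
  have "b / h - a / h - 1 \<le> real (card {z :: int. a \<le> z * h \<and> z * h \<le> b})"
    unfolding int_multiples_between[OF assms(1)] card_atLeastAtMost_int by linarith
  then show ?thesis
    using assms by (simp add: field_simps)
qed

section \<open>Fine grids: how many cells a set has, and how few meet a null set\<close>

text \<open>One notion for two counts: mesh \<open>1/c\<close> gives the sites of
  \<open>c C\<close>, mesh \<open>cell_vec\<close> gives the boxes in \<open>Qminus\<close>.\<close>

definition grid_index :: "(real ^ 'd) set \<Rightarrow> real ^ 'd \<Rightarrow> (int ^ 'd) set" where
  "grid_index C h = {z. real_vec z * h \<in> C}"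

text \<open>The product on the left is the total volume of the counted cells. In a cube of
  half-width b the coordinates are counted separately, and each direction contributes at most its
  length plus one mesh.\<close>

lemma grid_index_upper:
  fixes h :: "real ^ 'd"
  assumes h: "\<And>i. 0 < h $ i" and b: "\<And>u i. u \<in> C \<Longrightarrow> \<bar>u $ i\<bar> \<le> b" "0 \<le> b"
  shows "finite (grid_index C h)"
    and "real (card (grid_index C h)) * (\<Prod>i\<in>UNIV. h $ i) \<le> (\<Prod>i\<in>UNIV. 2 * b + h $ i)"
proof -
  let ?S = "\<lambda>i. {z :: int. - b \<le> z * h $ i \<and> z * h $ i \<le> b}"
  have sub: "grid_index C h \<subseteq> {z. \<forall>i. z $ i \<in> ?S i}"
  proof
    fix z
    assume "z \<in> grid_index C h"
    then have "\<bar>(real_vec z * h) $ i\<bar> \<le> b" for i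
      using b(1)[of "real_vec z * h"] by (simp add: grid_index_def)
    then show "z \<in> {z. \<forall>i. z $ i \<in> ?S i}"
      by (auto simp: real_vec_def abs_le_iff minus_le_iff)
  qed
  have fin: "finite {z :: int ^ 'd. \<forall>i. z $ i \<in> ?S i}"
    by (rule finite_vec_Collect) (simp add: int_multiples_between h)
  show "finite (grid_index C h)"
    using finite_subset[OF sub fin] .
  have "card (grid_index C h) \<le> (\<Prod>i\<in>UNIV. card (?S i))"
    using card_mono[OF fin sub] by (simp only: card_vec_Collect)
  then have "real (card (grid_index C h)) * (\<Prod>i\<in>UNIV. h $ i) 
      \<le> real (\<Prod>i\<in>UNIV. card (?S i)) * (\<Prod>i\<in>UNIV. h $ i)"
    by (intro mult_right_mono prod_nonneg) (use h less_imp_le in \<open>auto simp only: of_nat_le_iff\<close>)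
  also have "\<dots> = (\<Prod>i\<in>UNIV. real (card (?S i)) * h $ i)"
    by (simp add: prod.distrib)
  also have "\<dots> \<le> (\<Prod>i\<in>UNIV. 2 * b + h $ i)"
  proof (intro prod_mono conjI)
    fix i
    show "real (card (?S i)) * h $ i \<le> 2 * b + h $ i"
      using card_int_multiples_le[OF h[of i], of "-b" b] b(2) by simp
  qed (auto intro!: mult_nonneg_nonneg less_imp_le[OF h])
  finally show "real (card (grid_index C h)) * (\<Prod>i\<in>UNIV. h $ i) \<le> (\<Prod>i\<in>UNIV. 2 * b + h $ i)" .
qed

text \<open>The dual bound, with an inscribed cube around \<open>y\<close>: at most one mesh is lost
  per direction. The bound on \<open>h\<close> by \<open>2 * s\<close> keeps the factors
  nonnegative, as a product of inequalities requires.\<close>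

lemma grid_index_lower:
  fixes h :: "real ^ 'd"
  assumes h: "\<And>i. 0 < h $ i" "\<And>i. h $ i \<le> 2 * s"
    and s: "\<And>u. (\<And>i. \<bar>u $ i - y $ i\<bar> \<le> s) \<Longrightarrow> u \<in> C" and fin: "finite (grid_index C h)"
  shows "(\<Prod>i\<in>UNIV. 2 * s - h $ i) \<le> real (card (grid_index C h)) * (\<Prod>i\<in>UNIV. h $ i)"
proof -
  let ?S = "\<lambda>i. {z :: int. y $ i - s \<le> z * h $ i \<and> z * h $ i \<le> y $ i + s}"
  have sub: "{z. \<forall>i. z $ i \<in> ?S i} \<subseteq> grid_index C h"
  proof
    fix z
    assume "z \<in> {z. \<forall>i. z $ i \<in> ?S i}"
    then have "\<bar>(real_vec z * h) $ i - y $ i\<bar> \<le> s" for i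
      by (auto simp: real_vec_def abs_le_iff algebra_simps)
    then show "z \<in> grid_index C h"
      by (auto simp: grid_index_def intro!: s)
  qed
  have "(\<Prod>i\<in>UNIV. 2 * s - h $ i) \<le> (\<Prod>i\<in>UNIV. real (card (?S i)) * h $ i)"
  proof (intro prod_mono conjI)
    fix i
    show "2 * s - h $ i \<le> real (card (?S i)) * h $ i"
      using card_int_multiples_ge[OF h(1)[of i], of "y $ i + s" "y $ i - s"] by simp
  qed (use h in auto)
  also have "\<dots> = real (\<Prod>i\<in>UNIV. card (?S i)) * (\<Prod>i\<in>UNIV. h $ i)"
    by (simp add: prod.distrib)
  also have "\<dots> \<le> real (card (grid_index C h)) * (\<Prod>i\<in>UNIV. h $ i)"
    using card_mono[OF fin sub]
    by (intro mult_right_mono prod_nonneg) (use h less_imp_le in \<open>auto simp only: card_vec_Collect of_nat_le_iff\<close>)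
  finally show ?thesis .
qed

lemma eventually_vec_less:
  fixes h :: "nat \<Rightarrow> real ^ 'd"
  assumes "\<And>i. (\<lambda>n. h n $ i) \<longlonglongrightarrow> 0" "0 < e"
  shows "\<forall>\<^sub>F n in sequentially. \<forall>i. h n $ i < e"
  by (rule eventually_all_finite) (use assms order_tendstoD(2) in blast)

text \<open>Boundedness puts C into a cube, an interior point puts a cube into C, and the two cube
  counts give the constants once the mesh is small.\<close>

lemma grid_index_count:
  fixes h :: "nat \<Rightarrow> real ^ 'd"
  assumes C: "bounded C" "interior C \<noteq> {}"
    and h: "\<forall>\<^sub>F n in sequentially. \<forall>i. 0 < h n $ i" "\<And>i. (\<lambda>n. h n $ i) \<longlonglongrightarrow> 0"
  obtains a b where "0 < a" "0 < b"
    "\<forall>\<^sub>F n in sequentially. a \<le> real (card (grid_index C (h n))) * (\<Prod>i\<in>UNIV. h n $ i)"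
    "\<forall>\<^sub>F n in sequentially. real (card (grid_index C (h n))) * (\<Prod>i\<in>UNIV. h n $ i) \<le> b"
proof -
  from C(1) obtain b where b: "0 < b" "\<And>u. u \<in> C \<Longrightarrow> norm u \<le> b"
    by (auto simp: bounded_pos)
  have b': "\<And>u i. u \<in> C \<Longrightarrow> \<bar>u $ i\<bar> \<le> b"
    using b(2) component_le_norm_cart order_trans by blast
  from C(2) obtain y r where yr: "0 < r" "ball y r \<subseteq> C"
    by (meson ex_in_conv mem_interior)
  \<comment> \<open>A deviation of at most \<open>s\<close> in every coordinate has l1 norm at most
    r / 2, hence stays inside the ball of radius r.\<close>
  define s where "s = r / (2 * real CARD('d))"
  have s: "0 < s"
    using yr by (simp add: s_def)
  have cube: "u \<in> C" if "\<And>i. \<bar>u $ i - y $ i\<bar> \<le> s" for u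
  proof -
    have "norm (u - y) \<le> (\<Sum>i\<in>UNIV. \<bar>(u - y) $ i\<bar>)"
      by (rule norm_le_l1_cart)
    also have "\<dots> \<le> (\<Sum>i\<in>(UNIV :: 'd set). s)"
      by (intro sum_mono) (use that in auto)
    also have "\<dots> = r / 2"
      by (simp add: s_def)
    finally show ?thesis
      using yr by (auto simp: subset_iff dist_norm norm_minus_commute)
  qed
  have fin: "finite (grid_index C (h n))" if "\<forall>i. 0 < h n $ i" for n
    using grid_index_upper(1)[of "h n" C b] that b' b by auto
  show ?thesis
  proof (rule that)
    show "0 < s ^ CARD('d)" "0 < (2 * b + 1) ^ CARD('d)"
      using s b by auto
    have "\<forall>\<^sub>F n in sequentially. \<forall>i. h n $ i < s"
      using eventually_vec_less[OF h(2) s] .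
    with h(1) show "\<forall>\<^sub>F n in sequentially. s ^ CARD('d) \<le> real (card (grid_index C (h n))) * (\<Prod>i\<in>UNIV. h n $ i)"
    proof eventually_elim
      case (elim n)
      have "s ^ CARD('d) = (\<Prod>i\<in>(UNIV :: 'd set). s)"
        by simp
      also have "\<dots> \<le> (\<Prod>i\<in>UNIV. 2 * s - h n $ i)"
        proof (intro prod_mono conjI)
          fix i
          show "0 \<le> s" "s \<le> 2 * s - h n $ i"
            using spec[OF elim(2), of i] s by auto
        qed
      also have "\<dots> \<le> real (card (grid_index C (h n))) * (\<Prod>i\<in>UNIV. h n $ i)"
      proof (rule grid_index_lower[OF _ _ cube fin[OF elim(1)]])
        show "0 < h n $ i" for i
          using elim(1) by simp
        show "h n $ i \<le> 2 * s" for i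
          using spec[OF elim(2), of i] s by simp
      qed
      finally show ?case .
    qed
    have "\<forall>\<^sub>F n in sequentially. \<forall>i. h n $ i < 1"
      using eventually_vec_less[OF h(2), of 1] by simp
    with h(1) show "\<forall>\<^sub>F n in sequentially. real (card (grid_index C (h n))) * (\<Prod>i\<in>UNIV. h n $ i) \<le> (2 * b + 1) ^ CARD('d)"
    proof eventually_elim
      case (elim n)
      have "real (card (grid_index C (h n))) * (\<Prod>i\<in>UNIV. h n $ i) \<le> (\<Prod>i\<in>UNIV. 2 * b + h n $ i)"
        using grid_index_upper(2)[of "h n" C b] elim(1) b' b by auto
      also have "\<dots> \<le> (\<Prod>i\<in>(UNIV :: 'd set). 2 * b + 1)"
        by (intro prod_mono) (use elim b in \<open>auto simp: less_imp_le add_nonneg_nonneg\<close>)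
      finally show ?case
        by simp
    qed
  qed
qed

text \<open>Outer regularity covers \<open>F\<close> by an open set of small measure, and
  compactness keeps a whole \<delta>-neighbourhood of \<open>F\<close> inside it. Small cells that
  meet \<open>F\<close> lie in this neighbourhood, so their total volume is small. Finiteness and
  contact are asked only for positive meshes, since \<open>h\<close> is positive only
  eventually.\<close>

lemma negligible_imp_grid_cells_small:
  fixes h :: "nat \<Rightarrow> real ^ 'd" and B :: "nat \<Rightarrow> (int ^ 'd) set"
  assumes F: "compact F" "negligible F"
    and h: "\<forall>\<^sub>F n in sequentially. \<forall>i. 0 < h n $ i" "\<And>i. (\<lambda>n. h n $ i) \<longlonglongrightarrow> 0"
    and fin: "\<And>n. (\<And>i. 0 < h n $ i) \<Longrightarrow> finite (B n)"
    and meets: "\<And>n z. (\<And>i. 0 < h n $ i) \<Longrightarrow> z \<in> B n \<Longrightarrow> cbox (real_vec z * h n) (real_vec z * h n + h n) \<inter> F \<noteq> {}"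
  shows "(\<lambda>n. real (card (B n)) * (\<Prod>i\<in>UNIV. h n $ i)) \<longlonglongrightarrow> 0"
proof (rule LIMSEQ_I)
  fix r :: real
  assume r: "0 < r"
  obtain U where U: "open U" "F \<subseteq> U" "U \<in> lmeasurable" "measure lebesgue U < r"
  proof -
    obtain T where T: "open T" "F \<subseteq> T" "T - F \<in> lmeasurable" "emeasure lebesgue (T - F) < ennreal r"
      using sets_lebesgue_outer_open[of F r] F(2) r negligible_imp_sets by blast
    have "T = F \<union> (T - F)"
      using T(2) by blast
    then have "T \<in> lmeasurable"
      using T(3) F(2) by (metis fmeasurable.Un negligible_imp_measurable)
    moreover have "measure lebesgue T = measure lebesgue (T - F)"
      using measure_negligible_symdiff[OF T(3), of T] F(2) T(2)
      by (simp add: Diff_Diff_Int Un_absorb2 Int_absorb1 Diff_subset)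
    moreover have "measure lebesgue (T - F) < r"
      using T(3,4) r by (simp add: emeasure_eq_measure2 ennreal_less_iff)
    ultimately show ?thesis
      using that T by simp
  qed
  obtain \<delta> where \<delta>: "0 < \<delta>" "(\<Union>u\<in>F. ball u \<delta>) \<subseteq> U"
    using compact_subset_open_imp_ball_epsilon_subset[OF F(1) U(1,2)] by blast
  \<comment> \<open>The l1 bound turns this into a distance below \<delta> between any two points of
    a cell.\<close>
  have "\<forall>\<^sub>F n in sequentially. \<forall>i. h n $ i < \<delta> / CARD('d)"
    using eventually_vec_less[OF h(2)] \<delta>(1) by simp
  with h(1) have "\<forall>\<^sub>F n in sequentially. (\<forall>i. 0 < h n $ i) \<and> (\<forall>i. h n $ i < \<delta> / CARD('d))"
    by (rule eventually_conj)
  then obtain n0 where n0: "\<And>n i. n \<ge> n0 \<Longrightarrow> h n $ i < \<delta> / CARD('d)"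
    and pos: "\<And>n i. n \<ge> n0 \<Longrightarrow> 0 < h n $ i"
    by (auto simp: eventually_sequentially)
  have "norm (real (card (B n)) * (\<Prod>i\<in>UNIV. h n $ i) - 0) < r" if n: "n \<ge> n0" for n
  proof -
    \<comment> \<open>Volumes are added over open cells, which are disjoint; contact with
      \<open>F\<close> is known for the closed cells.\<close>
    let ?cell = "\<lambda>z. box (real_vec z * h n) (real_vec z * h n + h n)"
    have sub: "?cell z \<subseteq> U" if z: "z \<in> B n" for z
    proof
      fix u
      assume u: "u \<in> ?cell z"
      obtain f where f: "f \<in> F" "f \<in> cbox (real_vec z * h n) (real_vec z * h n + h n)"
        using meets[OF pos[OF n] z] by blast
      have "norm (f - u) \<le> (\<Sum>i\<in>UNIV. \<bar>(f - u) $ i\<bar>)"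
        by (rule norm_le_l1_cart)
      also have "\<dots> < (\<Sum>i\<in>(UNIV :: 'd set). \<delta> / CARD('d))"
      proof (rule sum_strict_mono)
        fix i :: 'd
        have "\<bar>(f - u) $ i\<bar> \<le> h n $ i"
          using u[unfolded mem_box_cart, rule_format, of i] f(2)[unfolded mem_box_cart, rule_format, of i]
          by (simp add: abs_le_iff)
        also have "\<dots> < \<delta> / CARD('d)"
          using n0[OF n] .
        finally show "\<bar>(f - u) $ i\<bar> < \<delta> / CARD('d)" .
      qed auto
      also have "\<dots> = \<delta>"
        by simp
      finally show "u \<in> U"
        using f(1) \<delta>(2) unfolding subset_iff by (auto simp: dist_norm)
    qed
    have cell_ne: "u \<notin> ?cell z'" if in_z: "u \<in> ?cell z" and "z \<noteq> z'" for u z z'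
    proof
      assume u': "u \<in> ?cell z'"
      obtain i where i: "z $ i \<noteq> z' $ i"
        using \<open>z \<noteq> z'\<close> by (auto simp: vec_eq_iff)
      have "real_of_int (z $ i) * h n $ i < (z' $ i + 1) * h n $ i"
           "real_of_int (z' $ i) * h n $ i < (z $ i + 1) * h n $ i"
        using in_z[unfolded mem_box_cart, rule_format, of i] u'[unfolded mem_box_cart, rule_format, of i]
        by (simp_all add: real_vec_def algebra_simps)
      then have "real_of_int (z $ i) < z' $ i + 1" "real_of_int (z' $ i) < z $ i + 1"
        using pos[OF n, of i] by (auto simp: mult_less_cancel_right_disj)
      then show False
        using i by linarith
    qed
    have "real (card (B n)) * (\<Prod>i\<in>UNIV. h n $ i) = (\<Sum>z\<in>B n. measure lebesgue (?cell z))"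
    proof -
      have "measure lebesgue (?cell z) = (\<Prod>i\<in>UNIV. h n $ i)" for z
        using pos[OF n] content_cbox_cart[of "real_vec z * h n" "real_vec z * h n + h n"]
        by (simp add: measure_lborel_box_eq measure_lborel_cbox_eq measure_completion interval_ne_empty_cart less_imp_le)
      then show ?thesis
        by simp
    qed
    also have "\<dots> = measure lebesgue (\<Union>z\<in>B n. ?cell z)"
      by (rule measure_finite_Union[symmetric])
        (use fin[OF pos[OF n]] cell_ne in \<open>auto simp: disjoint_family_on_def emeasure_lborel_box_eq\<close>)
    also have "\<dots> \<le> measure lebesgue U"
      using U(3) sub fin[OF pos[OF n]] by (intro measure_mono_fmeasurable) (auto intro!: sets.finite_UN)
    finally have "real (card (B n)) * (\<Prod>i\<in>UNIV. h n $ i) < r"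
      using U(4) by simp
    moreover have "0 \<le> real (card (B n)) * (\<Prod>i\<in>UNIV. h n $ i)"
      using pos[OF n] by (intro mult_nonneg_nonneg prod_nonneg) (auto simp: less_imp_le)
    ultimately show ?thesis
      by simp
  qed
  then show "\<exists>n0. \<forall>n\<ge>n0. norm (real (card (B n)) * (\<Prod>i\<in>UNIV. h n $ i) - 0) < r"
    by blast
qed

section \<open>Exceedances of a stationary field\<close>

text \<open>Linearity of expectation. Through it expected counts become sums of probabilities, to
  which mixing applies.\<close>

lemma (in prob_space) set_integral_card_events:
  assumes "finite I" and H: "\<And>i. i \<in> I \<Longrightarrow> H i \<in> events" and A: "A \<in> events"
  shows "(LINT \<omega>:A|M. real (card {i \<in> I. \<omega> \<in> H i})) = (\<Sum>i\<in>I. prob (H i \<inter> A))"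
proof -
  have "(LINT \<omega>:A|M. real (card {i \<in> I. \<omega> \<in> H i})) = (LINT \<omega>|M. (\<Sum>i\<in>I. indicator (H i \<inter> A) \<omega>))"
    unfolding set_lebesgue_integral_def
  proof (rule Bochner_Integration.integral_cong[OF refl])
    fix \<omega>
    have "real (card {i \<in> I. \<omega> \<in> H i}) = (\<Sum>i\<in>I. indicator (H i) \<omega>)"
      using assms(1) by (simp add: indicator_def sum.If_cases Int_def)
    then show "indicator A \<omega> *\<^sub>R real (card {i \<in> I. \<omega> \<in> H i}) = (\<Sum>i\<in>I. indicator (H i \<inter> A) \<omega>)"
      by (simp add: indicator_inter_arith sum_distrib_left mult.commute)
  qed
  also have "\<dots> = (\<Sum>i\<in>I. prob (H i \<inter> A))"
    using H A by (subst Bochner_Integration.integral_sum) (auto simp: emeasure_eq_measure)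
  finally show ?thesis .
qed

lemma (in prob_space) prob_Int_diff_le:
  assumes "A \<in> events" "B \<in> events" "E \<in> events" "A \<subseteq> B"
  shows "prob (A \<inter> E) \<le> prob (B \<inter> E)" "prob (B \<inter> E) \<le> prob (A \<inter> E) + prob (B - A)"
proof -
  show "prob (A \<inter> E) \<le> prob (B \<inter> E)"
    using assms by (intro finite_measure_mono) auto
  have "prob (B \<inter> E) \<le> prob ((A \<inter> E) \<union> (B - A))"
    using assms by (intro finite_measure_mono) auto
  also have "\<dots> \<le> prob (A \<inter> E) + prob (B - A)"
    using assms by (intro measure_Un_le) auto
  finally show "prob (B \<inter> E) \<le> prob (A \<inter> E) + prob (B - A)" .
qed

section \<open>Exceedance events and stationarity\<close>

locale exceedances = prob_space M for M :: "'a measure" +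
  fixes \<xi> :: "int ^ 'd \<Rightarrow> 'a \<Rightarrow> real"
  assumes stationary: "stationary_field M \<xi>"
begin

definition exc :: "real \<Rightarrow> int ^ 'd \<Rightarrow> 'a set" where
  "exc x v = {\<omega> \<in> space M. \<xi> v \<omega> > x}"

definition hit :: "real \<Rightarrow> (int ^ 'd) set \<Rightarrow> 'a set" where
  "hit x A = {\<omega> \<in> space M. \<exists>v\<in>A. \<xi> v \<omega> > x}"

lemma measurable_field [measurable]: "\<xi> v \<in> borel_measurable M"
  using stationary by (simp add: stationary_field_def)

lemma exc_events [simp, measurable]: "exc x v \<in> events"
  unfolding exc_def by measurable

lemma hit_eq_UN: "hit x A = (\<Union>v\<in>A. exc x v)"
  by (auto simp: hit_def exc_def)

lemma hit_events [simp, measurable]: "hit x A \<in> events"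
  unfolding hit_eq_UN by (intro sets.countable_UN') auto

lemma hit_mono: "A \<subseteq> B \<Longrightarrow> hit x A \<subseteq> hit x B"
  by (auto simp: hit_def)

text \<open>Translates the mixing conditions into statements about \<open>hit\<close>. The empty
  set, which a core may be, is covered because its supremum is -\<infinity>.\<close>

lemma field_max_le_eq: "{\<omega> \<in> space M. field_max \<xi> A \<omega> \<le> ereal x} = space M - hit x A"
  by (auto simp: field_max_def hit_def SUP_le_iff not_less)

text \<open>Both sides are values of the laws compared in \<open>stationary_field\<close>; the
  unshifted one is the shift by 0.\<close>

lemma prob_shift:
  assumes S: "S \<in> sets (PiM UNIV (\<lambda>_. borel))"
  shows "prob {\<omega> \<in> space M. (\<lambda>v. \<xi> (v + w) \<omega>) \<in> S} = prob {\<omega> \<in> space M. (\<lambda>v. \<xi> v \<omega>) \<in> S}"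
proof -
  let ?P = "PiM UNIV (\<lambda>_ :: int ^ 'd. borel :: real measure)"
  have meas: "(\<lambda>\<omega> v. \<xi> (v + u) \<omega>) \<in> M \<rightarrow>\<^sub>M ?P" for u
    by (rule measurable_PiM_single') auto
  have "prob {\<omega> \<in> space M. (\<lambda>v. \<xi> (v + u) \<omega>) \<in> S} = measure (distr M ?P (\<lambda>\<omega> v. \<xi> (v + u) \<omega>)) S" for u
    by (subst measure_distr[OF meas S]) (auto intro!: arg_cong[where f = prob])
  from this[of w] this[of 0] show ?thesis
    using stationary by (simp add: stationary_field_def)
qed

text \<open>Countability of the lattice puts the event into the product \<sigma>-algebra for every
  \<open>A\<close>. This carries the probability of being a last exceedance from 0 to any site;
  \<open>A = {}\<close> yields \<open>prob_exc\<close>.\<close>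

lemma prob_exc_diff_hit_shift:
  "prob (exc x w - hit x ((+) w ` A)) = prob (exc x 0 - hit x A)"
proof -
  let ?P = "PiM UNIV (\<lambda>_ :: int ^ 'd. borel :: real measure)"
  let ?S = "{f \<in> space ?P. f 0 > x \<and> \<not> (\<exists>v\<in>A. f v > x)}"
  have [measurable]: "countable A" 
    by simp
  have S: "?S \<in> sets ?P"
    by measurable
  have "exc x w - hit x ((+) w ` A) = {\<omega> \<in> space M. (\<lambda>v. \<xi> (v + w) \<omega>) \<in> ?S}"
    by (auto simp: exc_def hit_def space_PiM add.commute)
  moreover have "exc x 0 - hit x A = {\<omega> \<in> space M. (\<lambda>v. \<xi> v \<omega>) \<in> ?S}"
    by (auto simp: exc_def hit_def space_PiM)
  ultimately show ?thesis
    using prob_shift[OF S, of w] by simp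
qed

lemma prob_exc: "prob (exc x v) = prob (exc x 0)"
  using prob_exc_diff_hit_shift[of x v "{}"] by (simp add: hit_def)

lemma prob_hit_shift: "prob (hit x ((+) w ` A)) = prob (hit x A)"
proof -
  let ?P = "PiM UNIV (\<lambda>_ :: int ^ 'd. borel :: real measure)"
  let ?S = "{f \<in> space ?P. \<exists>v\<in>A. f v > x}"
  have [measurable]: "countable A" 
    by simp
  have S: "?S \<in> sets ?P"
    by measurable
  have "hit x ((+) w ` A) = {\<omega> \<in> space M. (\<lambda>v. \<xi> (v + w) \<omega>) \<in> ?S}"
    by (auto simp: hit_def space_PiM add.commute)
  moreover have "hit x A = {\<omega> \<in> space M. (\<lambda>v. \<xi> v \<omega>) \<in> ?S}"
    by (auto simp: hit_def space_PiM)
  ultimately show ?thesis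
    using prob_shift[OF S, of w] by simp
qed

lemma prob_hit_le:
  assumes "finite A"
  shows "prob (hit x A) \<le> card A * prob (exc x 0)"
proof -
  have "prob (hit x A) \<le> (\<Sum>v\<in>A. prob (exc x v))"
    unfolding hit_eq_UN using assms by (intro finite_measure_subadditive_finite) auto
  also have "\<dots> = (\<Sum>v\<in>A. prob (exc x 0))"
    by (intro sum.cong refl prob_exc)
  finally show ?thesis
    by simp
qed

text \<open>Splitting \<open>hit x J\<close> according to the last exceedance in the order: inside \<open>J\<close> it has
  no successor, so only successors outside \<open>J\<close> can spoil the event that it is last in its own
  neighbourhood.\<close>

lemma prob_hit_last_exceedance:
  assumes R: "translation_invariant_total_order R" and fin: "finite J"
    and A: "\<And>v z. v \<in> J \<Longrightarrow> z \<in> J \<Longrightarrow> (v, z) \<in> R \<Longrightarrow> v \<noteq> z \<Longrightarrow> z \<in> (+) v ` A"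
    and A': "\<And>z. z \<in> A \<Longrightarrow> (0, z) \<in> R \<and> z \<noteq> 0"
    and B: "\<And>v. v \<in> J \<Longrightarrow> (+) v ` A - J \<subseteq> B"
  shows "card J * prob (exc x 0 - hit x A) \<le> prob (hit x J)"
    and "prob (hit x J) \<le> card J * prob (exc x 0 - hit x A) + prob (hit x J \<inter> hit x B)"
proof -
  let ?V = "\<lambda>v. exc x v - hit x ((+) v ` A)"
  have lin: "linear_order_on UNIV R" and inv: "\<And>u v w. (u, v) \<in> R \<Longrightarrow> (u + w, v + w) \<in> R"
    using R by (auto simp: translation_invariant_total_order_def)
  have tot: "(u, v) \<in> R \<or> (v, u) \<in> R" for u v
    using lin by (cases "u = v") (auto simp: linear_order_on_def partial_order_on_def preorder_on_def total_on_def refl_on_def)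
  have antis: "(u, v) \<in> R \<Longrightarrow> (v, u) \<in> R \<Longrightarrow> u = v" for u v
    using lin by (auto simp: linear_order_on_def partial_order_on_def antisym_def)
  have trans: "(u, v) \<in> R \<Longrightarrow> (v, w) \<in> R \<Longrightarrow> (u, w) \<in> R" for u v w
    using lin by (meson linear_order_on_def partial_order_on_def preorder_on_def transE)
  have sum: "prob (\<Union>v\<in>J. ?V v) = card J * prob (exc x 0 - hit x A)"
  proof -
    \<comment> \<open>If two sites of \<open>J\<close> were both last, the later one would be an
      exceedance among the successors of the earlier one.\<close>
    have "disjoint_family_on ?V J"
      unfolding disjoint_family_on_def
    proof (intro ballI impI equals0I)
      fix u v \<omega>
      assume uv: "u \<in> J" "v \<in> J" "u \<noteq> v" and "\<omega> \<in> ?V u \<inter> ?V v"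
      then show False
        using tot[of u v] A[of u v] A[of v u] by (auto simp: exc_def hit_def)
    qed
    then have "prob (\<Union>v\<in>J. ?V v) = (\<Sum>v\<in>J. prob (?V v))"
      using fin by (intro finite_measure_finite_Union) auto
    then show ?thesis
      by (simp add: prob_exc_diff_hit_shift)
  qed
  have "prob (\<Union>v\<in>J. ?V v) \<le> prob (hit x J)"
    by (intro finite_measure_mono) (auto simp: hit_eq_UN)
  then show "card J * prob (exc x 0 - hit x A) \<le> prob (hit x J)"
    by (simp add: sum)
  have "hit x J \<subseteq> (\<Union>v\<in>J. ?V v) \<union> (hit x J \<inter> hit x B)"
  proof
    fix \<omega>
    assume \<omega>: "\<omega> \<in> hit x J"
    define G where "G = {v \<in> J. \<xi> v \<omega> > x}"
    have G: "finite G" "G \<noteq> {}"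
      using \<omega> fin by (auto simp: G_def hit_def)
    from G have "\<exists>v\<in>G. \<forall>z\<in>G. (v, z) \<in> R \<longrightarrow> v = z"
    proof (induction rule: finite_ne_induct)
      case (singleton u)
      then show ?case by simp
    next
      case (insert u F)
      then obtain v where "v \<in> F" "\<And>z. z \<in> F \<Longrightarrow> (v, z) \<in> R \<Longrightarrow> v = z"
        by auto
      then show ?case
        using tot[of u v] trans antis by (metis insert_iff)
    qed
    then obtain v where v: "v \<in> G" "\<And>z. z \<in> G \<Longrightarrow> (v, z) \<in> R \<Longrightarrow> v = z"
      by blast
    show "\<omega> \<in> (\<Union>v\<in>J. ?V v) \<union> (hit x J \<inter> hit x B)"
    proof (cases "\<omega> \<in> hit x ((+) v ` A)")
      case False
      then show ?thesis
        using v(1) \<omega> by (auto simp: G_def exc_def hit_def)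
    next
      case True
      then obtain z where z: "z \<in> A" "\<xi> (v + z) \<omega> > x"
        by (auto simp: hit_def)
      have "(v, v + z) \<in> R" "v \<noteq> v + z"
        using A'[OF z(1)] inv[of 0 z v] by (auto simp: add.commute)
      then have "v + z \<notin> J"
        using v(2)[of "v + z"] z(2) by (auto simp: G_def)
      then have "v + z \<in> B"
        using B[of v] v(1) z(1) by (auto simp: G_def)
      then show ?thesis
        using \<omega> z(2) by (auto simp: hit_def)
    qed
  qed
  then have "prob (hit x J) \<le> prob ((\<Union>v\<in>J. ?V v) \<union> (hit x J \<inter> hit x B))"
    using fin by (intro finite_measure_mono) auto
  also have "\<dots> \<le> prob (\<Union>v\<in>J. ?V v) + prob (hit x J \<inter> hit x B)"
    using fin by (intro measure_Un_le) auto
  finally show "prob (hit x J) \<le> card J * prob (exc x 0 - hit x A) + prob (hit x J \<inter> hit x B)"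
    by (simp add: sum)
qed

section \<open>Decoupling a set of sites from a separated event\<close>

text \<open>Mixing is assumed for the smaller set \<open>A\<close> and transferred to
  \<open>J\<close>. The enlargement changes the joint probability and the product each by at most
  the expected number of exceedances in \<open>J - A\<close>; hence the factor 2.\<close>

lemma hit_mixing:
  fixes \<alpha> :: real
  assumes J: "finite J" "A \<subseteq> J" and E: "E \<in> events"
    and mix: "\<bar>prob ({\<omega> \<in> space M. field_max \<xi> A \<omega> \<le> ereal x} \<inter> E)
      - prob {\<omega> \<in> space M. field_max \<xi> A \<omega> \<le> ereal x} * prob E\<bar> \<le> \<alpha>"
  shows "\<bar>prob (hit x J \<inter> E) - prob (hit x J) * prob E\<bar> \<le> \<alpha> + 2 * (card (J - A) * prob (exc x 0))"
proof -
  have "hit x J - hit x A \<subseteq> hit x (J - A)"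
    by (auto simp: hit_def)
  then have diff: "prob (hit x J - hit x A) \<le> card (J - A) * prob (exc x 0)"
    using prob_hit_le[of "J - A" x] J finite_measure_mono[of "hit x J - hit x A" "hit x (J - A)"] by auto
  have E_split: "prob ((space M - hit x A) \<inter> E) = prob E - prob (hit x A \<inter> E)"
  proof -
    have "(space M - hit x A) \<inter> E = E - hit x A \<inter> E"
      using sets.sets_into_space[OF E] by auto
    then show ?thesis
      using E by (simp add: finite_measure_Diff)
  qed
  have "\<bar>prob (hit x A \<inter> E) - prob (hit x A) * prob E\<bar> \<le> \<alpha>"
    using mix unfolding field_max_le_eq E_split by (simp add: prob_compl algebra_simps)
  moreover have "prob (hit x A \<inter> E) \<le> prob (hit x J \<inter> E)"
      "prob (hit x J \<inter> E) \<le> prob (hit x A \<inter> E) + prob (hit x J - hit x A)"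
    using prob_Int_diff_le[of "hit x A" "hit x J" E] hit_mono[OF J(2)] E by auto
  moreover have "prob (hit x A) \<le> prob (hit x J)" "prob (hit x J) \<le> prob (hit x A) + prob (hit x J - hit x A)"
    using prob_Int_diff_le[of "hit x A" "hit x J" "space M"] hit_mono[OF J(2)]
    by (auto simp: Int_absorb2 sets.sets_into_space)
  moreover from this have "prob (hit x A) * prob E \<le> prob (hit x J) * prob E"
      "prob (hit x J) * prob E \<le> prob (hit x A) * prob E + prob (hit x J - hit x A)"
  proof -
    assume le: "prob (hit x A) \<le> prob (hit x J)" "prob (hit x J) \<le> prob (hit x A) + prob (hit x J - hit x A)"
    show "prob (hit x A) * prob E \<le> prob (hit x J) * prob E"
      using le(1) by (simp add: mult_right_mono)
    have "prob (hit x J) * prob E \<le> (prob (hit x A) + prob (hit x J - hit x A)) * prob E"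
      using le(2) by (simp add: mult_right_mono)
    moreover have "prob (hit x J - hit x A) * prob E \<le> prob (hit x J - hit x A)"
      by (simp add: mult_left_le)
    ultimately show "prob (hit x J) * prob E \<le> prob (hit x A) * prob E + prob (hit x J - hit x A)"
      by (simp add: distrib_right)
  qed
  ultimately show ?thesis
    using diff by linarith
qed

text \<open>Sites of \<open>A\<close> are decoupled one by one. For the others both the joint
  probability and the product lie between 0 and the probability of an exceedance, so their
  difference costs that probability once.\<close>

lemma exceedance_count_mixing:
  fixes \<alpha> :: real
  assumes J: "finite J" "A \<subseteq> J" and E: "E \<in> events" and "0 \<le> \<alpha>"
    and mix: "\<And>v. v \<in> A \<Longrightarrow> \<bar>prob (exc x v \<inter> E) - prob (exc x v) * prob E\<bar> \<le> \<alpha>"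
  shows "\<bar>(\<Sum>v\<in>J. prob (exc x v \<inter> E)) - card J * prob (exc x 0) * prob E\<bar>
    \<le> card J * \<alpha> + card (J - A) * prob (exc x 0)"
proof -
  have "(\<Sum>v\<in>J. prob (exc x v) * prob E) = (\<Sum>v\<in>J. prob (exc x 0) * prob E)"
    by (intro sum.cong refl arg_cong2[where f = "(*)"] prob_exc)
  then have "(\<Sum>v\<in>J. prob (exc x v \<inter> E)) - card J * prob (exc x 0) * prob E
      = (\<Sum>v\<in>J. prob (exc x v \<inter> E) - prob (exc x v) * prob E)"
    by (simp add: sum_subtractf)
  then have "\<bar>(\<Sum>v\<in>J. prob (exc x v \<inter> E)) - card J * prob (exc x 0) * prob E\<bar>
      \<le> (\<Sum>v\<in>J. \<bar>prob (exc x v \<inter> E) - prob (exc x v) * prob E\<bar>)"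
    by simp
  also have "\<dots> \<le> (\<Sum>v\<in>J. \<alpha> + (if v \<in> J - A then prob (exc x 0) else 0))"
  proof (rule sum_mono)
    fix v
    assume v: "v \<in> J"
    have "prob (exc x v \<inter> E) \<le> prob (exc x v)"
      by (intro finite_measure_mono) auto
    moreover have "prob (exc x v) * prob E \<le> prob (exc x v)"
      by (simp add: mult_left_le)
    ultimately have "\<bar>prob (exc x v \<inter> E) - prob (exc x v) * prob E\<bar> \<le> prob (exc x v)"
      by (smt (verit) measure_nonneg mult_nonneg_nonneg)
    then show "\<bar>prob (exc x v \<inter> E) - prob (exc x v) * prob E\<bar> \<le> \<alpha> + (if v \<in> J - A then prob (exc x 0) else 0)"
      using mix[of v] v \<open>0 \<le> \<alpha>\<close> prob_exc[of x v] by auto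
  qed
  also have "\<dots> = card J * \<alpha> + card (J - A) * prob (exc x 0)"
    using J(1) by (simp add: sum.distrib sum.If_cases Diff_eq Collect_neg_eq)
  finally show ?thesis .
qed

section \<open>Events determined by a finite exceedance pattern\<close>

lemma exceedance_sigma_subset_field_sigma: "exceedance_sigma M \<xi> x B \<subseteq> field_sigma M \<xi>"
proof -
  let ?P = "PiM UNIV (\<lambda>_ :: int ^ 'd. borel :: real measure)"
  let ?F = "vimage_algebra (space M) (\<lambda>\<omega> v. \<xi> v \<omega>) ?P"
  have "{\<omega> \<in> space M. \<xi> v \<omega> > x} \<in> sets ?F" for v
  proof -
    have "{f \<in> space ?P. f v > x} \<in> sets ?P"
      by measurable
    from in_vimage_algebra[OF this, of "\<lambda>\<omega> v. \<xi> v \<omega>" "space M"] show ?thesis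
      by (simp add: space_PiM vimage_def Int_def conj_commute)
  qed
  then have "sigma_sets (space ?F) ((\<lambda>v. {\<omega> \<in> space M. \<xi> v \<omega> > x}) ` B) \<subseteq> sets ?F"
    by (intro sets.sigma_sets_subset) auto
  then show ?thesis
    by (simp add: exceedance_sigma_def field_sigma_def)
qed

lemma exceedance_sigma_subset_events: "exceedance_sigma M \<xi> x B \<subseteq> events"
  unfolding exceedance_sigma_def by (intro sets.sigma_sets_subset) auto

lemma field_sigma_subset_events: "field_sigma M \<xi> \<subseteq> events"
proof -
  have "(\<lambda>\<omega> v. \<xi> v \<omega>) \<in> M \<rightarrow>\<^sub>M PiM UNIV (\<lambda>_. borel)"
    by (rule measurable_PiM_single') auto
  then show ?thesis
    unfolding field_sigma_def by (intro sets_image_in_sets) auto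
qed

text \<open>Induction on \<open>D\<close> for all predicates at once: according to whether the new
  site \<open>a\<close> exceeds, \<open>P\<close> is applied to the old pattern with or without
  \<open>a\<close>.\<close>

lemma exceedance_pattern_sigma:
  assumes "finite D" "D \<subseteq> B"
  shows "{\<omega> \<in> space M. P {v \<in> D. \<xi> v \<omega> > x}} \<in> exceedance_sigma M \<xi> x B"
proof -
  let ?\<Sigma> = "exceedance_sigma M \<xi> x B"
  interpret \<Sigma>: sigma_algebra "space M" ?\<Sigma>
    unfolding exceedance_sigma_def by (rule sigma_algebra_sigma_sets) auto
  show ?thesis
    using assms
  proof (induction D arbitrary: P)
    case empty
    then show ?case
      by (cases "P {}") auto
  next
    case (insert a D)
    let ?a = "{\<omega> \<in> space M. \<xi> a \<omega> > x}"
    have a: "?a \<in> ?\<Sigma>"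
      using insert.prems by (auto simp: exceedance_sigma_def)
    have 1: "{\<omega> \<in> space M. P (insert a {v \<in> D. \<xi> v \<omega> > x})} \<in> ?\<Sigma>"
      using insert.IH[of "\<lambda>G. P (insert a G)"] insert.prems by simp
    have 2: "{\<omega> \<in> space M. P {v \<in> D. \<xi> v \<omega> > x}} \<in> ?\<Sigma>"
      using insert.IH[of P] insert.prems by simp
    have eq: "{v \<in> insert a D. \<xi> v \<omega> > x} =
        (if \<xi> a \<omega> > x then insert a {v \<in> D. \<xi> v \<omega> > x} else {v \<in> D. \<xi> v \<omega> > x})" for \<omega>
      by auto
    have "{\<omega> \<in> space M. P {v \<in> insert a D. \<xi> v \<omega> > x}}
        = (?a \<inter> {\<omega> \<in> space M. P (insert a {v \<in> D. \<xi> v \<omega> > x})})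
          \<union> ({\<omega> \<in> space M. P {v \<in> D. \<xi> v \<omega> > x}} - ?a)"
      unfolding eq by auto
    also have "\<dots> \<in> ?\<Sigma>"
      using a 1 2 by (intro \<Sigma>.Un \<Sigma>.Int \<Sigma>.Diff)
    finally show ?case .
  qed
qed

lemma exceedance_pattern_field_sigma:
  "finite D \<Longrightarrow> {\<omega> \<in> space M. P {v \<in> D. \<xi> v \<omega> > x}} \<in> field_sigma M \<xi>"
  using exceedance_pattern_sigma[OF _ order_refl] exceedance_sigma_subset_field_sigma by blast

lemma exceedance_pattern_events:
  "finite D \<Longrightarrow> {\<omega> \<in> space M. P {v \<in> D. \<xi> v \<omega> > x}} \<in> events"
  using exceedance_pattern_field_sigma field_sigma_subset_events by blast

lemma exceedance_pattern_measurable: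
  assumes "finite D"
  shows "(\<lambda>\<omega>. {v \<in> D. \<xi> v \<omega> > x}) \<in> M \<rightarrow>\<^sub>M count_space (Pow D)"
  using exceedance_pattern_events[OF assms, of "\<lambda>G. G = _" x] assms
  by (subst measurable_count_space_eq2) (auto simp: vimage_def Int_def conj_commute)

text \<open>Write N for the number of hit sets. On N = j + 1 the left product is the expectation of
  N, that is, a sum over z of the probability that z is hit and exactly j others are. Mixing
  separates these two events.\<close>

lemma prob_count_eq_Suc:
  fixes h \<epsilon> :: real and j :: nat
  assumes fin: "finite Q" and h: "\<And>z. z \<in> Q \<Longrightarrow> prob (hit x (J z)) = h"
    and E: "\<And>z. E z = {\<omega> \<in> space M. card {z' \<in> Q - {z}. \<omega> \<in> hit x (J z')} = j}"
    and mix: "\<And>z. z \<in> Q \<Longrightarrow> \<bar>prob (hit x (J z) \<inter> E z) - h * prob (E z)\<bar> \<le> \<epsilon>"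
  shows "\<bar>(j + 1) * prob {\<omega> \<in> space M. card {z \<in> Q. \<omega> \<in> hit x (J z)} = j + 1}
      - card Q * h * prob {\<omega> \<in> space M. card {z \<in> Q. \<omega> \<in> hit x (J z)} = j}\<bar> \<le> card Q * (\<epsilon> + h\<^sup>2)"
proof -
  let ?F = "{\<omega> \<in> space M. card {z \<in> Q. \<omega> \<in> hit x (J z)} = j + 1}"
  let ?G = "{\<omega> \<in> space M. card {z \<in> Q. \<omega> \<in> hit x (J z)} = j}"
  have meas: "{\<omega> \<in> space M. card {z \<in> Q'. \<omega> \<in> hit x (J z)} = i} \<in> events" if "finite Q'" for Q' i
  proof -
    have eq: "card {z \<in> Q'. \<omega> \<in> hit x (J z)} = (\<Sum>z\<in>Q'. of_bool (\<omega> \<in> hit x (J z)))" for \<omega>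
      using that by (simp add: sum.If_cases of_bool_def Int_def)
    show ?thesis
      unfolding eq by measurable
  qed
  have card_remove: "card {z' \<in> Q. \<omega> \<in> hit x (J z')} = 
      card {z' \<in> Q - {z}. \<omega> \<in> hit x (J z')} + of_bool (\<omega> \<in> hit x (J z))" if "z \<in> Q" for z \<omega>
  proof (cases "\<omega> \<in> hit x (J z)")
    case True
    then have "{z' \<in> Q. \<omega> \<in> hit x (J z')} = insert z {z' \<in> Q - {z}. \<omega> \<in> hit x (J z')}"
      using that by auto
    then show ?thesis
      using True fin by (simp add: insert_absorb)
  next
    case False
    then have "{z' \<in> Q. \<omega> \<in> hit x (J z')} = {z' \<in> Q - {z}. \<omega> \<in> hit x (J z')}"
      by auto
    then show ?thesis
      using False by simp
  qed
  have "(j + 1) * prob ?F = (LINT \<omega>:?F|M. real (card {z \<in> Q. \<omega> \<in> hit x (J z)}))"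
  proof -
    have "(LINT \<omega>:?F|M. real (card {z \<in> Q. \<omega> \<in> hit x (J z)})) = (LINT \<omega>:?F|M. real (j + 1))"
      using meas[OF fin] by (intro set_lebesgue_integral_cong) auto
    then show ?thesis
      using meas[OF fin] by (simp add: set_integral_const emeasure_eq_measure)
  qed
  also have "\<dots> = (\<Sum>z\<in>Q. prob (hit x (J z) \<inter> ?F))"
    using set_integral_card_events[OF fin, of "\<lambda>z. hit x (J z)" ?F] meas[OF fin] by simp
  also have "\<dots> = (\<Sum>z\<in>Q. prob (hit x (J z) \<inter> E z))"
  proof (intro sum.cong refl arg_cong[where f = prob])
    fix z
    assume "z \<in> Q"
    then show "hit x (J z) \<inter> ?F = hit x (J z) \<inter> E z"
      using card_remove[of z] by (auto simp: E)
  qed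
  finally have F: "(j + 1) * prob ?F = (\<Sum>z\<in>Q. prob (hit x (J z) \<inter> E z))" .
  \<comment> \<open>\<open>E z\<close> and \<open>?G\<close> differ only where z is hit, so their
    probabilities differ by at most \<open>h\<close>; the prefactor \<open>h\<close> makes this
    \<open>h\<^sup>2\<close>.\<close>
  have "\<bar>prob (hit x (J z) \<inter> E z) - h * prob ?G\<bar> \<le> \<epsilon> + h\<^sup>2" if z: "z \<in> Q" for z
  proof -
    have Ez: "E z \<in> events"
      unfolding E by (rule meas) (use fin in simp)
    have h0: "0 \<le> h"
      using h[OF z] by (metis measure_nonneg)
    have "prob (E z) \<le> prob (?G \<union> hit x (J z))"
      using Ez meas[OF fin] card_remove[OF z] by (intro finite_measure_mono) (auto simp: E)
    also have "\<dots> \<le> prob ?G + h"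
      using measure_Un_le[of ?G M "hit x (J z)"] meas[OF fin] h[OF z] by simp
    finally have 1: "prob (E z) \<le> prob ?G + h" .
    have "prob ?G \<le> prob (E z \<union> hit x (J z))"
      using Ez meas[OF fin] card_remove[OF z] by (intro finite_measure_mono) (auto simp: E)
    also have "\<dots> \<le> prob (E z) + h"
      using measure_Un_le[of "E z" M "hit x (J z)"] Ez h[OF z] by simp
    finally have 2: "prob ?G \<le> prob (E z) + h" .
    have "\<bar>h * prob (E z) - h * prob ?G\<bar> = h * \<bar>prob (E z) - prob ?G\<bar>"
      using h0 by (simp add: abs_mult flip: right_diff_distrib)
    also have "\<dots> \<le> h * h"
      using 1 2 h0 by (intro mult_left_mono) auto
    finally show ?thesis
      using mix[OF z] by (simp add: power2_eq_square)
  qed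
  then have "\<bar>\<Sum>z\<in>Q. prob (hit x (J z) \<inter> E z) - h * prob ?G\<bar> \<le> (\<Sum>z\<in>Q. \<epsilon> + h\<^sup>2)"
    by (intro order_trans[OF sum_abs] sum_mono)
  then show ?thesis
    unfolding F by (simp add: sum_subtractf mult.assoc)
qed

end

section \<open>Geometry of the boxes\<close>

definition side :: "(nat \<Rightarrow> real ^ 'd) \<Rightarrow> (nat \<Rightarrow> nat) \<Rightarrow> nat \<Rightarrow> 'd \<Rightarrow> int" where
  "side c k n i = \<lfloor>c n $ i / root CARD('d) (real (k n))\<rfloor>"

text \<open>The mesh of the rescaled grid: \<open>grid_point c k n z\<close> equals
  \<open>real_vec z * cell_vec c k n\<close>.\<close>

definition cell_vec :: "(nat \<Rightarrow> real ^ 'd) \<Rightarrow> (nat \<Rightarrow> nat) \<Rightarrow> nat \<Rightarrow> real ^ 'd" where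
  "cell_vec c k n = vec_divide (side_vec c k n) (c n)"

text \<open>The sign of \<gamma> is not prescribed, hence the absolute value; rounding up keeps the
  bounds integral. The core is empty when the two layers removed in some direction use up the
  side.\<close>

definition core ::
  "(nat \<Rightarrow> real ^ 'd) \<Rightarrow> (nat \<Rightarrow> nat) \<Rightarrow> (nat \<Rightarrow> real ^ 'd) \<Rightarrow> nat \<Rightarrow> int ^ 'd \<Rightarrow> (int ^ 'd) set" where
  "core c k \<gamma> n z = {v. \<forall>i. z $ i * side c k n i + \<lceil>\<bar>\<gamma> n $ i\<bar>\<rceil> \<le> v $ i
     \<and> v $ i < (z $ i + 1) * side c k n i - \<lceil>\<bar>\<gamma> n $ i\<bar>\<rceil>}"

text \<open>A block of 3 boxes per direction. \<open>Aset\<close> reaches one side length each way,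
  so its translate to a site of box z stays in this block.\<close>

definition surround :: "(nat \<Rightarrow> real ^ 'd) \<Rightarrow> (nat \<Rightarrow> nat) \<Rightarrow> nat \<Rightarrow> int ^ 'd \<Rightarrow> (int ^ 'd) set" where
  "surround c k n z = {v. \<forall>i. (z $ i - 1) * side c k n i \<le> v $ i \<and> v $ i < (z $ i + 2) * side c k n i}"

text \<open>Sites of \<open>z\<close> and \<open>z'\<close> at most the linking distance \<open>\<surd>d / k\<^sup>1\<^sup>/\<^sup>d\<close> apart force \<^term>\<open>near z z'\<close>, because the
  rounded side of a box is at least half of \<open>c / k\<^sup>1\<^sup>/\<^sup>d\<close>.\<close>

definition near :: "int ^ 'd \<Rightarrow> int ^ 'd \<Rightarrow> bool" where
  "near z z' \<longleftrightarrow> (\<forall>i. \<bar>z' $ i - z $ i\<bar> \<le> \<lceil>2 * sqrt (real CARD('d))\<rceil> + 1)"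

lemma side_vec_nth: "side_vec c k n $ i = real_of_int (side c k n i)"
  by (simp add: side_vec_def side_def)

lemma cell_vec_nth: "cell_vec c k n $ i = real_of_int (side c k n i) / c n $ i"
  by (simp add: cell_vec_def vec_divide_def side_vec_nth)

lemma Qminus_eq_grid_index: "Qminus C c k n = grid_index C (cell_vec c k n)"
proof -
  have "grid_point c k n z = real_vec z * cell_vec c k n" for z
    by (simp add: vec_eq_iff grid_point_def vec_divide_def cell_vec_def)
  then show ?thesis
    by (simp add: Qminus_def grid_index_def)
qed

lemma mem_lattice_points_scaled:
  assumes "\<And>i. 0 < c $ i"
  shows "v \<in> lattice_points (scale_set c C) \<longleftrightarrow> vec_divide (real_vec v) c \<in> C"
proof -
  have "real_vec v = c * vec_divide (real_vec v) c"
    using assms by (simp add: vec_eq_iff vec_divide_def less_imp_neq[symmetric])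
  moreover have "vec_divide (c * a) c = a" for a
    using assms by (simp add: vec_eq_iff vec_divide_def less_imp_neq[symmetric])
  ultimately show ?thesis
    by (force simp: lattice_points_def scale_set_def)
qed

text \<open>Brings the cardinality in the hypothesis on \<tau> under the general grid count.\<close>

lemma lattice_points_scaled_eq_grid_index:
  assumes "\<And>i. 0 < c $ i"
  shows "lattice_points (scale_set c C) = grid_index C (\<chi> i. 1 / c $ i)"
proof -
  have "vec_divide (real_vec v) c = real_vec v * (\<chi> i. 1 / c $ i)" for v
    by (simp add: vec_eq_iff vec_divide_def)
  then show ?thesis
    using mem_lattice_points_scaled[OF assms] by (auto simp: grid_index_def)
qed


section \<open>Boxes, cores and blocks at one index with positive sides\<close>

context
  fixes c :: "nat \<Rightarrow> real ^ 'd" and k :: "nat \<Rightarrow> nat" and n :: nat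
  assumes side_pos: "\<And>i. 0 < side c k n i" and c_pos: "\<And>i. 0 < c n $ i" and k_pos: "0 < k n"
begin

lemma side_ne: "side c k n i \<noteq> 0"
  using side_pos[of i] by simp

lemma side_le: "real_of_int (side c k n i) \<le> c n $ i / root CARD('d) (real (k n))"
  unfolding side_def by (rule of_int_floor_le)

text \<open>A number whose floor is at least 1 is at most twice its floor. The powers of 2 in the
  comparison of \<open>k m\<close> with the volume come from here, as does the 2 in
  \<open>near\<close>.\<close>

lemma le_2_side: "c n $ i / root CARD('d) (real (k n)) \<le> 2 * real_of_int (side c k n i)"
  using side_pos[of i] unfolding side_def by linarith

lemma mem_Ibox:
  "u \<in> Ibox c k n z \<longleftrightarrow> (\<forall>i. z $ i * side c k n i \<le> u $ i \<and> u $ i < (z $ i + 1) * side c k n i)"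
proof
  assume "u \<in> Ibox c k n z"
  then obtain w where w: "\<And>i. 0 \<le> w $ i \<and> w $ i < 1" and u: "u = side_vec c k n * (real_vec z + w)"
    by (auto simp: Ibox_def scale_set_def)
  have "u $ i = z $ i * side c k n i + w $ i * side c k n i" for i
    unfolding u by (simp add: side_vec_nth real_vec_def algebra_simps)
  moreover have "0 \<le> w $ i * side c k n i" "w $ i * side c k n i < 1 * side c k n i" for i
    using w[of i] side_pos[of i] by (simp_all add: mult_strict_right_mono)
  ultimately show "\<forall>i. z $ i * side c k n i \<le> u $ i \<and> u $ i < (z $ i + 1) * side c k n i"
    by (simp add: algebra_simps)
next
  assume u: "\<forall>i. z $ i * side c k n i \<le> u $ i \<and> u $ i < (z $ i + 1) * side c k n i"
  define w :: "real ^ 'd" where "w = (\<chi> i. u $ i / side c k n i - z $ i)"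
  have "0 \<le> w $ i \<and> w $ i < 1" for i
    using u side_pos[of i] by (simp add: w_def pos_le_divide_eq pos_divide_less_eq field_simps)
  moreover have "u = side_vec c k n * (real_vec z + w)"
    by (simp add: vec_eq_iff w_def side_vec_nth real_vec_def side_ne)
  ultimately show "u \<in> Ibox c k n z"
    by (auto simp: Ibox_def scale_set_def)
qed

lemma mem_Jbox:
  "v \<in> Jbox c k n z \<longleftrightarrow> (\<forall>i. z $ i * side c k n i \<le> v $ i \<and> v $ i < (z $ i + 1) * side c k n i)"
proof -
  have cast: "real_of_int z * side c k n i = real_of_int (z * side c k n i)"
    "(real_of_int z + 1) * side c k n i = real_of_int ((z + 1) * side c k n i)" for z i
    by simp_all
  show ?thesis
    unfolding Jbox_def lattice_points_def mem_Collect_eq mem_Ibox real_vec_def vec_lambda_beta cast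
      of_int_le_iff of_int_less_iff ..
qed


lemma Jbox_eq_Collect:
  "Jbox c k n z = {v. \<forall>i. z $ i * side c k n i \<le> v $ i \<and> v $ i < (z $ i + 1) * side c k n i}"
  using mem_Jbox by blast

lemma finite_Jbox: "finite (Jbox c k n z)"
  unfolding Jbox_eq_Collect by (rule finite_int_vec_bounded)

lemma card_Jbox: "real (card (Jbox c k n z)) = (\<Prod>i\<in>UNIV. real_of_int (side c k n i))"
  unfolding Jbox_eq_Collect card_int_vec_bounded using side_pos
  by (simp add: algebra_simps less_imp_le)

lemma Jbox_shift: "Jbox c k n z = (+) (\<chi> i. z $ i * side c k n i) ` Jbox c k n 0"
proof (intro equalityI subsetI)
  fix v
  assume "v \<in> Jbox c k n z"
  then have "v - (\<chi> i. z $ i * side c k n i) \<in> Jbox c k n 0"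
    by (auto simp: mem_Jbox algebra_simps)
  then show "v \<in> (+) (\<chi> i. z $ i * side c k n i) ` Jbox c k n 0"
    by (metis add.commute diff_add_cancel imageI)
qed (auto simp: mem_Jbox algebra_simps)

text \<open>Integer division names the box of a site; disjointness of the boxes and the labelling of
  points by boxes rest on this.\<close>

lemma mem_Jbox_div: "v \<in> Jbox c k n z \<longleftrightarrow> z = (\<chi> i. v $ i div side c k n i)"
proof -
  have "z $ i * side c k n i \<le> v $ i \<and> v $ i < (z $ i + 1) * side c k n i \<longleftrightarrow> z $ i = v $ i div side c k n i" for i
  proof
    assume "z $ i * side c k n i \<le> v $ i \<and> v $ i < (z $ i + 1) * side c k n i"
    then show "z $ i = v $ i div side c k n i"
      by (intro int_div_pos_eq[symmetric, where r = "v $ i - z $ i * side c k n i"]) (auto simp: algebra_simps)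
  next
    assume z: "z $ i = v $ i div side c k n i"
    show "z $ i * side c k n i \<le> v $ i \<and> v $ i < (z $ i + 1) * side c k n i"
      unfolding z distrib_right
      using pos_mod_sign[OF side_pos, of "v $ i" i] pos_mod_bound[OF side_pos, of "v $ i" i]
        div_mult_mod_eq[of "v $ i" "side c k n i"] by linarith
  qed
  then show ?thesis
    by (auto simp: mem_Jbox vec_eq_iff)
qed

lemma Jbox_disjoint: "z \<noteq> z' \<Longrightarrow> Jbox c k n z \<inter> Jbox c k n z' = {}"
  by (auto simp: mem_Jbox_div)

text \<open>The lower corner of box z is \<open>c n\<close> times its grid point, so a grid point in
  C makes the box meet the scaled set.\<close>

lemma Jbox_subset_Dplus:
  assumes "z \<in> Qminus C c k n"
  shows "Jbox c k n z \<subseteq> Dplus C c k n"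
proof -
  have "side_vec c k n * real_vec z \<in> Ibox c k n z"
    using side_pos by (simp add: mem_Ibox side_vec_nth real_vec_def algebra_simps)
  moreover have "side_vec c k n * real_vec z = c n * grid_point c k n z"
    using c_pos by (simp add: vec_eq_iff grid_point_def vec_divide_def less_imp_neq[symmetric])
  ultimately show ?thesis
    using assms by (fastforce simp: Dplus_def Qminus_def scale_set_def)
qed

text \<open>Together with the inclusion of \<open>Dplus\<close> in \<open>Kset\<close>, a way to
  bring sites into the domain where mixing is assumed.\<close>

lemma scaled_lattice_point_in_Dplus:
  assumes "vec_divide (real_vec v) (c n) \<in> C"
  shows "v \<in> Dplus C c k n"
proof -
  let ?z = "\<chi> i. v $ i div side c k n i"
  have v: "v \<in> Jbox c k n ?z"
    by (simp add: mem_Jbox_div)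
  moreover have "real_vec v \<in> scale_set (c n) C"
    using assms mem_lattice_points_scaled[of "c n" v C] c_pos by (simp add: lattice_points_def)
  moreover have "real_vec v \<in> Ibox c k n ?z"
    using v by (simp add: Jbox_def lattice_points_def)
  ultimately show ?thesis
    by (auto simp: Dplus_def)
qed

lemma core_subset: "core c k \<gamma> n z \<subseteq> Jbox c k n z"
proof
  fix v
  assume v: "v \<in> core c k \<gamma> n z"
  show "v \<in> Jbox c k n z"
    unfolding mem_Jbox
  proof
    fix i
    have "0 \<le> \<lceil>\<bar>\<gamma> n $ i\<bar>\<rceil>"
      by simp
    then show "z $ i * side c k n i \<le> v $ i \<and> v $ i < (z $ i + 1) * side c k n i"
      using v[unfolded core_def mem_Collect_eq, rule_format, of i] by linarith
  qed
qed

text \<open>\<open>cond_D\<close> requires one of its two sets to be a box, and the core takes this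
  role. The final -1 turns a strict upper bound into a closed one.\<close>

lemma is_lattice_box_core: "is_lattice_box (core c k \<gamma> n z)"
  unfolding is_lattice_box_def core_def
  by (rule exI[of _ "\<chi> i. z $ i * side c k n i + \<lceil>\<bar>\<gamma> n $ i\<bar>\<rceil>"],
      rule exI[of _ "\<chi> i. (z $ i + 1) * side c k n i - \<lceil>\<bar>\<gamma> n $ i\<bar>\<rceil> - 1"]) auto

lemma card_core:
  "real (card (core c k \<gamma> n z)) = (\<Prod>i\<in>UNIV. real (nat (side c k n i - 2 * \<lceil>\<bar>\<gamma> n $ i\<bar>\<rceil>)))"
  unfolding core_def card_int_vec_bounded by (simp add: algebra_simps)

text \<open>A vector of the scaled unit ball has its i-th coordinate bounded by that of \<gamma> in
  absolute value. A lattice displacement of this size from a core point crosses at most the removed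
  layer and so remains in the box.\<close>

lemma separated_core:
  assumes A: "A \<subseteq> core c k \<gamma> n z" and B: "B \<inter> Jbox c k n z = {}"
  shows "separated (\<gamma> n) A B"
  unfolding separated_def
proof safe
  fix b a u
  assume b: "b \<in> B" "a \<in> A" and u: "u \<in> scale_set (\<gamma> n) (cball 0 1)" and eq: "real_vec b = real_vec a + u"
  have "b \<in> Jbox c k n z"
    unfolding mem_Jbox
  proof
    fix i
    obtain w where w: "norm w \<le> 1" "u = \<gamma> n * w"
      using u by (auto simp: scale_set_def)
    have "\<bar>w $ i\<bar> \<le> 1"
      using component_le_norm_cart[of w i] w(1) by simp
    then have "\<bar>u $ i\<bar> \<le> \<bar>\<gamma> n $ i\<bar>"
      using w(2) by (simp add: abs_mult mult_left_le)
    moreover have "real_of_int (b $ i) = a $ i + u $ i"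
      using eq by (simp add: real_vec_def vec_eq_iff)
    ultimately have "\<bar>b $ i - a $ i\<bar> \<le> \<lceil>\<bar>\<gamma> n $ i\<bar>\<rceil>"
      by linarith
    then show "z $ i * side c k n i \<le> b $ i \<and> b $ i < (z $ i + 1) * side c k n i"
      using subsetD[OF A b(2), unfolded core_def mem_Collect_eq, rule_format, of i] by linarith
  qed
  then show False
    using B b(1) by auto
qed

text \<open>Explains the linking distance: within a box each rescaled coordinate varies by at most 1
  / k^(1/d), and the Euclidean norm adds the factor sqrt d.\<close>

lemma norm_vec_divide_diff_le:
  assumes "v \<in> Jbox c k n z" "v' \<in> Jbox c k n z"
  shows "norm (vec_divide (real_vec v) (c n) - vec_divide (real_vec v') (c n))
    \<le> sqrt (real CARD('d)) / root CARD('d) (real (k n))"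
proof -
  let ?r = "root CARD('d) (real (k n))"
  have r: "0 < ?r"
    using k_pos by simp
  have "norm ((vec_divide (real_vec v) (c n) - vec_divide (real_vec v') (c n)) $ i) \<le> 1 / ?r" for i
  proof -
    have "\<bar>v $ i - v' $ i\<bar> \<le> side c k n i"
      using assms(1)[unfolded mem_Jbox, rule_format, of i] assms(2)[unfolded mem_Jbox, rule_format, of i]
      by (simp add: abs_le_iff distrib_right)
    then have "\<bar>real_of_int (v $ i) - real_of_int (v' $ i)\<bar> \<le> c n $ i / ?r"
      using side_le[of i] by linarith
    then show ?thesis
      using c_pos[of i] r
      by (simp add: vec_divide_def real_vec_def flip: diff_divide_distrib) (simp add: field_simps)
  qed
  then have "norm (vec_divide (real_vec v) (c n) - vec_divide (real_vec v') (c n)) \<le> L2_set (\<lambda>i. 1 / ?r) (UNIV :: 'd set)"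
    unfolding norm_vec_def by (intro L2_set_mono) auto
  also have "\<dots> = sqrt (real CARD('d)) / ?r"
    using r by (simp add: L2_set_constant)
  finally show ?thesis .
qed

text \<open>Measured in sides, the linking distance is at most 2 sqrt d by \<open>le_2_side\<close>,
  and the positions inside the two boxes add at most one more side.\<close>

lemma near_if_linked:
  assumes v: "v \<in> Jbox c k n z" "v' \<in> Jbox c k n z'"
    and le: "norm (vec_divide (real_vec v) (c n) - vec_divide (real_vec v') (c n))
      \<le> sqrt (real CARD('d)) / root CARD('d) (real (k n))"
  shows "near z z'"
  unfolding near_def
proof
  fix i
  let ?r = "root CARD('d) (real (k n))" and ?s = "real_of_int (side c k n i)"
  have r: "0 < ?r"
    using k_pos by simp
  have s: "0 < ?s"
    using side_pos by simp
  have "\<bar>(vec_divide (real_vec v) (c n) - vec_divide (real_vec v') (c n)) $ i\<bar> \<le> sqrt (real CARD('d)) / ?r"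
    using component_le_norm_cart le order_trans by blast
  then have "\<bar>real_of_int (v $ i) - real_of_int (v' $ i)\<bar> \<le> sqrt (real CARD('d)) * (c n $ i / ?r)"
    using c_pos[of i] r
    by (simp add: vec_divide_def real_vec_def flip: diff_divide_distrib) (simp add: field_simps)
  also have "\<dots> \<le> sqrt (real CARD('d)) * (2 * ?s)"
    by (intro mult_left_mono le_2_side) auto
  finally have "\<bar>real_of_int (v $ i) - real_of_int (v' $ i)\<bar> \<le> 2 * sqrt (real CARD('d)) * ?s"
    by simp
  moreover have "real_of_int (z $ i) * ?s \<le> v $ i" "real_of_int (v $ i) < z $ i * ?s + ?s"
      "real_of_int (z' $ i) * ?s \<le> v' $ i" "real_of_int (v' $ i) < z' $ i * ?s + ?s"
  proof -
    have "real_of_int (z $ i * side c k n i) \<le> v $ i" "v $ i < real_of_int ((z $ i + 1) * side c k n i)"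
        "real_of_int (z' $ i * side c k n i) \<le> v' $ i" "v' $ i < real_of_int ((z' $ i + 1) * side c k n i)"
      using v(1)[unfolded mem_Jbox, rule_format, of i] v(2)[unfolded mem_Jbox, rule_format, of i]
      by (simp_all only: of_int_le_iff of_int_less_iff)
    then show "real_of_int (z $ i) * ?s \<le> v $ i" "real_of_int (v $ i) < z $ i * ?s + ?s"
        "real_of_int (z' $ i) * ?s \<le> v' $ i" "real_of_int (v' $ i) < z' $ i * ?s + ?s"
      by (simp_all add: distrib_right)
  qed
  ultimately have "\<bar>real_of_int (z' $ i) * ?s - real_of_int (z $ i) * ?s\<bar> \<le> (2 * sqrt (real CARD('d)) + 1) * ?s"
    unfolding distrib_right by linarith
  then have "\<bar>real_of_int (z' $ i) - real_of_int (z $ i)\<bar> * ?s \<le> (2 * sqrt (real CARD('d)) + 1) * ?s"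
    using s by (simp add: abs_mult flip: left_diff_distrib)
  then have "\<bar>real_of_int (z' $ i) - real_of_int (z $ i)\<bar> \<le> 2 * sqrt (real CARD('d)) + 1"
    using s by (simp add: mult_le_cancel_right)
  then show "\<bar>z' $ i - z $ i\<bar> \<le> \<lceil>2 * sqrt (real CARD('d))\<rceil> + 1"
    by linarith
qed

lemma mem_Aset:
  "v \<in> Aset R c k n 0 \<longleftrightarrow> (\<forall>i. \<bar>v $ i\<bar> \<le> side c k n i) \<and> (0, v) \<in> R \<and> v \<noteq> 0"
proof -
  have "(\<exists>y. (\<forall>i. -1 \<le> y $ i \<and> y $ i \<le> 1) \<and> real_vec v = real_vec 0 + side_vec c k n * y)
      \<longleftrightarrow> (\<forall>i. \<bar>v $ i\<bar> \<le> side c k n i)" (is "?l \<longleftrightarrow> ?r")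
  proof
    assume ?l
    then obtain y where y: "\<And>i. -1 \<le> y $ i \<and> y $ i \<le> 1" "real_vec v = real_vec 0 + side_vec c k n * y"
      by blast
    show ?r
    proof
      fix i
      have "real_of_int (v $ i) = side c k n i * y $ i"
        using y(2) by (simp add: vec_eq_iff real_vec_def side_vec_nth)
      moreover have "\<bar>side c k n i * y $ i\<bar> \<le> real_of_int (side c k n i)"
        using y(1)[of i] side_pos[of i] by (simp add: abs_mult mult_left_le abs_le_iff)
      ultimately show "\<bar>v $ i\<bar> \<le> side c k n i"
        by linarith
    qed
  next
    assume r: ?r
    let ?y = "\<chi> i. v $ i / real_of_int (side c k n i)"
    have "-1 \<le> ?y $ i \<and> ?y $ i \<le> 1" for i
    proof -
      have "\<bar>real_of_int (v $ i)\<bar> \<le> side c k n i"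
        using spec[OF r, of i] by linarith
      then show ?thesis
        using side_pos[of i] by (simp add: pos_le_divide_eq abs_le_iff)
    qed
    moreover have "real_vec v = real_vec 0 + side_vec c k n * ?y"
      by (simp add: vec_eq_iff side_vec_nth real_vec_def side_ne)
    ultimately show ?l
      by blast
  qed
  then show ?thesis
    by (auto simp: Aset_def lattice_points_def scale_set_def image_image image_iff)
qed

text \<open>Provides the condition on successors inside \<open>J\<close> for
  \<open>prob_hit_last_exceedance\<close>. Two sites of one box differ by less than a side per
  coordinate, and invariance of the order moves the comparison to 0.\<close>

lemma translate_mem_Aset:
  assumes R: "translation_invariant_total_order R" and v: "v \<in> Jbox c k n z" "u \<in> Jbox c k n z"
    and "(v, u) \<in> R" "v \<noteq> u"
  shows "u \<in> (+) v ` Aset R c k n 0"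
proof -
  have "(0, u - v) \<in> R"
    using R assms(4) unfolding translation_invariant_total_order_def by (metis add_uminus_conv_diff right_minus)
  moreover have "\<bar>(u - v) $ i\<bar> \<le> side c k n i" for i
    using v(1)[unfolded mem_Jbox, rule_format, of i] v(2)[unfolded mem_Jbox, rule_format, of i]
    by (simp add: abs_le_iff distrib_right)
  ultimately have "u - v \<in> Aset R c k n 0"
    using assms(5) by (auto simp: mem_Aset)
  then show ?thesis
    by (metis add.commute diff_add_cancel imageI)
qed

lemma translate_Aset_subset_surround:
  assumes v: "v \<in> Jbox c k n z"
  shows "(+) v ` Aset R c k n 0 \<subseteq> surround c k n z"
proof
  fix u
  assume "u \<in> (+) v ` Aset R c k n 0"
  then obtain w where w: "u = v + w" "\<And>i. \<bar>w $ i\<bar> \<le> side c k n i"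
    by (auto simp: mem_Aset)
  show "u \<in> surround c k n z"
    unfolding surround_def
  proof (intro CollectI allI)
    fix i
    show "(z $ i - 1) * side c k n i \<le> u $ i \<and> u $ i < (z $ i + 2) * side c k n i"
      using v[unfolded mem_Jbox, rule_format, of i] w(2)[of i] unfolding w(1)
      by (simp add: abs_le_iff algebra_simps)
  qed
qed

lemma finite_surround: "finite (surround c k n z)"
  unfolding surround_def by (rule finite_int_vec_bounded)

lemma card_surround: "real (card (surround c k n z)) = 3 ^ CARD('d) * (\<Prod>i\<in>UNIV. real_of_int (side c k n i))"
proof -
  have "real (nat ((z $ i + 2) * side c k n i - (z $ i - 1) * side c k n i)) = 3 * real_of_int (side c k n i)" for i
    using side_pos[of i] by (simp add: algebra_simps)
  then show ?thesis
    unfolding surround_def card_int_vec_bounded by (simp add: prod.distrib)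
qed

end

lemma near_sym: "near z z' \<longleftrightarrow> near z' z"
  by (simp add: near_def abs_minus_commute)

text \<open>With b the bound in \<open>near\<close>, there are 2 b + 1 choices per coordinate, the
  site itself included. The number depends on the dimension only, not on \<open>n\<close>.\<close>

definition near_card :: "'d::finite itself \<Rightarrow> nat" where
  "near_card _ = nat (2 * \<lceil>2 * sqrt (real CARD('d))\<rceil> + 3) ^ CARD('d)"

lemma near_finite_card:
  fixes z :: "int ^ 'd"
  shows "finite {z'. near z z'}" "card {z'. near z z'} = near_card TYPE('d)"
proof -
  let ?b = "\<lceil>2 * sqrt (real CARD('d))\<rceil> + 1"
  have eq: "{z'. near z z'} = {z'. \<forall>i. z $ i - ?b \<le> z' $ i \<and> z' $ i < z $ i + ?b + 1}"
  proof (intro Collect_cong, unfold near_def, intro iff_allI)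
    fix z' i
    show "(\<bar>z' $ i - z $ i\<bar> \<le> ?b) = (z $ i - ?b \<le> z' $ i \<and> z' $ i < z $ i + ?b + 1)"
      by linarith
  qed
  show "finite {z'. near z z'}"
    unfolding eq by (rule finite_int_vec_bounded)
  have "nat (z $ i + ?b + 1 - (z $ i - ?b)) = nat (2 * \<lceil>2 * sqrt (real CARD('d))\<rceil> + 3)" for i
    by simp
  then show "card {z'. near z z'} = near_card TYPE('d)"
    unfolding eq card_int_vec_bounded by (simp add: near_card_def)
qed

section \<open>Clusters\<close>

text \<open>Loop erasure: a path that returns to a visited point is cut at the first visit, so
  reachability along distinct points is the reflexive transitive closure of closeness.\<close>

lemma linked_iff_rtrancl:
  "linked r P u u' \<longleftrightarrow> u \<in> P \<and> (u, u') \<in> {(a, b). a \<in> P \<and> b \<in> P \<and> norm (b - a) \<le> r}\<^sup>*"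
    (is "_ \<longleftrightarrow> u \<in> P \<and> (u, u') \<in> ?S\<^sup>*")
proof
  assume "linked r P u u'"
  then obtain us where us: "us \<noteq> []" "hd us = u" "last us = u'" "set us \<subseteq> P"
    "\<And>i. Suc i < length us \<Longrightarrow> norm (us ! Suc i - us ! i) \<le> r"
    by (auto simp: linked_def)
  have "(u, us ! i) \<in> ?S\<^sup>*" if "i < length us" for i
    using that
  proof (induction i)
    case 0
    then show ?case
      using us(1,2) by (simp add: hd_conv_nth)
  next
    case (Suc i)
    then have "(us ! i, us ! Suc i) \<in> ?S"
      using us(4,5) by (auto simp: subset_iff)
    then show ?case
      using Suc by (meson Suc_lessD rtrancl.rtrancl_into_rtrancl)
  qed
  from this[of "length us - 1"] show "u \<in> P \<and> (u, u') \<in> ?S\<^sup>*"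
    using us by (auto simp: last_conv_nth)
next
  assume "u \<in> P \<and> (u, u') \<in> ?S\<^sup>*"
  then have "(u, u') \<in> ?S\<^sup>*" and u: "u \<in> P"
    by auto
  then show "linked r P u u'"
  proof (induction rule: rtrancl_induct)
    case base
    then show ?case
      unfolding linked_def by (intro exI[of _ "[u]"]) auto
  next
    case (step b b')
    then obtain us where us: "us \<noteq> []" "hd us = u" "last us = b" "distinct us" "set us \<subseteq> P"
      "\<And>i. Suc i < length us \<Longrightarrow> norm (us ! Suc i - us ! i) \<le> r"
      by (auto simp: linked_def)
    show ?case
    proof (cases "b' \<in> set us")
      case True
      then obtain xs ys where xy: "us = xs @ b' # ys"
        by (meson split_list)
      have "norm ((xs @ [b']) ! Suc i - (xs @ [b']) ! i) \<le> r" if "Suc i < length (xs @ [b'])" for i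
      proof -
        have "(xs @ [b']) ! Suc i = us ! Suc i" "(xs @ [b']) ! i = us ! i"
          using that by (auto simp: xy nth_append)
        then show ?thesis
          using us(6)[of i] that by (simp add: xy)
      qed
      then show ?thesis
        unfolding linked_def using us
        by (intro exI[of _ "xs @ [b']"]) (auto simp: xy hd_append)
    next
      case False
      have "norm ((us @ [b']) ! Suc i - (us @ [b']) ! i) \<le> r" if "Suc i < length (us @ [b'])" for i
      proof (cases "Suc i = length us")
        case True
        then have "(us @ [b']) ! i = b"
          using us(1,3) by (auto simp: nth_append last_conv_nth simp flip: True)
        then show ?thesis
          using True step.hyps by (simp add: nth_append)
      next
        case False
        then show ?thesis
          using us(6)[of i] that by (simp add: nth_append)
      qed
      then show ?thesis
        unfolding linked_def using us False step.hyps
        by (intro exI[of _ "us @ [b']"]) auto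
    qed
  qed
qed

lemma equiv_linked: "equiv P {(u, u'). linked r P u u'}"
proof (rule equivI)
  let ?S = "{(a, b). a \<in> P \<and> b \<in> P \<and> norm (b - a) \<le> r}"
  have symS: "sym (?S\<^sup>*)"
    by (rule sym_rtrancl) (auto simp: sym_def norm_minus_commute)
  have in_P: "u' \<in> P" if "u \<in> P" "(u, u') \<in> ?S\<^sup>*" for u u'
    using that(2,1) by (induction rule: rtrancl_induct) auto
  show "{(u, u'). linked r P u u'} \<subseteq> P \<times> P"
  proof safe
    fix u u'
    assume "linked r P u u'"
    then show "u \<in> P" "u' \<in> P"
      unfolding linked_iff_rtrancl using in_P by blast+
  qed
  show "refl_on P {(u, u'). linked r P u u'}"
    by (rule refl_onI) (simp add: linked_iff_rtrancl)
  show "sym {(u, u'). linked r P u u'}"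
  proof (rule symI, unfold mem_Collect_eq prod.case)
    fix u u'
    assume "linked r P u u'"
    then show "linked r P u' u"
      unfolding linked_iff_rtrancl using in_P symD[OF symS] by blast
  qed
  show "trans {(u, u'). linked r P u u'}"
  proof (rule transI, unfold mem_Collect_eq prod.case)
    fix u u' u''
    assume "linked r P u u'" "linked r P u' u''"
    then show "linked r P u u''"
      unfolding linked_iff_rtrancl by (meson rtrancl_trans)
  qed
qed

lemma finite_clusters: "finite P \<Longrightarrow> finite (clusters k n P)"
  unfolding clusters_def quotient_def by simp

lemma cluster_subset: "K \<in> clusters k n P \<Longrightarrow> K \<subseteq> P"
  unfolding clusters_def by (rule in_quotient_imp_subset[OF equiv_linked])

lemma cluster_ne: "K \<in> clusters k n P \<Longrightarrow> K \<noteq> {}"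
  unfolding clusters_def by (rule in_quotient_imp_non_empty[OF equiv_linked])

lemma sum_card_clusters:
  assumes "finite P"
  shows "(\<Sum>K\<in>clusters k n P. card K) = card P"
proof -
  have "card (\<Union>(clusters k n P)) = (\<Sum>K\<in>clusters k n P. card K)"
  proof (rule card_Union_disjoint)
    show "pairwise disjnt (clusters k n P)"
      unfolding pairwise_def disjnt_def
    proof (intro ballI impI)
      fix K L
      assume "K \<in> clusters k n P" "L \<in> clusters k n P" "K \<noteq> L"
      then show "K \<inter> L = {}"
        using quotient_disj[OF equiv_linked] unfolding clusters_def by metis
    qed
    show "finite K" if "K \<in> clusters k n P" for K
      using cluster_subset[OF that] assms finite_subset by blast
  qed
  moreover have "\<Union>(clusters k n P) = P"
    unfolding clusters_def by (rule Union_quotient[OF equiv_linked])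
  ultimately show ?thesis
    by simp
qed

lemma card_clusters_le:
  assumes "finite P"
  shows "card (clusters k n P) \<le> card P"
proof -
  have "(\<Sum>K\<in>clusters k n P. 1) \<le> (\<Sum>K\<in>clusters k n P. card K)"
  proof (rule sum_mono)
    fix K
    assume "K \<in> clusters k n P"
    then show "1 \<le> card K"
      using cluster_ne[of K] finite_subset[OF cluster_subset[of K] assms]
      by (simp add: Suc_le_eq card_gt_0_iff)
  qed
  then show ?thesis
    using sum_card_clusters[OF assms] by simp
qed

text \<open>What the random index averages to: a uniform choice among l counted clusters has mean
  size \<open>cluster_mass\<close> / l.\<close>

definition cluster_mass ::
  "(nat \<Rightarrow> (real ^ 'd) set \<Rightarrow> real ^ 'd) \<Rightarrow> (nat \<Rightarrow> nat) \<Rightarrow> nat \<Rightarrow> (real ^ 'd) set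
     \<Rightarrow> (real ^ 'd) set \<Rightarrow> nat" where
  "cluster_mass q k n A P = (\<Sum>K | K \<in> clusters k n P \<and> q n K \<in> A. card K)"

lemma cluster_count_eq_card:
  "finite P \<Longrightarrow> cluster_count q k n A P = card {K \<in> clusters k n P. q n K \<in> A}"
  using finite_clusters[of P k n]
  by (simp add: cluster_count_def indicator_def sum.If_cases Int_def)

lemma cluster_count_le_card_clusters: "finite P \<Longrightarrow> cluster_count q k n A P \<le> card (clusters k n P)"
  by (subst cluster_count_eq_card) (auto intro!: card_mono finite_clusters)

lemma cluster_count_le: "finite P \<Longrightarrow> cluster_count q k n A P \<le> card P"
  by (rule order_trans[OF cluster_count_le_card_clusters card_clusters_le])

lemma cluster_mass_le: "finite P \<Longrightarrow> cluster_mass q k n A P \<le> card P"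
  unfolding cluster_mass_def
  by (subst sum_card_clusters[symmetric, of P k n]) (auto intro!: sum_mono2 finite_clusters)

text \<open>The counted clusters come first in the enumeration, so the indices up to their number
  run through exactly these.\<close>

lemma sum_enumerated_clusters:
  assumes e: "cluster_enumeration q C k e" and fin: "finite P"
  shows "(\<Sum>i = 1..cluster_count q k n C P. card (e n P i)) = cluster_mass q k n C P"
proof -
  let ?N = "card (clusters k n P)" and ?l = "cluster_count q k n C P"
  have bij: "bij_betw (e n P) {1..?N} (clusters k n P)"
    and first: "\<And>i. i \<in> {1..?N} \<Longrightarrow> q n (e n P i) \<in> C \<longleftrightarrow> i \<le> ?l"
    using e[unfolded cluster_enumeration_def, THEN spec, THEN spec, THEN mp, OF fin] by blast+
  have "?l \<le> ?N"
    using cluster_count_le_card_clusters[OF fin] .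
  then have idx: "{1..?l} = {i \<in> {1..?N}. q n (e n P i) \<in> C}"
    using first by force
  have "bij_betw (e n P) {1..?l} {K \<in> clusters k n P. q n K \<in> C}"
    unfolding idx bij_betw_def
  proof
    show "inj_on (e n P) {i \<in> {1..?N}. q n (e n P i) \<in> C}"
      by (rule inj_on_subset[OF bij_betw_imp_inj_on[OF bij]]) auto
    have "{K \<in> e n P ` {1..?N}. q n K \<in> C} = e n P ` {i \<in> {1..?N}. q n (e n P i) \<in> C}"
      by auto
    then show "e n P ` {i \<in> {1..?N}. q n (e n P i) \<in> C} = {K \<in> clusters k n P. q n K \<in> C}"
      by (simp only: bij_betw_imp_surj_on[OF bij])
  qed
  then show ?thesis
    unfolding cluster_mass_def by (rule sum.reindex_bij_betw[where g = card])
qed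

text \<open>Equality of labels is transitive; when it coincides with closeness, paths reach no
  further than single steps and the clusters are the fibres of \<open>f\<close>. Every cluster is
  counted, since a cluster point belongs to its own cluster and thus to C.\<close>

lemma clusters_of_labelling:
  fixes P :: "(real ^ 'd) set"
  assumes fin: "finite P"
    and f: "\<And>u u'. u \<in> P \<Longrightarrow> u' \<in> P \<Longrightarrow> f u = f u' \<longleftrightarrow> 
      norm (u' - u) \<le> sqrt (real CARD('d)) / root CARD('d) (real (k n))"
    and q: "cluster_point_rule q" and C: "P \<subseteq> C"
  shows "cluster_count q k n C P = card (f ` P)" "cluster_mass q k n C P = card P"
proof -
  let ?r = "sqrt (real CARD('d)) / root CARD('d) (real (k n))"
  let ?S = "{(a, b). a \<in> P \<and> b \<in> P \<and> norm (b - a) \<le> ?r}"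
  have linked: "linked ?r P u u' \<longleftrightarrow> u \<in> P \<and> u' \<in> P \<and> f u = f u'" for u u'
  proof
    assume "linked ?r P u u'"
    then have "(u, u') \<in> ?S\<^sup>*" "u \<in> P"
      by (auto simp: linked_iff_rtrancl)
    then show "u \<in> P \<and> u' \<in> P \<and> f u = f u'"
      by (induction rule: rtrancl_induct) (auto simp: f)
  qed (auto simp: linked_iff_rtrancl f)
  have cl: "clusters k n P = (\<lambda>y. {u \<in> P. y = f u}) ` f ` P"
    unfolding clusters_def linked by (auto simp: quotient_def)
  have "inj_on (\<lambda>y. {u \<in> P. y = f u}) (f ` P)"
    by (auto simp: inj_on_def)
  then have "card (clusters k n P) = card (f ` P)"
    unfolding cl by (rule card_image)
  moreover have "q n K \<in> C" if "K \<in> clusters k n P" for K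
  proof -
    have "finite K" "K \<noteq> {}"
      using cluster_ne[OF that] cluster_subset[OF that] fin finite_subset by auto
    then have "q n K \<in> K"
      using q by (auto simp: cluster_point_rule_def is_arg_min_def)
    then show ?thesis
      using cluster_subset[OF that] C by auto
  qed
  then have "{K \<in> clusters k n P. q n K \<in> C} = clusters k n P"
    by auto
  ultimately show "cluster_count q k n C P = card (f ` P)" "cluster_mass q k n C P = card P"
    using fin by (simp_all add: cluster_count_eq_card cluster_mass_def sum_card_clusters)
qed

text \<open>Separates the deterministic geometry of clusters from the random exceedance set, a
  subset of a finite set, so that measurability is immediate for all functions of clusters.\<close>

definition scaled_points :: "real ^ 'd \<Rightarrow> (int ^ 'd) set \<Rightarrow> (real ^ 'd) set" where
  "scaled_points c F = (\<lambda>v. vec_divide (real_vec v) c) ` F"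

lemma inj_scaled_point:
  assumes "\<And>i. 0 < c $ i"
  shows "inj_on (\<lambda>v. vec_divide (real_vec v) c) F"
  using assms by (auto simp: inj_on_def vec_eq_iff vec_divide_def real_vec_def less_imp_neq[symmetric])

lemma card_scaled_points: "(\<And>i. 0 < c $ i) \<Longrightarrow> card (scaled_points c F) = card F"
  unfolding scaled_points_def by (intro card_image inj_scaled_point)

text \<open>Points are labelled by their box. Points of one box are close by
  \<open>norm_vec_divide_diff_le\<close>; close points lie in near boxes, and \<open>far\<close>
  then identifies these boxes.\<close>

lemma clusters_eq_boxes:
  fixes c :: "nat \<Rightarrow> real ^ 'd"
  assumes pos: "\<And>i. 0 < side c k n i" "\<And>i. 0 < c n $ i" "0 < k n"
    and q: "cluster_point_rule q" and F: "finite F"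
    and far: "\<And>v v' z z'. v \<in> F \<Longrightarrow> v' \<in> F \<Longrightarrow> v \<in> Jbox c k n z \<Longrightarrow> v' \<in> Jbox c k n z' \<Longrightarrow> near z z' \<Longrightarrow> z = z'"
    and C: "\<And>v. v \<in> F \<Longrightarrow> vec_divide (real_vec v) (c n) \<in> C"
  shows "cluster_count q k n C (scaled_points (c n) F) = card {z. Jbox c k n z \<inter> F \<noteq> {}}"
    and "cluster_mass q k n C (scaled_points (c n) F) = card F"
proof -
  let ?s = "\<lambda>v. vec_divide (real_vec v) (c n)"
  define b where "b v = (\<chi> i. v $ i div side c k n i)" for v :: "int ^ 'd"
  define f where "f u = b (inv_into UNIV ?s u)" for u
  have inj: "inj ?s"
    using inj_scaled_point[of "c n" UNIV] pos(2) by simp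
  have f_s: "f (?s v) = b v" for v
    unfolding f_def by (simp only: inv_f_f[OF inj])
  have box: "v \<in> Jbox c k n z \<longleftrightarrow> z = b v" for v z
    unfolding b_def by (rule mem_Jbox_div[OF pos])
  have f: "f u = f u' \<longleftrightarrow> norm (u' - u) \<le> sqrt (real CARD('d)) / root CARD('d) (real (k n))"
    if u: "u \<in> scaled_points (c n) F" "u' \<in> scaled_points (c n) F" for u u'
  proof -
    obtain v v' where v: "v \<in> F" "v' \<in> F" "u = ?s v" "u' = ?s v'"
      using u by (auto simp: scaled_points_def)
    have "b v = b v'" if "norm (?s v' - ?s v) \<le> sqrt (real CARD('d)) / root CARD('d) (real (k n))"
      using near_if_linked[OF pos, of v "b v" v' "b v'"] that far[of v v' "b v" "b v'"] v(1,2)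
      by (simp add: box norm_minus_commute)
    moreover have "norm (?s v' - ?s v) \<le> sqrt (real CARD('d)) / root CARD('d) (real (k n))" if "b v = b v'"
      using norm_vec_divide_diff_le[OF pos, of v' "b v" v] that by (simp add: box)
    ultimately show ?thesis
      unfolding v(3,4) f_s by blast
  qed
  have fin: "finite (scaled_points (c n) F)" and sub: "scaled_points (c n) F \<subseteq> C"
    using F C by (auto simp: scaled_points_def)
  have eq: "f ` scaled_points (c n) F = {z. Jbox c k n z \<inter> F \<noteq> {}}"
    unfolding scaled_points_def image_image f_s by (auto simp: box)
  show "cluster_count q k n C (scaled_points (c n) F) = card {z. Jbox c k n z \<inter> F \<noteq> {}}"
    "cluster_mass q k n C (scaled_points (c n) F) = card F"
    using clusters_of_labelling[where f = f and k = k and n = n, OF fin f q sub]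
    by (simp_all only: eq card_scaled_points[OF pos(2)])
qed

section \<open>The randomly chosen cluster\<close>

text \<open>Apart from the index, everything depends on the finite pattern of exceedances. Partition
  by pattern and index: independence factorises each piece and every index in \<open>{1..l}\<close>
  has weight 1 / l. Integrability is stated because these set integrals are later added over
  l.\<close>

lemma (in exceedances) random_index_integral:
  fixes N :: "(int ^ 'd) set \<Rightarrow> nat" and g :: "(int ^ 'd) set \<Rightarrow> nat \<Rightarrow> real"
  assumes S: "uniform_index M \<xi> (\<lambda>\<omega>. N {v \<in> D. \<xi> v \<omega> > x}) S" and D: "finite D" and l: "1 \<le> l"
  defines "A \<equiv> {\<omega> \<in> space M. N {v \<in> D. \<xi> v \<omega> > x} = l}"
  shows "set_integrable M A (\<lambda>\<omega>. g {v \<in> D. \<xi> v \<omega> > x} (S \<omega>))"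
    and "(LINT \<omega>:A|M. g {v \<in> D. \<xi> v \<omega> > x} (S \<omega>))
      = (LINT \<omega>:A|M. (\<Sum>i = 1..l. g {v \<in> D. \<xi> v \<omega> > x} i)) / l"
proof -
  define F where "F \<omega> = {v \<in> D. \<xi> v \<omega> > x}" for \<omega>
  have S_meas: "S \<in> M \<rightarrow>\<^sub>M count_space UNIV"
    using S by (simp add: uniform_index_def)
  have S_ev: "{\<omega> \<in> space M. S \<omega> = i} \<in> events" for i
    using measurable_sets[OF S_meas, of "{i}"] by (simp add: vimage_def Int_def conj_commute)
  have A: "A \<in> events"
    unfolding A_def by (rule exceedance_pattern_events[OF D])
  have F_ev: "{\<omega> \<in> space M. F \<omega> = G} \<in> field_sigma M \<xi>" for G
    unfolding F_def using exceedance_pattern_field_sigma[OF D, of "\<lambda>H. H = G" x] by simp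
  have F_Pow: "F \<omega> \<in> Pow D" for \<omega>
    by (auto simp: F_def)
  have F_ev': "{\<omega> \<in> space M. F \<omega> = G} \<in> events" for G
    using F_ev field_sigma_subset_events by blast
  have prob_S: "prob ({\<omega> \<in> space M. S \<omega> = i} \<inter> {\<omega> \<in> space M. F \<omega> = G} \<inter> A)
      = of_bool (i \<in> {1..l}) * prob ({\<omega> \<in> space M. F \<omega> = G} \<inter> A) / l" for i G
  \<comment> \<open>\<open>uniform_index\<close> says nothing about null events; both sides are 0
    there.\<close>
  proof (cases "prob A = 0")
    case True
    have "prob (B \<inter> A) = 0" if "B \<in> events" for B
      using finite_measure_mono[of "B \<inter> A" A] A that True by (simp add: measure_le_0_iff)
    then show ?thesis
      using sets.Int[OF S_ev F_ev'] F_ev' by simp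
  next
    case False
    define M' where "M' = uniform_measure M A"
    have pos: "emeasure M A \<noteq> 0" "emeasure M A \<noteq> \<infinity>"
      using False by (auto simp: emeasure_eq_measure)
    interpret M': prob_space M'
      unfolding M'_def by (rule prob_space_uniform_measure[OF pos])
    have M'_prob: "M'.prob B = prob (A \<inter> B) / prob A" if "B \<in> events" for B
      unfolding M'_def by (rule measure_uniform_measure[OF pos that])
    have "0 < prob A"
      using False by (simp add: zero_less_measure_iff)
    then have d: "distr M' (count_space UNIV) S = measure_pmf (pmf_of_set {1..l})"
      and indep: "M'.indep_set (sets (vimage_algebra (space M) S (count_space UNIV))) (field_sigma M \<xi>)"
      using S l unfolding uniform_index_def M'_def A_def by (auto simp: Let_def)
    have S_meas': "S \<in> M' \<rightarrow>\<^sub>M count_space UNIV"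
      using S_meas by (simp add: M'_def)
    let ?S = "{\<omega> \<in> space M. S \<omega> = i}" and ?F = "{\<omega> \<in> space M. F \<omega> = G}"
    have "M'.prob ?S = measure (distr M' (count_space UNIV) S) {i}"
      by (subst measure_distr[OF S_meas']) (simp_all add: M'_def vimage_def Int_def conj_commute)
    also have "\<dots> = of_bool (i \<in> {1..l}) / l"
      unfolding d using l by (simp add: measure_pmf_single pmf_of_set)
    finally have pS: "M'.prob ?S = of_bool (i \<in> {1..l}) / l" .
    have "?S \<in> sets (vimage_algebra (space M) S (count_space UNIV))"
      using in_vimage_algebra[of "{i}" "count_space UNIV" S "space M"]
      by (simp add: vimage_def Int_def conj_commute)
    from M'.indep_setD[OF indep this F_ev]
    have "M'.prob (?S \<inter> ?F) = M'.prob ?S * M'.prob ?F" .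
    then have "prob (A \<inter> (?S \<inter> ?F)) / prob A = of_bool (i \<in> {1..l}) / l * (prob (A \<inter> ?F) / prob A)"
      unfolding pS M'_prob[OF sets.Int[OF S_ev F_ev']] M'_prob[OF F_ev'] .
    then show ?thesis
      using False by (simp add: field_simps Int_ac)
  qed
  \<comment> \<open>The law of \<open>S\<close> excludes other values only up to null sets: first
    for each i, by summing over patterns, then for countably many i at once.\<close>
  have ae: "AE \<omega> in M. \<omega> \<in> A \<longrightarrow> S \<omega> \<in> {1..l}"
  proof -
    have "prob ({\<omega> \<in> space M. S \<omega> = i} \<inter> A) = 0" if "i \<notin> {1..l}" for i
    proof -
      have "{\<omega> \<in> space M. S \<omega> = i} \<inter> A = (\<Union>G\<in>Pow D. {\<omega> \<in> space M. S \<omega> = i} \<inter> {\<omega> \<in> space M. F \<omega> = G} \<inter> A)"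
        using F_Pow by blast
      then have "prob ({\<omega> \<in> space M. S \<omega> = i} \<inter> A) = prob (\<Union>G\<in>Pow D. {\<omega> \<in> space M. S \<omega> = i} \<inter> {\<omega> \<in> space M. F \<omega> = G} \<inter> A)"
        by (rule arg_cong)
      also have "\<dots> \<le> (\<Sum>G\<in>Pow D. prob ({\<omega> \<in> space M. S \<omega> = i} \<inter> {\<omega> \<in> space M. F \<omega> = G} \<inter> A))"
        using D S_ev F_ev' A by (intro finite_measure_subadditive_finite) auto
      also have "\<dots> = 0"
        unfolding prob_S using that by auto
      finally show ?thesis
        by (simp add: measure_le_0_iff)
    qed
    then have "AE \<omega> in M. \<not> (\<omega> \<in> A \<and> S \<omega> = i)" if "i \<in> - {1..l}" for i
      using that S_ev A by (intro AE_I[where N = "{\<omega> \<in> space M. S \<omega> = i} \<inter> A"]) (auto simp: emeasure_eq_measure)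
    then have "AE \<omega> in M. \<forall>i\<in>- {1..l}. \<not> (\<omega> \<in> A \<and> S \<omega> = i)"
      by (intro AE_ball_countable') auto
    then show ?thesis
      by eventually_elim blast
  qed
  \<comment> \<open>A finite combination of indicators equal almost everywhere to the integrand cut
    off to \<open>A\<close>; it yields integrability and the value.\<close>
  define f where "f \<omega> = (\<Sum>G\<in>Pow D. \<Sum>i = 1..l. g G i *
      indicator ({\<omega> \<in> space M. S \<omega> = i} \<inter> {\<omega> \<in> space M. F \<omega> = G} \<inter> A) \<omega>)" for \<omega>
  have hb: "has_bochner_integral M (\<lambda>\<omega>. a * indicator B \<omega>) (a * prob B)" if "B \<in> events" for a B
    using that by (intro has_bochner_integral_mult_right has_bochner_integral_real_indicator)
      (auto simp: emeasure_eq_measure)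
  have f_hb: "has_bochner_integral M f (\<Sum>G\<in>Pow D. \<Sum>i = 1..l. g G i *
      prob ({\<omega> \<in> space M. S \<omega> = i} \<inter> {\<omega> \<in> space M. F \<omega> = G} \<inter> A))"
    unfolding f_def using S_ev F_ev' A by (intro has_bochner_integral_sum hb sets.Int)
  have f_int: "integrable M f"
    using f_hb by (rule integrable.intros)
  have F_meas: "F \<in> M \<rightarrow>\<^sub>M count_space (Pow D)"
    unfolding F_def by (rule exceedance_pattern_measurable[OF D])
  have gFS: "(\<lambda>\<omega>. g (F \<omega>) (S \<omega>)) \<in> borel_measurable M"
    by (rule measurable_compose_countable'[OF measurable_compose_countable[OF _ S_meas] F_meas])
      (use D in \<open>auto intro: countable_finite\<close>)
  have AgFS: "(\<lambda>\<omega>. indicator A \<omega> *\<^sub>R g (F \<omega>) (S \<omega>)) \<in> borel_measurable M"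
    by (intro borel_measurable_scaleR borel_measurable_indicator A gFS)
  have eq_f: "AE \<omega> in M. indicator A \<omega> *\<^sub>R g (F \<omega>) (S \<omega>) = f \<omega>"
    using ae AE_space
  proof eventually_elim
    case (elim \<omega>)
    show ?case
    proof (cases "\<omega> \<in> A")
      case True
      then have "f \<omega> = (\<Sum>G\<in>Pow D. \<Sum>i = 1..l. if G = F \<omega> then if i = S \<omega> then g G i else 0 else 0)"
        unfolding f_def using elim by (intro sum.cong refl) auto
      also have "\<dots> = (\<Sum>G\<in>Pow D. if G = F \<omega> then g G (S \<omega>) else 0)"
        using elim True by (intro sum.cong refl) auto
      also have "\<dots> = g (F \<omega>) (S \<omega>)"
        using D F_Pow[of \<omega>] by simp
      finally show ?thesis
        using True by simp
    qed (simp add: f_def)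
  qed
  show "set_integrable M A (\<lambda>\<omega>. g {v \<in> D. \<xi> v \<omega> > x} (S \<omega>))"
    unfolding set_integrable_def F_def[symmetric]
    by (rule integrable_cong_AE_imp[OF f_int AgFS]) (use eq_f in \<open>auto elim!: eventually_mono\<close>)
  have "(LINT \<omega>:A|M. g (F \<omega>) (S \<omega>)) = (LINT \<omega>|M. f \<omega>)"
    unfolding set_lebesgue_integral_def
    by (rule integral_cong_AE[OF AgFS borel_measurable_integrable[OF f_int] eq_f])
  also have "\<dots> = (\<Sum>G\<in>Pow D. \<Sum>i = 1..l. g G i *
      prob ({\<omega> \<in> space M. S \<omega> = i} \<inter> {\<omega> \<in> space M. F \<omega> = G} \<inter> A))"
    by (rule has_bochner_integral_integral_eq[OF f_hb])
  also have "\<dots> = (\<Sum>G\<in>Pow D. (\<Sum>i = 1..l. g G i) * prob ({\<omega> \<in> space M. F \<omega> = G} \<inter> A)) / l"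
    unfolding prob_S sum_distrib_right sum_divide_distrib by (intro sum.cong refl) auto
  also have "(\<Sum>G\<in>Pow D. (\<Sum>i = 1..l. g G i) * prob ({\<omega> \<in> space M. F \<omega> = G} \<inter> A))
      = (LINT \<omega>|M. (\<Sum>G\<in>Pow D. (\<Sum>i = 1..l. g G i) * indicator ({\<omega> \<in> space M. F \<omega> = G} \<inter> A) \<omega>))"
    using F_ev' A by (intro has_bochner_integral_integral_eq[symmetric] has_bochner_integral_sum hb sets.Int)
  also have "\<dots> = (LINT \<omega>:A|M. (\<Sum>i = 1..l. g (F \<omega>) i))"
    unfolding set_lebesgue_integral_def
  proof (rule Bochner_Integration.integral_cong[OF refl])
    fix \<omega>
    assume \<omega>: "\<omega> \<in> space M"
    have "(\<Sum>G\<in>Pow D. (\<Sum>i = 1..l. g G i) * indicator ({\<omega> \<in> space M. F \<omega> = G} \<inter> A) \<omega>)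
        = (\<Sum>G\<in>Pow D. if G = F \<omega> then (\<Sum>i = 1..l. g G i) * indicator A \<omega> else 0)"
      using \<omega> by (intro sum.cong refl) (auto simp: indicator_def)
    also have "\<dots> = indicator A \<omega> *\<^sub>R (\<Sum>i = 1..l. g (F \<omega>) i)"
      using D F_Pow[of \<omega>] by simp
    finally show "(\<Sum>G\<in>Pow D. (\<Sum>i = 1..l. g G i) * indicator ({\<omega> \<in> space M. F \<omega> = G} \<inter> A) \<omega>)
        = indicator A \<omega> *\<^sub>R (\<Sum>i = 1..l. g (F \<omega>) i)" .
  qed
  finally show "(LINT \<omega>:A|M. g {v \<in> D. \<xi> v \<omega> > x} (S \<omega>))
      = (LINT \<omega>:A|M. (\<Sum>i = 1..l. g {v \<in> D. \<xi> v \<omega> > x} i)) / l"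
    unfolding F_def .
qed

section \<open>Real sequences\<close>

lemma tendsto_zero_mult_bounded:
  fixes f g :: "nat \<Rightarrow> real"
  assumes "f \<longlonglongrightarrow> 0" "\<forall>\<^sub>F n in sequentially. \<bar>g n\<bar> \<le> b"
  shows "(\<lambda>n. f n * g n) \<longlonglongrightarrow> 0"
proof (rule tendsto_0_le[OF assms(1)])
  show "\<forall>\<^sub>F n in sequentially. norm (f n * g n) \<le> norm (f n) * b"
    using assms(2) by eventually_elim (auto simp: abs_mult intro: mult_left_mono)
qed

text \<open>The form in which conditional mean cluster sizes are handled: an additive error is
  harmless once the denominator stays away from 0.\<close>

lemma ratio_tendsto:
  fixes a b :: "nat \<Rightarrow> real"
  assumes "(\<lambda>n. a n - b n * r) \<longlonglongrightarrow> 0" "0 < \<delta>" "\<forall>\<^sub>F n in sequentially. \<delta> \<le> b n"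
  shows "(\<lambda>n. a n / b n) \<longlonglongrightarrow> r"
proof -
  have "(\<lambda>n. (a n - b n * r) * (1 / b n)) \<longlonglongrightarrow> 0"
  proof (rule tendsto_zero_mult_bounded[OF assms(1), where b = "1 / \<delta>"])
    show "\<forall>\<^sub>F n in sequentially. \<bar>1 / b n\<bar> \<le> 1 / \<delta>"
      using assms(3) by eventually_elim (use assms(2) in \<open>auto simp: frac_le\<close>)
  qed
  then have "(\<lambda>n. (a n - b n * r) * (1 / b n) + r) \<longlonglongrightarrow> r"
    by (auto intro: tendsto_eq_intros)
  moreover have "\<forall>\<^sub>F n in sequentially. (a n - b n * r) * (1 / b n) + r = a n / b n"
    using assms(3) by eventually_elim (use assms(2) in \<open>auto simp: field_simps\<close>)
  ultimately show ?thesis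
    by (rule Lim_transform_eventually)
qed

text \<open>The recursion \<open>(j + 1) P(N = j + 1) \<approx> w P(N = j)\<close> characterises the Poisson law (it is the
  Stein--Chen identity); together with tightness it excludes that any of the probabilities vanishes.\<close>

lemma recursion_bounded_below:
  fixes P :: "nat \<Rightarrow> nat \<Rightarrow> real"
  assumes nonneg: "\<And>j n. 0 \<le> P j n"
    and rec: "\<And>j. (\<lambda>n. real (j + 1) * P (j + 1) n - w n * P j n) \<longlonglongrightarrow> 0"
    and a: "0 < a" "\<forall>\<^sub>F n in sequentially. a \<le> w n" and b: "\<forall>\<^sub>F n in sequentially. w n \<le> b"
    and tight: "\<forall>\<^sub>F n in sequentially. 1 / 2 \<le> (\<Sum>j\<le>L. P j n)"
  shows "\<exists>\<delta>>0. \<forall>\<^sub>F n in sequentially. \<delta> \<le> P j n"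
proof -
  have b0: "0 < b"
    using eventually_conj[OF a(2) b] a(1) by (auto dest!: eventually_happens)
  \<comment> \<open>Smallness would spread upwards: if \<open>P 0\<close> were small, every
    \<open>P j\<close> would be, which tightness forbids.\<close>
  have upper: "\<exists>B \<eta>. 0 < B \<and> \<eta> \<longlonglongrightarrow> 0 \<and> (\<forall>\<^sub>F n in sequentially. P j n \<le> B * P 0 n + \<eta> n)" for j
  proof (induction j)
    case 0
    then show ?case
      by (intro exI[of _ 1] exI[of _ "\<lambda>_. 0"]) auto
  next
    case (Suc j)
    then obtain B \<eta> where B: "0 < B" "\<eta> \<longlonglongrightarrow> 0" "\<forall>\<^sub>F n in sequentially. P j n \<le> B * P 0 n + \<eta> n"
      by blast
    let ?r = "\<lambda>n. real (j + 1) * P (j + 1) n - w n * P j n"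
    have "(\<lambda>n. b * \<eta> n + \<bar>?r n\<bar>) \<longlonglongrightarrow> 0"
      using tendsto_add[OF tendsto_mult_left[OF B(2), of b] tendsto_rabs_zero[OF rec[of j]]]
      by (simp add: add.commute)
    moreover have "\<forall>\<^sub>F n in sequentially. P (Suc j) n \<le> b * B * P 0 n + (b * \<eta> n + \<bar>?r n\<bar>)"
      using B(3) b
    proof eventually_elim
      case (elim n)
      have "P (Suc j) n \<le> real (j + 1) * P (j + 1) n"
        using nonneg[of "Suc j" n] by (simp add: distrib_right)
      also have "\<dots> \<le> w n * P j n + \<bar>?r n\<bar>"
        by simp
      finally have "P (Suc j) n \<le> w n * P j n + \<bar>?r n\<bar>" .
      moreover have "w n * P j n \<le> b * (B * P 0 n + \<eta> n)"
        using elim nonneg[of j n] b0 by (intro mult_mono) auto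
      moreover have "b * (B * P 0 n + \<eta> n) = b * B * P 0 n + b * \<eta> n"
        by (simp add: algebra_simps)
      ultimately show ?case
        by linarith
    qed
    ultimately show ?case
      using B(1) b0 by (intro exI[of _ "b * B"] exI[of _ "\<lambda>n. b * \<eta> n + \<bar>?r n\<bar>"] conjI) auto
  qed
  have upper_sum: "\<exists>B \<eta>. 0 < B \<and> \<eta> \<longlonglongrightarrow> 0 \<and>
      (\<forall>\<^sub>F n in sequentially. (\<Sum>j\<le>L. P j n) \<le> B * P 0 n + \<eta> n)" for L
  proof (induction L)
    case 0
    show ?case
      by (intro exI[of _ 1] exI[of _ "\<lambda>_. 0"]) auto
  next
    case (Suc L)
    then obtain B \<eta> where B: "0 < B" "\<eta> \<longlonglongrightarrow> 0"
      "\<forall>\<^sub>F n in sequentially. (\<Sum>j\<le>L. P j n) \<le> B * P 0 n + \<eta> n"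
      by blast
    obtain B' \<eta>' where B': "0 < B'" "\<eta>' \<longlonglongrightarrow> 0" "\<forall>\<^sub>F n in sequentially. P (Suc L) n \<le> B' * P 0 n + \<eta>' n"
      using upper[of "Suc L"] by blast
    have "\<forall>\<^sub>F n in sequentially. (\<Sum>j\<le>Suc L. P j n) \<le> (B + B') * P 0 n + (\<eta> n + \<eta>' n)"
      using B(3) B'(3) by eventually_elim (simp add: distrib_right)
    then show ?case
      using B(1,2) B'(1,2)
      by (intro exI[of _ "B + B'"] exI[of _ "\<lambda>n. \<eta> n + \<eta>' n"] conjI tendsto_add_zero) auto
  qed
  then obtain S \<eta> where S: "0 < S" and \<eta>: "\<eta> \<longlonglongrightarrow> 0"
    and sum: "\<forall>\<^sub>F n in sequentially. (\<Sum>j\<le>L. P j n) \<le> S * P 0 n + \<eta> n"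
    by blast
  \<comment> \<open>The partial sum is at least 1/2 and the error \<eta> is below 1/4, which leaves
    1/4 for \<open>S * P 0 n\<close>.\<close>
  have lower_0: "\<exists>\<delta>>0. \<forall>\<^sub>F n in sequentially. \<delta> \<le> P 0 n"
  proof (intro exI conjI)
    show "0 < 1 / (4 * S)"
      using S by simp
    have "\<forall>\<^sub>F n in sequentially. \<eta> n < 1 / 4"
      using order_tendstoD(2)[OF \<eta>, of "1 / 4"] by simp
    then show "\<forall>\<^sub>F n in sequentially. 1 / (4 * S) \<le> P 0 n"
      using tight sum
    proof eventually_elim
      case (elim n)
      then have "1 / 4 \<le> S * P 0 n"
        by linarith
      then show ?case
        using S by (simp add: field_simps)
    qed
  qed
  show ?thesis
  proof (induction j)
    case 0
    show ?case by (rule lower_0)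
  next
    case (Suc j)
    then obtain \<delta> where \<delta>: "0 < \<delta>" "\<forall>\<^sub>F n in sequentially. \<delta> \<le> P j n"
      by blast
    let ?r = "\<lambda>n. real (j + 1) * P (j + 1) n - w n * P j n"
    \<comment> \<open>The error may consume half of \<open>w n * P j n\<close>, which is at least
      \<open>a * \<delta>\<close>; the other half bounds the next probability.\<close>
    have "\<forall>\<^sub>F n in sequentially. - (a * \<delta> / 2) < ?r n"
      using a(1) \<delta>(1) by (intro order_tendstoD(1)[OF rec[of j]]) simp
    then have "\<forall>\<^sub>F n in sequentially. a * \<delta> / (2 * (j + 1)) \<le> P (Suc j) n"
      using \<delta>(2) a(2)
    proof eventually_elim
      case (elim n)
      have "a * \<delta> \<le> w n * P j n"
        using elim a(1) \<delta>(1) by (intro mult_mono) auto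
      then have "a * \<delta> / 2 \<le> (j + 1) * P (Suc j) n"
        using elim(1) by simp
      then show ?case
        by (simp add: field_simps)
    qed
    then show ?case
      using a(1) \<delta>(1) by (intro exI[of _ "a * \<delta> / (2 * (j + 1))"]) auto
  qed
qed

text \<open>Termwise limits do not suffice for sums whose length grows with n. Beyond a fixed L the
  remainder is small uniformly in n, and only finitely many terms are left.\<close>

lemma tail_sum_tendsto_zero:
  fixes e :: "nat \<Rightarrow> nat \<Rightarrow> real"
  assumes lim: "\<And>l. 1 \<le> l \<Longrightarrow> (\<lambda>n. e n l) \<longlonglongrightarrow> 0"
    and tail: "\<And>L. \<forall>\<^sub>F n in sequentially. \<bar>s n - (\<Sum>l = 1..L. e n l)\<bar> \<le> B / (L + 1)"
  shows "s \<longlonglongrightarrow> (0 :: real)"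
proof (rule tendstoI)
  fix \<epsilon> :: real
  assume \<epsilon>: "0 < \<epsilon>"
  obtain L :: nat where L: "2 * \<bar>B\<bar> / \<epsilon> < L"
    using reals_Archimedean2 by blast
  have BL: "B / (real L + 1) < \<epsilon> / 2"
  proof -
    have "2 * \<bar>B\<bar> < \<epsilon> * (L + 1)"
      using L \<epsilon> by (simp add: field_simps)
    then show ?thesis
      by (simp add: field_simps)
  qed
  have "(\<lambda>n. \<Sum>l = 1..L. e n l) \<longlonglongrightarrow> 0"
    using tendsto_sum[of "{1..L}" "\<lambda>l n. e n l" "\<lambda>_. 0" sequentially] lim by simp
  then have "\<forall>\<^sub>F n in sequentially. dist (\<Sum>l = 1..L. e n l) 0 < \<epsilon> / 2"
    using \<epsilon> by (intro tendstoD) auto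
  then show "\<forall>\<^sub>F n in sequentially. dist (s n) 0 < \<epsilon>"
    using tail[of L]
  proof eventually_elim
    case (elim n)
    then show ?case
      using BL unfolding dist_real_def by linarith
  qed
qed

text \<open>Markov's inequality for the number of events that occur.\<close>

lemma (in prob_space) prob_many_events_le:
  assumes "finite I" and H: "\<And>i. i \<in> I \<Longrightarrow> H i \<in> events"
    and A: "A \<in> events" "\<And>\<omega>. \<omega> \<in> A \<Longrightarrow> l \<le> card {i \<in> I. \<omega> \<in> H i}"
  shows "real l * prob A \<le> (\<Sum>i\<in>I. prob (H i))"
proof -
  have eq: "real (card {i \<in> I. \<omega> \<in> H i}) = (\<Sum>i\<in>I. indicator (H i) \<omega>)" for \<omega>
    using assms(1) by (simp add: indicator_def sum.If_cases Int_def)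
  have int: "set_integrable M A (\<lambda>\<omega>. real (card {i \<in> I. \<omega> \<in> H i}))"
    unfolding eq set_integrable_def using H A(1)
    by (intro integrable_mult_indicator Bochner_Integration.integrable_sum) (auto simp: emeasure_eq_measure)
  have "real l * prob A = (LINT \<omega>:A|M. real l)"
    using A(1) by (simp add: set_integral_const emeasure_eq_measure)
  also have "\<dots> \<le> (LINT \<omega>:A|M. real (card {i \<in> I. \<omega> \<in> H i}))"
  proof (rule set_integral_mono[OF _ int])
    show "set_integrable M A (\<lambda>_. real l)"
      using A(1) by (simp add: set_integrable_def emeasure_eq_measure)
  qed (use A(2) in auto)
  also have "\<dots> = (\<Sum>i\<in>I. prob (H i \<inter> A))"
    by (rule set_integral_card_events[OF assms(1) H A(1)])
  also have "\<dots> \<le> (\<Sum>i\<in>I. prob (H i))"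
    using H by (intro sum_mono finite_measure_mono) auto
  finally show ?thesis .
qed

section \<open>Asymptotics of a single box\<close>

text \<open>The assumptions on \<open>C\<close> are the form in which p-convexity is used:
  boundedness and interior points for counting cells, a null frontier for discarding boundary
  boxes.\<close>

locale box_asymptotics = exceedances M \<xi> for M :: "'a measure" and \<xi> :: "int ^ 'd \<Rightarrow> 'a \<Rightarrow> real" +
  fixes C :: "(real ^ 'd) set" and c :: "nat \<Rightarrow> real ^ 'd" and \<kappa> \<theta> \<tau> :: real
    and x :: "nat \<Rightarrow> real" and k :: "nat \<Rightarrow> nat" and R :: "(int ^ 'd) rel"
  assumes C: "compact C" "interior C \<noteq> {}" "negligible (frontier C)"
    and c_pos: "\<And>n l. 0 < c n $ l"
    and c_lim: "\<And>l. filterlim (\<lambda>n. c n $ l) at_top sequentially"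
    and R: "translation_invariant_total_order R"
    and k_pos: "\<And>n. 0 < k n"
    and k_lim: "filterlim k at_top sequentially"
    and root_lim: "\<And>l. (\<lambda>n. root CARD('d) (real (k n)) / c n $ l) \<longlonglongrightarrow> 0"
    and Dplus_subset: "\<And>n. Dplus C c k n \<subseteq> Kset c \<kappa> n"
    and \<theta>: "0 < \<theta>" "cond_Dl M \<xi> R c x k \<theta>"
    and \<tau>: "0 < \<tau>"
      "(\<lambda>n. real (card (lattice_points (scale_set (c n) C))) * prob (exc (x n) 0)) \<longlonglongrightarrow> \<tau>"
begin

section \<open>Orders of magnitude of the box parameters\<close>

definition rt :: "nat \<Rightarrow> real" where "rt n = root CARD('d) (real (k n))"

definition volume :: "nat \<Rightarrow> real" where "volume n = (\<Prod>i\<in>UNIV. c n $ i)"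

definition p :: "nat \<Rightarrow> real" where "p n = prob (exc (x n) 0)"

definition m :: "nat \<Rightarrow> real" where "m n = (\<Prod>i\<in>UNIV. real_of_int (side c k n i))"

definition h :: "nat \<Rightarrow> real" where "h n = prob (hit (x n) (Jbox c k n 0))"

text \<open>The number of sites of a box outside its core, the same for all boxes. The truncated
  \<open>nat\<close> keeps this right when the core is empty.\<close>

definition margin :: "(nat \<Rightarrow> real ^ 'd) \<Rightarrow> nat \<Rightarrow> real" where
  "margin \<gamma> n = m n - (\<Prod>i\<in>UNIV. real (nat (side c k n i - 2 * \<lceil>\<bar>\<gamma> n $ i\<bar>\<rceil>)))"

abbreviation good :: "nat \<Rightarrow> bool" where "good n \<equiv> \<forall>i. 0 < side c k n i"

abbreviation Q :: "nat \<Rightarrow> (int ^ 'd) set" where "Q n \<equiv> Qminus C c k n"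

lemma rt_pos: "0 < rt n"
  using k_pos by (simp add: rt_def)

lemma rt_power: "rt n ^ CARD('d) = real (k n)"
  by (simp add: rt_def real_root_pow_pos2)

lemma real_k_lim: "filterlim (\<lambda>n. real (k n)) at_top sequentially"
  by (rule filterlim_compose[OF filterlim_real_sequentially k_lim])

lemma inverse_k_lim: "(\<lambda>n. 1 / real (k n)) \<longlonglongrightarrow> 0"
  using tendsto_inverse_0_at_top[OF real_k_lim] by (simp add: inverse_eq_divide)

lemma rt_lim: "filterlim rt at_top sequentially"
proof -
  have "filterlim (root CARD('d)) at_top at_top"
    unfolding filterlim_at_top
  proof
    fix Z :: real
    show "\<forall>\<^sub>F y in at_top. Z \<le> root CARD('d) y"
      using eventually_ge_at_top[of "\<bar>Z\<bar> ^ CARD('d)"]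
    proof eventually_elim
      case (elim y)
      have "Z \<le> root CARD('d) (\<bar>Z\<bar> ^ CARD('d))"
        by (simp add: real_root_power_cancel)
      also have "\<dots> \<le> root CARD('d) y"
        using elim by simp
      finally show ?case .
    qed
  qed
  from filterlim_compose[OF this real_k_lim] show ?thesis
    by (simp add: rt_def[abs_def])
qed

lemma inverse_rt_lim: "(\<lambda>n. 1 / rt n) \<longlonglongrightarrow> 0"
  using tendsto_inverse_0_at_top[OF rt_lim] by (simp add: inverse_eq_divide)

lemma scaled_side_lim: "filterlim (\<lambda>n. c n $ i / rt n) at_top sequentially"
proof -
  have "filterlim (\<lambda>n. inverse (rt n / c n $ i)) at_top sequentially"
    using root_lim[of i] rt_pos c_pos
    by (intro filterlim_inverse_at_top) (auto simp: rt_def[symmetric] intro!: always_eventually)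
  then show ?thesis
    by simp
qed

lemma eventually_good: "\<forall>\<^sub>F n in sequentially. good n"
proof (rule eventually_all_finite)
  fix i
  have "\<forall>\<^sub>F n in sequentially. 1 \<le> c n $ i / rt n"
    using scaled_side_lim[of i] by (simp add: filterlim_at_top)
  then show "\<forall>\<^sub>F n in sequentially. 0 < side c k n i"
    by eventually_elim (simp add: side_def rt_def)
qed

lemma eventually_cell_pos: "\<forall>\<^sub>F n in sequentially. \<forall>i. 0 < cell_vec c k n $ i"
  using eventually_good by eventually_elim (simp add: cell_vec_nth c_pos)

lemma cell_lim: "(\<lambda>n. cell_vec c k n $ i) \<longlonglongrightarrow> 0"
proof (rule tendsto_sandwich[OF _ _ tendsto_const inverse_rt_lim])
  show "\<forall>\<^sub>F n in sequentially. 0 \<le> cell_vec c k n $ i"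
    using eventually_cell_pos by eventually_elim (simp add: less_imp_le)
  show "\<forall>\<^sub>F n in sequentially. cell_vec c k n $ i \<le> 1 / rt n"
  proof (rule always_eventually, rule allI)
    fix n
    have "real_of_int (side c k n i) \<le> c n $ i / rt n"
      unfolding side_def rt_def by (rule of_int_floor_le)
    then show "cell_vec c k n $ i \<le> 1 / rt n"
      using c_pos[of n i] rt_pos[of n] by (simp add: cell_vec_nth field_simps)
  qed
qed

lemma volume_pos: "0 < volume n"
  unfolding volume_def using c_pos by (intro prod_pos) auto

lemma m_pos: "good n \<Longrightarrow> 0 < m n"
  unfolding m_def by (intro prod_pos) auto

text \<open>The identity \<open>k = rt^d\<close> gives one factor \<open>rt\<close> to each
  coordinate, and \<open>rt\<close> times a rounded side lies between c / 2 and c.\<close>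

lemma km_le_volume: "good n \<Longrightarrow> real (k n) * m n \<le> volume n"
  and volume_le_km: "good n \<Longrightarrow> volume n \<le> 2 ^ CARD('d) * (real (k n) * m n)"
proof -
  assume good: "good n"
  have km: "real (k n) * m n = (\<Prod>i\<in>UNIV. rt n * side c k n i)"
    unfolding m_def rt_power[symmetric] by (simp add: prod.distrib)
  have le: "rt n * side c k n i \<le> c n $ i" "c n $ i \<le> 2 * (rt n * side c k n i)" for i
    using side_le[of c k n i] le_2_side[of c k n i] good c_pos k_pos rt_pos[of n]
    by (simp_all add: rt_def[symmetric] field_simps)
  show "real (k n) * m n \<le> volume n"
    unfolding km volume_def using le(1) good rt_pos[of n] by (intro prod_mono) (auto simp: less_imp_le)
  have "volume n \<le> (\<Prod>i\<in>(UNIV :: 'd set). 2 * (rt n * side c k n i))"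
    unfolding volume_def using le(2) c_pos by (intro prod_mono) (auto simp: less_imp_le)
  also have "\<dots> = 2 ^ CARD('d) * (real (k n) * m n)"
    unfolding km by (simp add: prod.distrib)
  finally show "volume n \<le> 2 ^ CARD('d) * (real (k n) * m n)" .
qed

lemma prod_cell: "(\<Prod>i\<in>UNIV. cell_vec c k n $ i) = m n / volume n"
  by (simp add: cell_vec_nth m_def volume_def prod_dividef)

text \<open>Counting lattice points makes the cardinality of D_n comparable to
  \<open>volume\<close>, hence to \<open>k m\<close>; its product with \<open>p\<close> tends to
  \<tau>, which is positive and finite.\<close>

lemma kmp_bounds:
  obtains a b where "0 < a" "0 < b" "\<forall>\<^sub>F n in sequentially. a \<le> real (k n) * (m n * p n)"
    "\<forall>\<^sub>F n in sequentially. real (k n) * (m n * p n) \<le> b"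
proof -
  let ?h = "\<lambda>n. \<chi> i. 1 / c n $ i"
  have lim: "(\<lambda>n. ?h n $ i) \<longlonglongrightarrow> 0" for i
    using tendsto_inverse_0_at_top[OF c_lim[of i]] by (simp add: inverse_eq_divide)
  have prod: "(\<Prod>i\<in>UNIV. ?h n $ i) = 1 / volume n" for n
    by (simp add: volume_def prod_dividef)
  obtain a b where ab: "0 < a" "0 < b"
    "\<forall>\<^sub>F n in sequentially. a \<le> real (card (grid_index C (?h n))) * (1 / volume n)"
    "\<forall>\<^sub>F n in sequentially. real (card (grid_index C (?h n))) * (1 / volume n) \<le> b"
    using grid_index_count[of C ?h] C c_pos lim unfolding prod
    by (auto simp: compact_imp_bounded)
  have D: "real (card (lattice_points (scale_set (c n) C))) = real (card (grid_index C (?h n)))" for n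
    using lattice_points_scaled_eq_grid_index[of "c n" C] c_pos by simp
  have Dp: "\<forall>\<^sub>F n in sequentially. \<tau> / 2 < real (card (grid_index C (?h n))) * p n"
      "\<forall>\<^sub>F n in sequentially. real (card (grid_index C (?h n))) * p n < 2 * \<tau>"
    using order_tendstoD[OF \<tau>(2), of "\<tau> / 2"] order_tendstoD[OF \<tau>(2), of "2 * \<tau>"] \<tau>(1)
    unfolding D p_def by simp_all
  show ?thesis
  proof (rule that)
    show "0 < \<tau> / (2 * b) / 2 ^ CARD('d)" "0 < 2 * \<tau> / a"
      using ab \<tau>(1) by simp_all
    show "\<forall>\<^sub>F n in sequentially. \<tau> / (2 * b) / 2 ^ CARD('d) \<le> real (k n) * (m n * p n)"
      using eventually_good ab(4) Dp(1)
    proof eventually_elim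
      case (elim n)
      have p0: "0 \<le> p n"
        by (simp add: p_def)
      have "\<tau> / 2 \<le> real (card (grid_index C (?h n))) * p n"
        using elim by simp
      also have "\<dots> \<le> (b * volume n) * p n"
        using elim(2) volume_pos[of n] p0 by (intro mult_right_mono) (simp_all add: field_simps)
      also have "\<dots> \<le> (b * (2 ^ CARD('d) * (real (k n) * m n))) * p n"
        using volume_le_km[OF elim(1)] ab(2) p0 by (intro mult_right_mono mult_left_mono) auto
      finally show ?case
        using ab(2) by (simp add: field_simps)
    qed
    show "\<forall>\<^sub>F n in sequentially. real (k n) * (m n * p n) \<le> 2 * \<tau> / a"
      using eventually_good ab(3) Dp(2)
    proof eventually_elim
      case (elim n)
      have p0: "0 \<le> p n"
        by (simp add: p_def)
      have "a * (real (k n) * m n) * p n \<le> a * volume n * p n"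
        using km_le_volume[OF elim(1)] ab(1) p0 by (intro mult_right_mono mult_left_mono) auto
      also have "\<dots> \<le> real (card (grid_index C (?h n))) * p n"
        using elim(2) volume_pos[of n] p0 by (intro mult_right_mono) (simp_all add: field_simps)
      also have "\<dots> \<le> 2 * \<tau>"
        using elim(3) by simp
      finally show ?case
        using ab(1) by (simp add: field_simps)
    qed
  qed
qed

lemma finite_Q: "good n \<Longrightarrow> finite (Q n)"
proof -
  assume "good n"
  then have pos: "0 < cell_vec c k n $ i" for i
    by (simp add: cell_vec_nth c_pos)
  obtain b where b: "0 < b" "\<And>u. u \<in> C \<Longrightarrow> norm u \<le> b"
    using compact_imp_bounded[OF C(1)] by (auto simp: bounded_pos)
  have "\<bar>u $ i\<bar> \<le> b" if "u \<in> C" for u i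
    using b(2)[OF that] component_le_norm_cart[of u i] by linarith
  then show "finite (Q n)"
    unfolding Qminus_eq_grid_index using grid_index_upper(1)[of "cell_vec c k n" C b] pos b(1) by auto
qed

text \<open>A cell of the rescaled grid has volume \<open>m / volume\<close>, of order
  \<open>1/k\<close>, and the total volume of the counted cells is bounded on both sides.\<close>

lemma card_Q_bounds:
  obtains a b where "0 < a" "0 < b" "\<forall>\<^sub>F n in sequentially. a * real (k n) \<le> real (card (Q n))"
    "\<forall>\<^sub>F n in sequentially. real (card (Q n)) \<le> b * real (k n)"
proof -
  obtain a b where ab: "0 < a" "0 < b"
    "\<forall>\<^sub>F n in sequentially. a \<le> real (card (Q n)) * (m n / volume n)"
    "\<forall>\<^sub>F n in sequentially. real (card (Q n)) * (m n / volume n) \<le> b"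
    using grid_index_count[of C "cell_vec c k"] C eventually_cell_pos cell_lim
    unfolding prod_cell Qminus_eq_grid_index by (auto simp: compact_imp_bounded)
  show ?thesis
  proof (rule that)
    show "0 < a" "0 < b * 2 ^ CARD('d)"
      using ab by simp_all
    show "\<forall>\<^sub>F n in sequentially. a * real (k n) \<le> real (card (Q n))"
      using eventually_good ab(3)
    proof eventually_elim
      case (elim n)
      have "a * (real (k n) * m n) \<le> a * volume n"
        using km_le_volume[OF elim(1)] ab(1) by simp
      also have "\<dots> \<le> real (card (Q n)) * m n"
        using elim(2) volume_pos[of n] by (simp add: field_simps)
      finally show ?case
        using m_pos[OF elim(1)] by simp
    qed
    show "\<forall>\<^sub>F n in sequentially. real (card (Q n)) \<le> b * 2 ^ CARD('d) * real (k n)"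
      using eventually_good ab(4)
    proof eventually_elim
      case (elim n)
      have "real (card (Q n)) * m n \<le> b * volume n"
        using elim(2) volume_pos[of n] by (simp add: field_simps)
      also have "\<dots> \<le> b * (2 ^ CARD('d) * (real (k n) * m n))"
        using volume_le_km[OF elim(1)] ab(2) by simp
      finally have "real (card (Q n)) * m n \<le> (b * 2 ^ CARD('d) * real (k n)) * m n"
        by (simp add: mult_ac)
      then show ?case
        using m_pos[OF elim(1)] by simp
    qed
  qed
qed

lemma card_Jbox_m: "good n \<Longrightarrow> real (card (Jbox c k n z)) = m n"
  using card_Jbox[of c k n z] c_pos k_pos by (simp add: m_def)

lemma prob_hit_Jbox: "good n \<Longrightarrow> prob (hit (x n) (Jbox c k n z)) = h n"
  using Jbox_shift[of c k n z] prob_hit_shift c_pos k_pos by (simp add: h_def)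

lemma core_in_Jbox: "good n \<Longrightarrow> core c k \<gamma> n z \<subseteq> Jbox c k n z"
  using core_subset c_pos k_pos by blast

lemma fin_Jbox: "good n \<Longrightarrow> finite (Jbox c k n z)"
  using finite_Jbox c_pos k_pos by blast

lemma card_Jbox_diff_core: "good n \<Longrightarrow> real (card (Jbox c k n z - core c k \<gamma> n z)) = margin \<gamma> n"
proof -
  assume g: "good n"
  have "real (card (Jbox c k n z - core c k \<gamma> n z)) = real (card (Jbox c k n z)) - real (card (core c k \<gamma> n z))"
    using card_Diff_subset[OF finite_subset[OF core_in_Jbox[OF g] fin_Jbox[OF g]] core_in_Jbox[OF g]]
      card_mono[OF fin_Jbox[OF g] core_in_Jbox[OF g]] by (simp add: of_nat_diff)
  then show ?thesis
    using g c_pos k_pos by (simp add: card_Jbox_m card_core margin_def)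
qed

lemma Jbox_subset_Kset: "good n \<Longrightarrow> z \<in> Q n \<Longrightarrow> Jbox c k n z \<subseteq> Kset c \<kappa> n"
  using Jbox_subset_Dplus[of c k n z C] Dplus_subset[of n] c_pos k_pos by auto

lemma h_nonneg: "0 \<le> h n"
  by (simp add: h_def)

lemma p_nonneg: "0 \<le> p n"
  by (simp add: p_def)

lemma h_le_mp: "good n \<Longrightarrow> h n \<le> m n * p n"
  unfolding h_def p_def using prob_hit_le[OF fin_Jbox] card_Jbox_m by metis

text \<open>In each direction the core keeps a fraction of the side tending to 1: the layer is
  negligible because \<gamma> is o(c / k^(1/d)), its rounding because c / k^(1/d) tends to infinity.
  The remaining factor \<open>k m p\<close> is bounded.\<close>

lemma k_margin_lim:
  assumes \<gamma>: "vec_smallo (\<lambda>n. root CARD('d) (real (k n)) *\<^sub>R \<gamma> n) c"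
  shows "(\<lambda>n. real (k n) * (margin \<gamma> n * p n)) \<longlonglongrightarrow> 0"
proof -
  have lim1: "(\<lambda>n. real (nat (side c k n i - 2 * \<lceil>\<bar>\<gamma> n $ i\<bar>\<rceil>)) / side c k n i) \<longlonglongrightarrow> 1" for i
  proof (rule tendsto_sandwich[OF _ _ _ tendsto_const])
    \<comment> \<open>4 is two faces times the factor 2 of \<open>le_2_side\<close>; the summand
      \<open>rt n / c n $ i\<close> pays for rounding up.\<close>
    let ?l = "\<lambda>n. 1 - 4 * (\<bar>rt n * \<gamma> n $ i / c n $ i\<bar> + rt n / c n $ i)"
    have "(\<lambda>n. rt n * \<gamma> n $ i / c n $ i) \<longlonglongrightarrow> 0"
      using \<gamma> by (simp add: vec_smallo_def rt_def)
    then have "(\<lambda>n. \<bar>rt n * \<gamma> n $ i / c n $ i\<bar> + rt n / c n $ i) \<longlonglongrightarrow> 0"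
      using root_lim[of i] unfolding rt_def[symmetric] by (intro tendsto_add_zero tendsto_rabs_zero)
    from tendsto_diff[OF tendsto_const[of 1] tendsto_mult_left[OF this, of 4]]
    show "?l \<longlonglongrightarrow> 1"
      by simp
    show "\<forall>\<^sub>F n in sequentially. ?l n \<le> real (nat (side c k n i - 2 * \<lceil>\<bar>\<gamma> n $ i\<bar>\<rceil>)) / side c k n i"
      using eventually_good
    proof eventually_elim
      case (elim n)
      let ?s = "real_of_int (side c k n i)"
      have s: "0 < ?s"
        using elim by simp
      have le: "c n $ i / rt n \<le> 2 * ?s"
        using le_2_side[of c k n i] elim c_pos k_pos by (simp add: rt_def)
      have inv: "1 / ?s \<le> 2 * (rt n / c n $ i)"
        using le s c_pos[of n i] rt_pos[of n] by (simp add: field_simps)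
      have "?s - 2 * (\<bar>\<gamma> n $ i\<bar> + 1) \<le> real (nat (side c k n i - 2 * \<lceil>\<bar>\<gamma> n $ i\<bar>\<rceil>))"
      proof -
        have "side c k n i - 2 * \<lceil>\<bar>\<gamma> n $ i\<bar>\<rceil> \<le> int (nat (side c k n i - 2 * \<lceil>\<bar>\<gamma> n $ i\<bar>\<rceil>))"
          by simp
        then have "real_of_int (side c k n i - 2 * \<lceil>\<bar>\<gamma> n $ i\<bar>\<rceil>)
            \<le> real (nat (side c k n i - 2 * \<lceil>\<bar>\<gamma> n $ i\<bar>\<rceil>))"
          by linarith
        then show ?thesis
          using of_int_ceiling_le_add_one[of "\<bar>\<gamma> n $ i\<bar>"] by (simp add: algebra_simps)
      qed
      then have "(?s - 2 * (\<bar>\<gamma> n $ i\<bar> + 1)) / ?s \<le> real (nat (side c k n i - 2 * \<lceil>\<bar>\<gamma> n $ i\<bar>\<rceil>)) / ?s"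
        using s by (intro divide_right_mono) auto
      moreover have "(?s - 2 * (\<bar>\<gamma> n $ i\<bar> + 1)) / ?s = 1 - 2 * (\<bar>\<gamma> n $ i\<bar> + 1) * (1 / ?s)"
        using s by (simp add: field_simps)
      moreover have "2 * (\<bar>\<gamma> n $ i\<bar> + 1) * (1 / ?s) \<le> 2 * (\<bar>\<gamma> n $ i\<bar> + 1) * (2 * (rt n / c n $ i))"
        using inv by (intro mult_left_mono) auto
      moreover have "2 * (\<bar>\<gamma> n $ i\<bar> + 1) * (2 * (rt n / c n $ i)) = 4 * (\<bar>rt n * \<gamma> n $ i / c n $ i\<bar> + rt n / c n $ i)"
        using c_pos[of n i] rt_pos[of n] by (simp add: abs_mult field_simps)
      ultimately show ?case
        by linarith
    qed
    show "\<forall>\<^sub>F n in sequentially. real (nat (side c k n i - 2 * \<lceil>\<bar>\<gamma> n $ i\<bar>\<rceil>)) / side c k n i \<le> 1"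
      using eventually_good
    proof eventually_elim
      case (elim n)
      have "0 \<le> \<lceil>\<bar>\<gamma> n $ i\<bar>\<rceil>"
        by simp
      then have "real (nat (side c k n i - 2 * \<lceil>\<bar>\<gamma> n $ i\<bar>\<rceil>)) \<le> side c k n i"
        using spec[OF elim, of i] by linarith
      then show ?case
        using elim by simp
    qed
  qed
  have "(\<lambda>n. \<Prod>i\<in>UNIV. real (nat (side c k n i - 2 * \<lceil>\<bar>\<gamma> n $ i\<bar>\<rceil>)) / side c k n i) \<longlonglongrightarrow> (\<Prod>i\<in>(UNIV :: 'd set). 1)"
    by (rule tendsto_prod) (rule lim1)
  then have "(\<lambda>n. 1 - (\<Prod>i\<in>UNIV. real (nat (side c k n i - 2 * \<lceil>\<bar>\<gamma> n $ i\<bar>\<rceil>)) / side c k n i)) \<longlonglongrightarrow> 1 - 1"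
    by (intro tendsto_diff tendsto_const) simp
  then have lim: "(\<lambda>n. 1 - (\<Prod>i\<in>UNIV. real (nat (side c k n i - 2 * \<lceil>\<bar>\<gamma> n $ i\<bar>\<rceil>)) / side c k n i)) \<longlonglongrightarrow> 0"
    by simp
  obtain b where b: "\<forall>\<^sub>F n in sequentially. real (k n) * (m n * p n) \<le> b"
    using kmp_bounds by metis
  have "\<forall>\<^sub>F n in sequentially. \<bar>real (k n) * (m n * p n)\<bar> \<le> b"
    using b eventually_good
    by eventually_elim (use m_pos p_nonneg in \<open>simp add: abs_mult less_imp_le\<close>)
  from tendsto_zero_mult_bounded[OF lim this]
  show ?thesis
  proof (rule Lim_transform_eventually)
    show "\<forall>\<^sub>F n in sequentially. (1 - (\<Prod>i\<in>UNIV. real (nat (side c k n i - 2 * \<lceil>\<bar>\<gamma> n $ i\<bar>\<rceil>)) / side c k n i))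
        * (real (k n) * (m n * p n)) = real (k n) * (margin \<gamma> n * p n)"
      using eventually_good
    proof eventually_elim
      case (elim n)
      have "(\<Prod>i\<in>UNIV. real (nat (side c k n i - 2 * \<lceil>\<bar>\<gamma> n $ i\<bar>\<rceil>)) / side c k n i) * m n =
          (\<Prod>i\<in>UNIV. real (nat (side c k n i - 2 * \<lceil>\<bar>\<gamma> n $ i\<bar>\<rceil>)))"
        unfolding prod_dividef m_def[symmetric] using m_pos[OF elim] by simp
      then show ?case
        by (simp add: margin_def algebra_simps)
    qed
  qed
qed

section \<open>The probability that a box is hit\<close>

text \<open>Mixing is assumed inside \<open>Kset\<close> only. A block around an interior point
  \<open>y\<close> of C lies there eventually, and by stationarity any box may be used to estimate
  \<open>h\<close>.\<close>

lemma obtain_inner_box: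
  obtains z where "\<forall>\<^sub>F n in sequentially. surround c k n (z n) \<subseteq> Kset c \<kappa> n"
proof -
  obtain y r where yr: "0 < r" "ball y r \<subseteq> C"
    using C(2) by (meson ex_in_conv mem_interior)
  define z where "z n = (\<chi> i. \<lfloor>c n $ i * y $ i / side c k n i\<rfloor>)" for n
  \<comment> \<open>A site of the block is at most two sides away from \<open>c y\<close> in each
    coordinate, that is 2 / rt after rescaling; \<open>CARD('d)\<close> comes from the l1 bound of
    the norm.\<close>
  have "\<forall>\<^sub>F n in sequentially. 2 * (1 / rt n) * CARD('d) < r"
    using order_tendstoD(2)[OF tendsto_mult_left_zero[OF tendsto_mult_right_zero[OF inverse_rt_lim]] yr(1)] .
  then have "\<forall>\<^sub>F n in sequentially. surround c k n (z n) \<subseteq> Kset c \<kappa> n"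
    using eventually_good
  proof eventually_elim
    case (elim n)
    show ?case
    proof
      fix v
      assume v: "v \<in> surround c k n (z n)"
      let ?u = "vec_divide (real_vec v) (c n)"
      have "norm (?u - y) \<le> (\<Sum>i\<in>UNIV. \<bar>(?u - y) $ i\<bar>)"
        by (rule norm_le_l1_cart)
      also have "\<dots> \<le> (\<Sum>i\<in>(UNIV :: 'd set). 2 * (1 / rt n))"
      proof (rule sum_mono)
        fix i
        let ?s = "real_of_int (side c k n i)"
        have s: "0 < ?s"
          using elim by simp
        have z: "z n $ i * ?s \<le> c n $ i * y $ i" "c n $ i * y $ i < z n $ i * ?s + ?s"
        proof -
          have "real_of_int (z n $ i) \<le> c n $ i * y $ i / ?s" "c n $ i * y $ i / ?s < z n $ i + 1"
            unfolding z_def by simp_all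
          then show "z n $ i * ?s \<le> c n $ i * y $ i" "c n $ i * y $ i < z n $ i * ?s + ?s"
            using s by (simp_all add: field_simps)
        qed
        have "real_of_int ((z n $ i - 1) * side c k n i) \<le> v $ i" "v $ i < real_of_int ((z n $ i + 2) * side c k n i)"
          using v unfolding surround_def of_int_le_iff of_int_less_iff by blast+
        then have "z n $ i * ?s - ?s \<le> v $ i" "v $ i < z n $ i * ?s + 2 * ?s"
          by (simp_all add: algebra_simps)
        then have "\<bar>real_of_int (v $ i) - c n $ i * y $ i\<bar> \<le> 2 * ?s"
          using z s by linarith
        also have "\<dots> \<le> 2 * (c n $ i / rt n)"
          using side_le[of c k n i] elim c_pos k_pos by (simp add: rt_def)
        finally have "\<bar>real_of_int (v $ i) - c n $ i * y $ i\<bar> / c n $ i \<le> 2 * (c n $ i / rt n) / c n $ i"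
          using c_pos[of n i] by (intro divide_right_mono) auto
        moreover have "(?u - y) $ i = (real_of_int (v $ i) - c n $ i * y $ i) / c n $ i"
          using c_pos[of n i] by (simp add: vec_divide_def real_vec_def field_simps)
        ultimately show "\<bar>(?u - y) $ i\<bar> \<le> 2 * (1 / rt n)"
          using c_pos[of n i] by (simp add: abs_divide)
      qed
      also have "\<dots> = 2 * (1 / rt n) * CARD('d)"
        by simp
      also have "\<dots> < r"
        using elim by simp
      finally have "?u \<in> C"
        using yr(2) by (auto simp: subset_iff dist_norm norm_minus_commute)
      then have "v \<in> Dplus C c k n"
        by (intro scaled_lattice_point_in_Dplus) (use elim c_pos k_pos in auto)
      then show "v \<in> Kset c \<kappa> n"
        using Dplus_subset by blast
    qed
  qed
  then show ?thesis
    using that by blast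
qed

lemma hit_Jbox_mixing:
  assumes good: "good n" and E: "E \<in> events"
    and mix: "\<bar>prob ({\<omega> \<in> space M. field_max \<xi> (core c k \<gamma> n z) \<omega> \<le> ereal (x n)} \<inter> E)
      - prob {\<omega> \<in> space M. field_max \<xi> (core c k \<gamma> n z) \<omega> \<le> ereal (x n)} * prob E\<bar> \<le> \<alpha>"
  shows "\<bar>prob (hit (x n) (Jbox c k n z) \<inter> E) - h n * prob E\<bar> \<le> \<alpha> + 2 * (margin \<gamma> n * p n)"
  using hit_mixing[OF fin_Jbox[OF good] core_in_Jbox[OF good] E mix]
  by (simp only: prob_hit_Jbox[OF good] card_Jbox_diff_core[OF good] p_def)

lemma theta_lim:
  "\<forall>\<^sub>F n in sequentially. 0 < p n"
  "(\<lambda>n. prob (exc (x n) 0 - hit (x n) (Aset R c k n 0)) / p n) \<longlonglongrightarrow> \<theta>"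
proof -
  obtain a where a: "0 < a" "\<forall>\<^sub>F n in sequentially. a \<le> real (k n) * (m n * p n)"
    using kmp_bounds by metis
  show "\<forall>\<^sub>F n in sequentially. 0 < p n"
    using a(2)
  proof eventually_elim
    case (elim n)
    then have "p n \<noteq> 0"
      using a(1) by auto
    then show ?case
      using p_nonneg[of n] by simp
  qed
  have "{\<omega> \<in> space M. field_max \<xi> A \<omega> \<le> ereal y \<and> y < \<xi> 0 \<omega>} = exc y 0 - hit y A" for A y
    using field_max_le_eq[of A y] by (auto simp: exc_def)
  then have "cond_prob M (\<lambda>\<omega>. field_max \<xi> (Aset R c k n 0) \<omega> \<le> ereal (x n)) (\<lambda>\<omega>. \<xi> 0 \<omega> > x n)
      = prob (exc (x n) 0 - hit (x n) (Aset R c k n 0)) / p n" for n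
    by (simp add: cond_prob_def p_def exc_def)
  then show "(\<lambda>n. prob (exc (x n) 0 - hit (x n) (Aset R c k n 0)) / p n) \<longlonglongrightarrow> \<theta>"
    using \<theta>(2) by (simp add: cond_Dl_def)
qed

text \<open>A sandwich. Divided by \<open>m p\<close>, the bounds of
  \<open>prob_hit_last_exceedance\<close> become \<open>t n\<close>, which tends to \<theta>, and
  \<open>t n\<close> plus \<open>g / (m p)\<close>; the latter quotient vanishes because
  \<open>k g\<close> does while \<open>k m p\<close> is bounded below.\<close>

lemma prob_hit_ratio_lim:
  assumes D: "cond_D M \<xi> c x (Kset c \<kappa>) \<gamma> \<alpha>"
    and \<alpha>: "(\<lambda>n. real (k n) * \<alpha> n) \<longlonglongrightarrow> 0"
    and \<gamma>: "vec_smallo (\<lambda>n. root CARD('d) (real (k n)) *\<^sub>R \<gamma> n) c"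
  shows "(\<lambda>n. h n / (m n * p n)) \<longlonglongrightarrow> \<theta>"
proof -
  obtain z where z: "\<forall>\<^sub>F n in sequentially. surround c k n (z n) \<subseteq> Kset c \<kappa> n"
    using obtain_inner_box by blast
  obtain a b where ab: "0 < a" "0 < b" "\<forall>\<^sub>F n in sequentially. a \<le> real (k n) * (m n * p n)"
      "\<forall>\<^sub>F n in sequentially. real (k n) * (m n * p n) \<le> b"
    by (rule kmp_bounds)
  define t where "t n = prob (exc (x n) 0 - hit (x n) (Aset R c k n 0)) / p n" for n
  \<comment> \<open>Bounds the joint hit of the box and the ring around it: hit probabilities at
    most \<open>m p\<close> and 3^d \<open>m p\<close>, the mixing error, and the cost of passing to
    the core.\<close>
  define g where "g n = 3 ^ CARD('d) * (m n * p n)\<^sup>2 + \<alpha> n + 2 * (margin \<gamma> n * p n)" for n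
  have kg_lim: "(\<lambda>n. real (k n) * g n) \<longlonglongrightarrow> 0"
  proof -
    have "\<forall>\<^sub>F n in sequentially. \<bar>3 ^ CARD('d) * (real (k n) * (m n * p n))\<^sup>2\<bar> \<le> 3 ^ CARD('d) * b\<^sup>2"
      using ab(3,4) by eventually_elim (use ab(1) in \<open>auto simp: abs_mult intro!: power_mono\<close>)
    from tendsto_zero_mult_bounded[OF inverse_k_lim this]
    have "(\<lambda>n. 1 / real (k n) * (3 ^ CARD('d) * (real (k n) * (m n * p n))\<^sup>2) + real (k n) * \<alpha> n
        + 2 * (real (k n) * (margin \<gamma> n * p n))) \<longlonglongrightarrow> 0 + 0 + 2 * 0"
      by (intro tendsto_add tendsto_mult tendsto_const \<alpha> k_margin_lim[OF \<gamma>])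
    moreover have "1 / real (k n) * (3 ^ CARD('d) * (real (k n) * (m n * p n))\<^sup>2) + real (k n) * \<alpha> n
        + 2 * (real (k n) * (margin \<gamma> n * p n)) = real (k n) * g n" for n
      using k_pos[of n] by (simp add: g_def field_simps power2_eq_square)
    ultimately show ?thesis
      by simp
  qed
  have "(\<lambda>n. real (k n) * g n * (1 / (real (k n) * (m n * p n)))) \<longlonglongrightarrow> 0"
  proof (rule tendsto_zero_mult_bounded[OF kg_lim])
    show "\<forall>\<^sub>F n in sequentially. \<bar>1 / (real (k n) * (m n * p n))\<bar> \<le> 1 / a"
      using ab(3) by eventually_elim (use ab(1) in \<open>auto simp: frac_le\<close>)
  qed
  from tendsto_add[OF theta_lim(2) this]
  have upper: "(\<lambda>n. t n + real (k n) * g n * (1 / (real (k n) * (m n * p n)))) \<longlonglongrightarrow> \<theta>"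
    by (simp add: t_def)
  have "\<forall>\<^sub>F n in sequentially. m n * p n * t n \<le> h n \<and> h n \<le> m n * p n * t n + g n"
    using eventually_good z theta_lim(1)
  proof eventually_elim
    case (elim n)
    note pos = elim(1)[rule_format] c_pos k_pos
    let ?J = "Jbox c k n (z n)" and ?A = "Aset R c k n 0" and ?B = "surround c k n (z n) - Jbox c k n (z n)"
    let ?core = "core c k \<gamma> n (z n)"
    have t: "prob (exc (x n) 0 - hit (x n) ?A) = p n * t n"
      using elim(3) by (simp add: t_def)
    have succ: "(0, w) \<in> R \<and> w \<noteq> 0" if "w \<in> ?A" for w
      using that mem_Aset[OF pos, of w R] by auto
    have out: "(+) v ` ?A - ?J \<subseteq> ?B" if "v \<in> ?J" for v
      using translate_Aset_subset_surround[OF pos that, of R] by blast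
    note last = prob_hit_last_exceedance[OF R fin_Jbox[OF elim(1)] translate_mem_Aset[OF pos R] succ out, where x = "x n"]
    have 1: "card ?J * prob (exc (x n) 0 - hit (x n) ?A) \<le> prob (hit (x n) ?J)"
      and 2: "prob (hit (x n) ?J) \<le> card ?J * prob (exc (x n) 0 - hit (x n) ?A) + prob (hit (x n) ?J \<inter> hit (x n) ?B)"
      using last by simp_all
    have J_sub: "?J \<subseteq> surround c k n (z n)"
    proof
      fix v
      assume v: "v \<in> ?J"
      show "v \<in> surround c k n (z n)"
        unfolding surround_def
      proof (intro CollectI allI)
        fix i
        show "(z n $ i - 1) * side c k n i \<le> v $ i \<and> v $ i < (z n $ i + 2) * side c k n i"
          using v[unfolded mem_Jbox[OF pos], rule_format, of i] pos(1)[of i] by (simp add: algebra_simps)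
      qed
    qed
    have sep: "separated (\<gamma> n) ?core ?B"
      by (rule separated_core[OF pos, where z = "z n"]) auto
    have sub: "?core \<subseteq> Kset c \<kappa> n" "?B \<subseteq> Kset c \<kappa> n"
      using J_sub elim(2) core_in_Jbox[OF elim(1), of \<gamma> "z n"] by auto
    let ?EA = "{\<omega> \<in> space M. field_max \<xi> ?core \<omega> \<le> ereal (x n)}"
      and ?EB = "{\<omega> \<in> space M. field_max \<xi> ?B \<omega> \<le> ereal (x n)}"
    \<comment> \<open>\<open>cond_D\<close> speaks of the maximum over a union, which amounts to
      intersecting two events without exceedances.\<close>
    have EAB: "{\<omega> \<in> space M. field_max \<xi> (?core \<union> ?B) \<omega> \<le> ereal (x n)} = ?EA \<inter> ?EB"
      unfolding field_max_le_eq by (auto simp: hit_def)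
    have mixB: "\<bar>prob (?EA \<inter> ?EB) - prob ?EA * prob ?EB\<bar> \<le> \<alpha> n"
      using D sub sep is_lattice_box_core[OF pos, of \<gamma> "z n"] unfolding cond_D_def EAB[symmetric] by blast
    have EB: "?EB = space M - hit (x n) ?B"
      by (rule field_max_le_eq)
    have EA_ev: "?EA \<in> events"
      unfolding field_max_le_eq by auto
    have EAB_eq: "prob (?EA \<inter> ?EB) = prob ?EA - prob (?EA \<inter> hit (x n) ?B)"
    proof -
      have "?EA \<inter> ?EB = ?EA - ?EA \<inter> hit (x n) ?B"
        unfolding EB by auto
      then show ?thesis
        using EA_ev by (simp add: finite_measure_Diff)
    qed
    have EB_eq: "prob ?EB = 1 - prob (hit (x n) ?B)"
      unfolding EB by (simp add: prob_compl)
    \<comment> \<open>Replacing the absence of exceedances in \<open>?B\<close> by their presence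
      only changes the sign of the covariance.\<close>
    have "prob (?EA \<inter> ?EB) - prob ?EA * prob ?EB
        = - (prob (?EA \<inter> hit (x n) ?B) - prob ?EA * prob (hit (x n) ?B))"
      unfolding EAB_eq EB_eq by (simp add: right_diff_distrib)
    with mixB have "\<bar>prob (?EA \<inter> hit (x n) ?B) - prob ?EA * prob (hit (x n) ?B)\<bar> \<le> \<alpha> n"
      by (simp only: abs_minus_cancel)
    from hit_Jbox_mixing[OF elim(1) hit_events this]
    have "prob (hit (x n) ?J \<inter> hit (x n) ?B) \<le> h n * prob (hit (x n) ?B) + \<alpha> n + 2 * (margin \<gamma> n * p n)"
      by linarith
    also have "h n * prob (hit (x n) ?B) \<le> (m n * p n) * (3 ^ CARD('d) * (m n * p n))"
    proof (intro mult_mono)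
      have "prob (hit (x n) ?B) \<le> prob (hit (x n) (surround c k n (z n)))"
        by (intro finite_measure_mono hit_mono) auto
      also have "\<dots> \<le> card (surround c k n (z n)) * p n"
        unfolding p_def by (rule prob_hit_le[OF finite_surround[OF pos]])
      finally show "prob (hit (x n) ?B) \<le> 3 ^ CARD('d) * (m n * p n)"
        unfolding card_surround[OF pos] by (simp add: m_def mult_ac)
    qed (use h_le_mp[OF elim(1)] m_pos[OF elim(1)] p_nonneg in auto)
    finally have "prob (hit (x n) ?J \<inter> hit (x n) ?B) \<le> g n"
      by (simp add: g_def power2_eq_square algebra_simps)
    then show ?case
      using 1 2 unfolding t card_Jbox_m[OF elim(1)] prob_hit_Jbox[OF elim(1)] by (simp add: mult.assoc)
  qed
  then have bounds: "\<forall>\<^sub>F n in sequentially. t n \<le> h n / (m n * p n) \<and>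
      h n / (m n * p n) \<le> t n + real (k n) * g n * (1 / (real (k n) * (m n * p n)))"
    using eventually_good theta_lim(1)
  proof eventually_elim
    case (elim n)
    have mp: "0 < m n * p n"
      using elim m_pos by auto
    have eq: "real (k n) * g n * (1 / (real (k n) * (m n * p n))) = g n / (m n * p n)"
      using k_pos[of n] by (simp add: field_simps)
    have "u \<le> y / s \<and> y / s \<le> u + w / s" if "0 < s" "s * u \<le> y \<and> y \<le> s * u + w" for s u w y :: real
      using that by (simp add: field_simps)
    from this[OF mp elim(1)] show ?case
      unfolding eq .
  qed
  show ?thesis
  proof (rule tendsto_sandwich[OF _ _ _ upper])
    show "t \<longlonglongrightarrow> \<theta>"
      using theta_lim(2) by (simp add: t_def[abs_def])
  qed (use bounds in \<open>auto elim: eventually_mono\<close>)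
qed

lemma cond_expect_Ycount:
  assumes good: "good n"
  shows "cond_expect M (\<lambda>\<omega>. real (Ycount \<xi> c x k n 0 \<omega>)) (\<lambda>\<omega>. Ycount \<xi> c x k n 0 \<omega> > 0) = m n * p n / h n"
proof -
  let ?J = "Jbox c k n 0"
  have fin: "finite ?J"
    by (rule fin_Jbox[OF good])
  have ev: "{\<omega> \<in> space M. Ycount \<xi> c x k n 0 \<omega> > 0} = hit (x n) ?J"
    using fin by (auto simp: Ycount_def card_gt_0_iff hit_def)
  have "(LINT \<omega>:hit (x n) ?J|M. real (Ycount \<xi> c x k n 0 \<omega>))
      = (LINT \<omega>:hit (x n) ?J|M. real (card {v \<in> ?J. \<omega> \<in> exc (x n) v}))"
    by (rule set_lebesgue_integral_cong) (auto simp: Ycount_def exc_def hit_def)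
  also have "\<dots> = (\<Sum>v\<in>?J. prob (exc (x n) v \<inter> hit (x n) ?J))"
    by (rule set_integral_card_events[OF fin]) auto
  also have "\<dots> = (\<Sum>v\<in>?J. p n)"
  proof (rule sum.cong[OF refl])
    fix v
    assume "v \<in> ?J"
    then have "exc (x n) v \<inter> hit (x n) ?J = exc (x n) v"
      by (auto simp: exc_def hit_def)
    then show "prob (exc (x n) v \<inter> hit (x n) ?J) = p n"
      using prob_exc[of "x n" v] by (simp add: p_def)
  qed
  finally show ?thesis
    unfolding cond_expect_def ev using card_Jbox_m[OF good, of 0] by (simp add: h_def)
qed

lemma cond_expect_Ycount_lim:
  assumes "(\<lambda>n. h n / (m n * p n)) \<longlonglongrightarrow> \<theta>"
  shows "(\<lambda>n. cond_expect M (\<lambda>\<omega>. real (Ycount \<xi> c x k n 0 \<omega>)) (\<lambda>\<omega>. Ycount \<xi> c x k n 0 \<omega> > 0)) \<longlonglongrightarrow> 1 / \<theta>"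
proof -
  have "(\<lambda>n. 1 / (h n / (m n * p n))) \<longlonglongrightarrow> 1 / \<theta>"
    using assms \<theta>(1) by (intro tendsto_divide tendsto_const) auto
  then show ?thesis
  proof (rule Lim_transform_eventually)
    show "\<forall>\<^sub>F n in sequentially. 1 / (h n / (m n * p n)) =
        cond_expect M (\<lambda>\<omega>. real (Ycount \<xi> c x k n 0 \<omega>)) (\<lambda>\<omega>. Ycount \<xi> c x k n 0 \<omega> > 0)"
      using eventually_good by eventually_elim (simp add: cond_expect_Ycount)
  qed
qed

end

section \<open>The number of boxes with exceedances\<close>

text \<open>\<open>h_lim\<close> is an assumption here because its proof rests on
  \<open>cond_D\<close>, whose witnesses may differ from the \<gamma> and \<alpha> fixed
  now.\<close>

locale cluster_asymptotics = box_asymptotics M \<xi> C c \<kappa> \<theta> \<tau> x k R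
  for M :: "'a measure" and \<xi> :: "int ^ 'd \<Rightarrow> 'a \<Rightarrow> real"
    and C :: "(real ^ 'd) set" and c :: "nat \<Rightarrow> real ^ 'd" and \<kappa> \<theta> \<tau> :: real
    and x :: "nat \<Rightarrow> real" and k :: "nat \<Rightarrow> nat" and R :: "(int ^ 'd) rel" +
  fixes \<gamma> :: "nat \<Rightarrow> real ^ 'd" and \<alpha> \<alpha>' :: "nat \<Rightarrow> real"
  assumes h_lim: "(\<lambda>n. h n / (m n * p n)) \<longlonglongrightarrow> \<theta>"
    and \<gamma>: "vec_smallo (\<lambda>n. root CARD('d) (real (k n)) *\<^sub>R \<gamma> n) c"
    and \<alpha>: "(\<lambda>n. real (k n) * \<alpha> n) \<longlonglongrightarrow> 0"
    and \<alpha>': "\<alpha>' \<in> o(p)"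
    and max_mix: "\<And>n A B E. A \<subseteq> Kset c \<kappa> n \<Longrightarrow> B \<subseteq> Kset c \<kappa> n \<Longrightarrow> separated (\<gamma> n) A B \<Longrightarrow>
      E \<in> exceedance_sigma M \<xi> (x n) B \<Longrightarrow>
      \<bar>prob ({\<omega> \<in> space M. field_max \<xi> A \<omega> \<le> ereal (x n)} \<inter> E)
        - prob {\<omega> \<in> space M. field_max \<xi> A \<omega> \<le> ereal (x n)} * prob E\<bar> \<le> \<alpha> n"
    and exc_mix: "\<And>n v B E. v \<in> Kset c \<kappa> n \<Longrightarrow> B \<subseteq> Kset c \<kappa> n \<Longrightarrow> separated (\<gamma> n) {v} B \<Longrightarrow>
      E \<in> exceedance_sigma M \<xi> (x n) B \<Longrightarrow>
      \<bar>prob (exc (x n) v \<inter> E) - prob (exc (x n) v) * prob E\<bar> \<le> \<alpha>' n"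
begin

text \<open>The cost of decoupling the hit of one box from the other boxes, as delivered by
  \<open>hit_mixing\<close>.\<close>

definition \<epsilon> :: "nat \<Rightarrow> real" where "\<epsilon> n = \<alpha> n + 2 * (margin \<gamma> n * p n)"

text \<open>The cost of decoupling the expected number of exceedances in one box: one error
  \<alpha>' for each of its \<open>m\<close> sites, plus the sites outside the core.\<close>

definition \<delta> :: "nat \<Rightarrow> real" where "\<delta> n = m n * \<bar>\<alpha>' n\<bar> + margin \<gamma> n * p n"

abbreviation hit_box :: "nat \<Rightarrow> int ^ 'd \<Rightarrow> 'a set" where
  "hit_box n z \<equiv> hit (x n) (Jbox c k n z)"

definition hit_boxes :: "nat \<Rightarrow> (int ^ 'd) set \<Rightarrow> 'a \<Rightarrow> (int ^ 'd) set" where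
  "hit_boxes n Q' \<omega> = {z \<in> Q'. \<omega> \<in> hit_box n z}"

definition P_count :: "nat \<Rightarrow> nat \<Rightarrow> real" where
  "P_count l n = prob {\<omega> \<in> space M. card (hit_boxes n (Q n) \<omega>) = l}"

lemma k_\<epsilon>_lim: "(\<lambda>n. real (k n) * \<epsilon> n) \<longlonglongrightarrow> 0"
proof -
  have "(\<lambda>n. real (k n) * \<alpha> n + 2 * (real (k n) * (margin \<gamma> n * p n))) \<longlonglongrightarrow> 0 + 2 * 0"
    by (intro tendsto_add tendsto_mult tendsto_const \<alpha> k_margin_lim[OF \<gamma>])
  then show ?thesis
    by (simp add: \<epsilon>_def algebra_simps)
qed

text \<open>The condition that \<alpha>' is o(p) acts here: \<open>k m\<close> times \<alpha>' is
  the quotient of \<alpha>' and \<open>p\<close> times the bounded \<open>k m p\<close>.\<close>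

lemma k_\<delta>_lim: "(\<lambda>n. real (k n) * \<delta> n) \<longlonglongrightarrow> 0"
proof -
  obtain a b where ab: "0 < a" "0 < b" "\<forall>\<^sub>F n in sequentially. a \<le> real (k n) * (m n * p n)"
      "\<forall>\<^sub>F n in sequentially. real (k n) * (m n * p n) \<le> b"
    by (rule kmp_bounds)
  have "(\<lambda>n. \<alpha>' n / p n) \<longlonglongrightarrow> 0"
    by (rule smalloD_tendsto[OF \<alpha>'])
  moreover have "\<forall>\<^sub>F n in sequentially. \<bar>real (k n) * (m n * p n)\<bar> \<le> b"
    using ab(3,4) by eventually_elim (use ab(1) in auto)
  ultimately have "(\<lambda>n. \<bar>\<alpha>' n / p n\<bar> * (real (k n) * (m n * p n))) \<longlonglongrightarrow> 0"
    by (intro tendsto_zero_mult_bounded tendsto_rabs_zero)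
  from tendsto_add[OF this k_margin_lim[OF \<gamma>]]
  have "(\<lambda>n. \<bar>\<alpha>' n / p n\<bar> * (real (k n) * (m n * p n)) + real (k n) * (margin \<gamma> n * p n)) \<longlonglongrightarrow> 0"
    by simp
  then show ?thesis
  proof (rule Lim_transform_eventually)
    show "\<forall>\<^sub>F n in sequentially. \<bar>\<alpha>' n / p n\<bar> * (real (k n) * (m n * p n)) + real (k n) * (margin \<gamma> n * p n)
        = real (k n) * \<delta> n"
      using theta_lim(1) by eventually_elim (simp add: \<delta>_def algebra_simps)
  qed
qed

text \<open>Positivity of \<theta> transfers the lower bound from \<open>m p\<close> to
  \<open>h\<close>.\<close>

lemma kh_bounds:
  obtains a b where "0 < a" "0 < b" "\<forall>\<^sub>F n in sequentially. a \<le> real (k n) * h n"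
    "\<forall>\<^sub>F n in sequentially. real (k n) * h n \<le> b"
proof -
  obtain a b where ab: "0 < a" "0 < b" "\<forall>\<^sub>F n in sequentially. a \<le> real (k n) * (m n * p n)"
      "\<forall>\<^sub>F n in sequentially. real (k n) * (m n * p n) \<le> b"
    by (rule kmp_bounds)
  have half: "\<forall>\<^sub>F n in sequentially. \<theta> / 2 < h n / (m n * p n)"
    using order_tendstoD(1)[OF h_lim, of "\<theta> / 2"] \<theta>(1) by simp
  show ?thesis
  proof (rule that)
    show "0 < \<theta> / 2 * a" "0 < b"
      using ab \<theta>(1) by auto
    show "\<forall>\<^sub>F n in sequentially. \<theta> / 2 * a \<le> real (k n) * h n"
      using half ab(3) eventually_good theta_lim(1)
    proof eventually_elim
      case (elim n)
      have mp: "0 < m n * p n"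
        using elim m_pos by auto
      have "\<theta> / 2 * a \<le> \<theta> / 2 * (real (k n) * (m n * p n))"
        using elim(2) \<theta>(1) by simp
      also have "\<dots> = real (k n) * (\<theta> / 2 * (m n * p n))"
        by simp
      also have "\<dots> \<le> real (k n) * h n"
        using elim(1) mp by (intro mult_left_mono) (auto simp: pos_less_divide_eq)
      finally show ?case .
    qed
    show "\<forall>\<^sub>F n in sequentially. real (k n) * h n \<le> b"
      using ab(4) eventually_good
    proof eventually_elim
      case (elim n)
      have "real (k n) * h n \<le> real (k n) * (m n * p n)"
        using h_le_mp[OF elim(2)] by (intro mult_left_mono) auto
      then show ?case
        using elim(1) by simp
    qed
  qed
qed

lemma h_tendsto_0: "h \<longlonglongrightarrow> 0"
  and k_h2_lim: "(\<lambda>n. real (k n) * (h n)\<^sup>2) \<longlonglongrightarrow> 0"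
proof -
  obtain a b where ab: "0 < a" "0 < b" "\<forall>\<^sub>F n in sequentially. a \<le> real (k n) * h n"
      "\<forall>\<^sub>F n in sequentially. real (k n) * h n \<le> b"
    by (rule kh_bounds)
  have bd: "\<forall>\<^sub>F n in sequentially. \<bar>real (k n) * h n\<bar> \<le> b"
    using ab(4) by eventually_elim (simp add: h_nonneg)
  from tendsto_zero_mult_bounded[OF inverse_k_lim this] show h0: "h \<longlonglongrightarrow> 0"
    using k_pos by (simp add: less_imp_neq[symmetric])
  from tendsto_zero_mult_bounded[OF h0 bd] show "(\<lambda>n. real (k n) * (h n)\<^sup>2) \<longlonglongrightarrow> 0"
    by (simp add: power2_eq_square mult_ac)
qed

text \<open>Turns the limit of a quotient into an additive error of o(1/k), which can be summed over
  boxes.\<close>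

lemma k_mp_h_lim: "(\<lambda>n. real (k n) * \<bar>m n * p n - h n / \<theta>\<bar>) \<longlonglongrightarrow> 0"
proof -
  obtain a b where ab: "0 < a" "0 < b" "\<forall>\<^sub>F n in sequentially. a \<le> real (k n) * (m n * p n)"
      "\<forall>\<^sub>F n in sequentially. real (k n) * (m n * p n) \<le> b"
    by (rule kmp_bounds)
  have bd: "\<forall>\<^sub>F n in sequentially. \<bar>real (k n) * (m n * p n)\<bar> \<le> b"
    using ab(3,4) by eventually_elim (use ab(1) in auto)
  have "(\<lambda>n. 1 - h n / (m n * p n) / \<theta>) \<longlonglongrightarrow> 1 - \<theta> / \<theta>"
    using \<theta>(1) by (intro tendsto_diff tendsto_divide tendsto_const h_lim) auto
  then have "(\<lambda>n. 1 - h n / (m n * p n) / \<theta>) \<longlonglongrightarrow> 0"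
    using \<theta>(1) by simp
  from tendsto_rabs_zero[OF tendsto_zero_mult_bounded[OF this bd]] show ?thesis
  proof (rule Lim_transform_eventually)
    show "\<forall>\<^sub>F n in sequentially. \<bar>(1 - h n / (m n * p n) / \<theta>) * (real (k n) * (m n * p n))\<bar>
        = real (k n) * \<bar>m n * p n - h n / \<theta>\<bar>"
      using eventually_good theta_lim(1)
    proof eventually_elim
      case (elim n)
      have "m n \<noteq> 0" "p n \<noteq> 0"
        using elim m_pos[OF elim(1)] by auto
      then have "(1 - h n / (m n * p n) / \<theta>) * (real (k n) * (m n * p n)) = real (k n) * (m n * p n - h n / \<theta>)"
        using \<theta>(1) by (simp add: field_simps)
      then show ?case
        by (simp only: abs_mult abs_of_nat)
    qed
  qed
qed

text \<open>The number of boxes is O(k), so a per-box error of o(1/k) survives summation.\<close>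

lemma card_Q_mult_lim:
  assumes "(\<lambda>n. real (k n) * f n) \<longlonglongrightarrow> 0"
  shows "(\<lambda>n. real (card (Q n)) * f n) \<longlonglongrightarrow> 0"
proof -
  obtain a b where ab: "0 < a" "0 < b" "\<forall>\<^sub>F n in sequentially. a * real (k n) \<le> real (card (Q n))"
    "\<forall>\<^sub>F n in sequentially. real (card (Q n)) \<le> b * real (k n)"
    by (rule card_Q_bounds)
  have "\<forall>\<^sub>F n in sequentially. \<bar>real (card (Q n)) / real (k n)\<bar> \<le> b"
    using ab(4)
  proof eventually_elim
    case (elim n)
    then show ?case
      using k_pos[of n] by (simp add: pos_divide_le_eq)
  qed
  from tendsto_zero_mult_bounded[OF assms this]
  have "(\<lambda>n. real (k n) * f n * (real (card (Q n)) / real (k n))) \<longlonglongrightarrow> 0" .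
  moreover have "real (k n) * f n * (real (card (Q n)) / real (k n)) = real (card (Q n)) * f n" for n
    using k_pos[of n] by simp
  ultimately show ?thesis
    by simp
qed

lemma card_Q_h_bounds:
  obtains a b where "0 < a" "0 < b" "\<forall>\<^sub>F n in sequentially. a \<le> real (card (Q n)) * h n"
    "\<forall>\<^sub>F n in sequentially. real (card (Q n)) * h n \<le> b"
    "\<forall>\<^sub>F n in sequentially. real (card (Q n)) * (m n * p n) \<le> b"
proof -
  obtain a b where ab: "0 < a" "0 < b" "\<forall>\<^sub>F n in sequentially. a * real (k n) \<le> real (card (Q n))"
    "\<forall>\<^sub>F n in sequentially. real (card (Q n)) \<le> b * real (k n)"
    by (rule card_Q_bounds)
  obtain a' b' where ab': "0 < a'" "0 < b'" "\<forall>\<^sub>F n in sequentially. a' \<le> real (k n) * h n"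
      "\<forall>\<^sub>F n in sequentially. real (k n) * h n \<le> b'"
    by (rule kh_bounds)
  obtain a'' b'' where ab'': "0 < a''" "0 < b''" "\<forall>\<^sub>F n in sequentially. a'' \<le> real (k n) * (m n * p n)"
      "\<forall>\<^sub>F n in sequentially. real (k n) * (m n * p n) \<le> b''"
    by (rule kmp_bounds)
  have mp: "\<forall>\<^sub>F n in sequentially. real (card (Q n)) * (m n * p n) \<le> b * b''"
    using ab(4) ab''(4) eventually_good
  proof eventually_elim
    case (elim n)
    have "real (card (Q n)) * (m n * p n) \<le> b * real (k n) * (m n * p n)"
      using elim(1) m_pos[OF elim(3)] p_nonneg[of n] by (intro mult_right_mono) auto
    also have "\<dots> \<le> b * b''"
      using elim(2) ab(2) by (simp add: mult.assoc)
    finally show ?case .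
  qed
  show ?thesis
  proof (rule that)
    show "0 < a * a'" "0 < b * b''"
      using ab ab' ab'' by auto
    show "\<forall>\<^sub>F n in sequentially. a * a' \<le> real (card (Q n)) * h n"
      using ab(3) ab'(3)
    proof eventually_elim
      case (elim n)
      have "a * a' \<le> a * (real (k n) * h n)"
        using elim(2) ab(1) by simp
      also have "\<dots> \<le> real (card (Q n)) * h n"
        using elim(1) h_nonneg[of n] by (simp add: mult_right_mono flip: mult.assoc)
      finally show ?case .
    qed
    show "\<forall>\<^sub>F n in sequentially. real (card (Q n)) * (m n * p n) \<le> b * b''"
      by (rule mp)
    show "\<forall>\<^sub>F n in sequentially. real (card (Q n)) * h n \<le> b * b''"
      using mp eventually_good
    proof eventually_elim
      case (elim n)
      have "real (card (Q n)) * h n \<le> real (card (Q n)) * (m n * p n)"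
        using h_le_mp[OF elim(2)] by (intro mult_left_mono) auto
      then show ?case
        using elim(1) by simp
    qed
  qed
qed

section \<open>One box against all the others\<close>

lemma hit_boxes_pattern:
  assumes "good n" "finite Q'"
  shows "{\<omega> \<in> space M. S (hit_boxes n Q' \<omega>)} \<in> exceedance_sigma M \<xi> (x n) (\<Union>(Jbox c k n ` Q'))"
proof -
  let ?D = "\<Union>(Jbox c k n ` Q')"
  have "finite ?D"
    using assms fin_Jbox by blast
  then have "{\<omega> \<in> space M. S {z \<in> Q'. Jbox c k n z \<inter> {v \<in> ?D. \<xi> v \<omega> > x n} \<noteq> {}}}
      \<in> exceedance_sigma M \<xi> (x n) ?D"
    by (rule exceedance_pattern_sigma[OF _ order_refl])
  moreover have "hit_boxes n Q' \<omega> = {z \<in> Q'. Jbox c k n z \<inter> {v \<in> ?D. \<xi> v \<omega> > x n} \<noteq> {}}" if "\<omega> \<in> space M" for \<omega>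
    using that by (auto simp: hit_boxes_def hit_def)
  then have "{\<omega> \<in> space M. S (hit_boxes n Q' \<omega>)}
      = {\<omega> \<in> space M. S {z \<in> Q'. Jbox c k n z \<inter> {v \<in> ?D. \<xi> v \<omega> > x n} \<noteq> {}}}"
    by auto
  ultimately show ?thesis
    by simp
qed

lemma hit_boxes_events:
  assumes "good n" "finite Q'"
  shows "{\<omega> \<in> space M. S (hit_boxes n Q' \<omega>)} \<in> events"
  using hit_boxes_pattern[OF assms, of S] exceedance_sigma_subset_events by blast

lemma other_boxes:
  assumes "good n" "z \<in> Q n"
  shows "\<Union>(Jbox c k n ` (Q n - {z})) \<subseteq> Kset c \<kappa> n" "\<Union>(Jbox c k n ` (Q n - {z})) \<inter> Jbox c k n z = {}"
  using Jbox_subset_Kset[OF assms(1)] Jbox_disjoint[of c k n] assms c_pos k_pos by blast+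

text \<open>The other boxes may touch box z, but its core is separated from all of them, and which
  of them are hit is determined by exceedances there. \<open>S\<close> is arbitrary because both
  counts and the hit of a single other box are needed.\<close>

lemma hit_box_mixing:
  assumes good: "good n" and z: "z \<in> Q n"
  shows "\<bar>prob (hit_box n z \<inter> {\<omega> \<in> space M. S (hit_boxes n (Q n - {z}) \<omega>)})
      - h n * prob {\<omega> \<in> space M. S (hit_boxes n (Q n - {z}) \<omega>)}\<bar> \<le> \<epsilon> n"
proof -
  let ?E = "{\<omega> \<in> space M. S (hit_boxes n (Q n - {z}) \<omega>)}"
  have fin: "finite (Q n - {z})"
    using finite_Q[OF good] by simp
  have sub: "core c k \<gamma> n z \<subseteq> Kset c \<kappa> n"
    using core_in_Jbox[OF good] Jbox_subset_Kset[OF good z] by blast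
  have sep: "separated (\<gamma> n) (core c k \<gamma> n z) (\<Union>(Jbox c k n ` (Q n - {z})))"
    by (rule separated_core[OF good[rule_format] c_pos k_pos order_refl other_boxes(2)[OF good z]])
  show ?thesis
    unfolding \<epsilon>_def
    by (rule hit_Jbox_mixing[OF good hit_boxes_events[OF good fin]
        max_mix[OF sub other_boxes(1)[OF good z] sep hit_boxes_pattern[OF good fin]]])
qed

lemma exceedances_mixing:
  assumes good: "good n" and z: "z \<in> Q n"
  shows "\<bar>(\<Sum>v\<in>Jbox c k n z. prob (exc (x n) v \<inter> {\<omega> \<in> space M. S (hit_boxes n (Q n - {z}) \<omega>)}))
      - m n * p n * prob {\<omega> \<in> space M. S (hit_boxes n (Q n - {z}) \<omega>)}\<bar> \<le> \<delta> n"
proof -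
  let ?E = "{\<omega> \<in> space M. S (hit_boxes n (Q n - {z}) \<omega>)}"
  have fin: "finite (Q n - {z})"
    using finite_Q[OF good] by simp
  have sub: "core c k \<gamma> n z \<subseteq> Kset c \<kappa> n"
    using core_in_Jbox[OF good] Jbox_subset_Kset[OF good z] by blast
  have mix: "\<bar>prob (exc (x n) v \<inter> ?E) - prob (exc (x n) v) * prob ?E\<bar> \<le> \<bar>\<alpha>' n\<bar>" if v: "v \<in> core c k \<gamma> n z" for v
  proof -
    have "separated (\<gamma> n) {v} (\<Union>(Jbox c k n ` (Q n - {z})))"
      by (rule separated_core[OF good[rule_format] c_pos k_pos _ other_boxes(2)[OF good z]]) (use v in auto)
    from exc_mix[OF subsetD[OF sub v] other_boxes(1)[OF good z] this hit_boxes_pattern[OF good fin]]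
    show ?thesis
      by (meson abs_ge_self order_trans)
  qed
  show ?thesis
    using exceedance_count_mixing[OF fin_Jbox[OF good] core_in_Jbox[OF good] hit_boxes_events[OF good fin] abs_ge_zero mix]
    unfolding \<delta>_def card_Jbox_m[OF good] card_Jbox_diff_core[OF good] p_def by simp
qed

lemma card_hit_boxes_remove:
  assumes "good n" "z \<in> Q n"
  shows "card (hit_boxes n (Q n) \<omega>) = card (hit_boxes n (Q n - {z}) \<omega>) + of_bool (\<omega> \<in> hit_box n z)"
proof (cases "\<omega> \<in> hit_box n z")
  case True
  then have "hit_boxes n (Q n) \<omega> = insert z (hit_boxes n (Q n - {z}) \<omega>)"
    using assms(2) by (auto simp: hit_boxes_def)
  moreover have "z \<notin> hit_boxes n (Q n - {z}) \<omega>" "finite (hit_boxes n (Q n - {z}) \<omega>)"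
    using finite_Q[OF assms(1)] by (auto simp: hit_boxes_def)
  ultimately show ?thesis
    using True by simp
next
  case False
  then have "hit_boxes n (Q n) \<omega> = hit_boxes n (Q n - {z}) \<omega>"
    by (auto simp: hit_boxes_def)
  then show ?thesis
    using False by simp
qed

text \<open>Each box contributes the error \<epsilon> plus \<open>h\<^sup>2\<close>; the second is
  o(1/k) because \<open>h\<close> is O(1/k).\<close>

lemma P_count_recursion:
  "(\<lambda>n. real (j + 1) * P_count (j + 1) n - real (card (Q n)) * h n * P_count j n) \<longlonglongrightarrow> 0"
proof (rule tendsto_0_le[where K = 1])
  have "(\<lambda>n. real (k n) * \<epsilon> n + real (k n) * (h n)\<^sup>2) \<longlonglongrightarrow> 0"
    using tendsto_add[OF k_\<epsilon>_lim k_h2_lim] by simp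
  then show "(\<lambda>n. real (card (Q n)) * (\<epsilon> n + (h n)\<^sup>2)) \<longlonglongrightarrow> 0"
    by (intro card_Q_mult_lim) (simp add: distrib_left)
  show "\<forall>\<^sub>F n in sequentially. norm (real (j + 1) * P_count (j + 1) n - real (card (Q n)) * h n * P_count j n)
      \<le> norm (real (card (Q n)) * (\<epsilon> n + (h n)\<^sup>2)) * 1"
    using eventually_good
  proof eventually_elim
    case (elim n)
    have "\<bar>real (j + 1) * P_count (j + 1) n - real (card (Q n)) * h n * P_count j n\<bar> \<le> real (card (Q n)) * (\<epsilon> n + (h n)\<^sup>2)"
      unfolding P_count_def hit_boxes_def
      by (rule prob_count_eq_Suc[OF finite_Q[OF elim] prob_hit_Jbox[OF elim] refl])
        (rule hit_box_mixing[OF elim, of _ "\<lambda>G. card G = j", unfolded hit_boxes_def])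
    then show ?case
      by simp
  qed
qed

lemma P_count_bounded_below: "\<exists>\<delta>>0. \<forall>\<^sub>F n in sequentially. \<delta> \<le> P_count j n"
proof -
  obtain a b where ab: "0 < a" "0 < b" "\<forall>\<^sub>F n in sequentially. a \<le> real (card (Q n)) * h n"
    "\<forall>\<^sub>F n in sequentially. real (card (Q n)) * h n \<le> b"
    by (rule card_Q_h_bounds)
  \<comment> \<open>The mean number of hit boxes is at most b, so by Markov's inequality more than L
    boxes are hit with probability at most 1/2.\<close>
  obtain L :: nat where L: "2 * b < L"
    using reals_Archimedean2 by blast
  show ?thesis
  proof (rule recursion_bounded_below[OF _ P_count_recursion ab(1,3,4)])
    show "0 \<le> P_count j n" for j n
      by (simp add: P_count_def)
    show "\<forall>\<^sub>F n in sequentially. 1 / 2 \<le> (\<Sum>j\<le>L. P_count j n)"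
      using eventually_good ab(4)
    proof eventually_elim
      case (elim n)
      let ?N = "\<lambda>\<omega>. card (hit_boxes n (Q n) \<omega>)"
      note ev = hit_boxes_events[OF elim(1) finite_Q[OF elim(1)]]
      have "real (L + 1) * prob {\<omega> \<in> space M. L + 1 \<le> ?N \<omega>} \<le> (\<Sum>z\<in>Q n. prob (hit_box n z))"
        by (rule prob_many_events_le[OF finite_Q[OF elim(1)]]) (auto simp: hit_boxes_def[symmetric] intro: ev)
      also have "\<dots> = real (card (Q n)) * h n"
        using prob_hit_Jbox[OF elim(1)] by simp
      also have "\<dots> \<le> L / 2"
        using elim(2) L by simp
      also have "\<dots> \<le> real (L + 1) * (1 / 2)"
        by simp
      finally have "prob {\<omega> \<in> space M. L + 1 \<le> ?N \<omega>} \<le> 1 / 2"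
        by (subst (asm) mult_le_cancel_left_pos) auto
      moreover have "prob {\<omega> \<in> space M. L + 1 \<le> ?N \<omega>} = 1 - prob {\<omega> \<in> space M. ?N \<omega> \<le> L}"
      proof -
        have "{\<omega> \<in> space M. L + 1 \<le> ?N \<omega>} = space M - {\<omega> \<in> space M. ?N \<omega> \<le> L}"
          by auto
        then show ?thesis
          using prob_compl[OF ev[of "\<lambda>G. card G \<le> L"]] by simp
      qed
      moreover have "prob {\<omega> \<in> space M. ?N \<omega> \<le> L} = (\<Sum>j\<le>L. P_count j n)"
      proof -
        have "{\<omega> \<in> space M. ?N \<omega> \<le> L} = (\<Union>j\<in>{..L}. {\<omega> \<in> space M. ?N \<omega> = j})"
          by auto
        then show ?thesis
          unfolding P_count_def using ev
          by (simp only:) (rule finite_measure_finite_Union; auto simp: disjoint_family_on_def)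
      qed
      ultimately show ?case
        by linarith
    qed
  qed
qed

text \<open>Three errors in comparing exceedances with hits divided by \<theta>: decoupling the
  exceedances, decoupling the hit, and replacing \<open>m p\<close> by
  \<open>h / \<theta>\<close>.\<close>

definition rate :: "nat \<Rightarrow> real" where
  "rate n = \<delta> n + \<epsilon> n / \<theta> + \<bar>m n * p n - h n / \<theta>\<bar>"

lemma k_rate_lim: "(\<lambda>n. real (k n) * rate n) \<longlonglongrightarrow> 0"
proof -
  have "(\<lambda>n. real (k n) * \<delta> n + real (k n) * \<epsilon> n / \<theta> + real (k n) * \<bar>m n * p n - h n / \<theta>\<bar>) \<longlonglongrightarrow> 0 + 0 / \<theta> + 0"
    using \<theta>(1) by (intro tendsto_add tendsto_divide tendsto_const k_\<delta>_lim k_\<epsilon>_lim k_mp_h_lim) auto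
  then show ?thesis
    by (simp add: rate_def distrib_left)
qed

text \<open>Where box z is hit, \<open>N\<close> says that exactly l other boxes are hit.
  Exceedances in z and the hit of z are both decoupled from this event \<open>?E\<close>, whose
  probability then cancels. For the lower bound, it falls short of \<open>P_count l n\<close> by at
  most \<open>h\<close>.\<close>

lemma box_numerator:
  fixes l :: nat
  assumes good: "good n" and z: "z \<in> Q n"
  defines "N \<equiv> {\<omega> \<in> space M. card (hit_boxes n (Q n) \<omega>) = l + 1}"
  shows "\<bar>(\<Sum>v\<in>Jbox c k n z. prob (exc (x n) v \<inter> N)) - prob (hit_box n z \<inter> N) / \<theta>\<bar> \<le> rate n"
    and "h n * (P_count l n - h n) - \<epsilon> n \<le> prob (hit_box n z \<inter> N)"
proof -
  let ?E = "{\<omega> \<in> space M. card (hit_boxes n (Q n - {z}) \<omega>) = l}"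
  have fin: "finite (Q n - {z})"
    using finite_Q[OF good] by simp
  have E: "?E \<in> events"
    using hit_boxes_events[OF good fin, of "\<lambda>G. card G = l"] .
  have hit: "hit_box n z \<inter> N = hit_box n z \<inter> ?E"
    unfolding N_def using card_hit_boxes_remove[OF good z] by auto
  have exc: "exc (x n) v \<inter> N = exc (x n) v \<inter> ?E" if "v \<in> Jbox c k n z" for v
  proof -
    have "exc (x n) v \<subseteq> hit_box n z"
      using that by (auto simp: hit_eq_UN)
    then show ?thesis
      using hit by blast
  qed
  have num: "\<bar>(\<Sum>v\<in>Jbox c k n z. prob (exc (x n) v \<inter> N)) - m n * p n * prob ?E\<bar> \<le> \<delta> n"
    using exceedances_mixing[OF good z, of "\<lambda>G. card G = l"] by (simp add: exc)
  have den: "\<bar>prob (hit_box n z \<inter> N) - h n * prob ?E\<bar> \<le> \<epsilon> n"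
    using hit_box_mixing[OF good z, of "\<lambda>G. card G = l"] by (simp only: hit)
  have den': "\<bar>prob (hit_box n z \<inter> N) / \<theta> - h n / \<theta> * prob ?E\<bar> \<le> \<epsilon> n / \<theta>"
  proof -
    have "prob (hit_box n z \<inter> N) / \<theta> - h n / \<theta> * prob ?E = (prob (hit_box n z \<inter> N) - h n * prob ?E) / \<theta>"
      by (simp add: diff_divide_distrib)
    then show ?thesis
      using den \<theta>(1) by (simp add: abs_divide divide_right_mono)
  qed
  have "\<bar>(m n * p n - h n / \<theta>) * prob ?E\<bar> \<le> \<bar>m n * p n - h n / \<theta>\<bar>"
    by (simp add: abs_mult mult_left_le)
  then have mid: "\<bar>m n * p n * prob ?E - h n / \<theta> * prob ?E\<bar> \<le> \<bar>m n * p n - h n / \<theta>\<bar>"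
    by (simp only: left_diff_distrib)
  show "\<bar>(\<Sum>v\<in>Jbox c k n z. prob (exc (x n) v \<inter> N)) - prob (hit_box n z \<inter> N) / \<theta>\<bar> \<le> rate n"
  proof -
    have "\<bar>s - d\<bar> \<le> u + v + w" if "\<bar>a - b\<bar> \<le> w" "\<bar>s - a\<bar> \<le> u" "\<bar>d - b\<bar> \<le> v" for a b s d u v w :: real
      using that by linarith
    then show ?thesis
      unfolding rate_def using mid num den' by blast
  qed
  have "P_count l n \<le> prob (?E \<union> hit_box n z)"
    unfolding P_count_def using E card_hit_boxes_remove[OF good z] by (intro finite_measure_mono) auto
  also have "\<dots> \<le> prob ?E + h n"
    using measure_Un_le[OF E, of "hit_box n z"] prob_hit_Jbox[OF good] by simp
  finally have "h n * (P_count l n - h n) \<le> h n * prob ?E"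
    using h_nonneg by (intro mult_left_mono) auto
  then show "h n * (P_count l n - h n) - \<epsilon> n \<le> prob (hit_box n z \<inter> N)"
    using den by linarith
qed

lemma Ncount_eq:
  assumes "good n" "\<omega> \<in> space M"
  shows "Ncount \<xi> c x k n C \<omega> = card (hit_boxes n (Q n) \<omega>)"
proof -
  have "field_max \<xi> A \<omega> > ereal y \<longleftrightarrow> \<omega> \<in> hit y A" for A y
    using field_max_le_eq[of A y] assms(2) by (auto simp: not_le[symmetric])
  then have "Ncount \<xi> c x k n C \<omega> = (\<Sum>z\<in>Q n. of_bool (\<omega> \<in> hit_box n z))"
    by (simp add: Ncount_def Qminus_def)
  then show ?thesis
    using finite_Q[OF assms(1)] by (simp add: hit_boxes_def sum.If_cases of_bool_def Int_def)
qed

lemma cond_expect_Ycount_count: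
  assumes good: "good n" and z: "z \<in> Q n"
  shows "cond_expect M (\<lambda>\<omega>. real (Ycount \<xi> c x k n z \<omega>))
      (\<lambda>\<omega>. Ycount \<xi> c x k n z \<omega> > 0 \<and> Ncount \<xi> c x k n C \<omega> = l)
    = (\<Sum>v\<in>Jbox c k n z. prob (exc (x n) v \<inter> {\<omega> \<in> space M. card (hit_boxes n (Q n) \<omega>) = l}))
      / prob (hit_box n z \<inter> {\<omega> \<in> space M. card (hit_boxes n (Q n) \<omega>) = l})"
proof -
  let ?J = "Jbox c k n z" and ?N = "{\<omega> \<in> space M. card (hit_boxes n (Q n) \<omega>) = l}"
  have fin: "finite ?J"
    by (rule fin_Jbox[OF good])
  have N: "?N \<in> events"
    by (rule hit_boxes_events[OF good finite_Q[OF good]])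
  have ev: "{\<omega> \<in> space M. Ycount \<xi> c x k n z \<omega> > 0 \<and> Ncount \<xi> c x k n C \<omega> = l} = hit_box n z \<inter> ?N"
    using fin Ncount_eq[OF good] by (auto simp: Ycount_def card_gt_0_iff hit_def)
  have "(LINT \<omega>:hit_box n z \<inter> ?N|M. real (Ycount \<xi> c x k n z \<omega>))
      = (LINT \<omega>:hit_box n z \<inter> ?N|M. real (card {v \<in> ?J. \<omega> \<in> exc (x n) v}))"
    using N by (intro set_lebesgue_integral_cong) (auto simp: Ycount_def exc_def)
  also have "\<dots> = (\<Sum>v\<in>?J. prob (exc (x n) v \<inter> (hit_box n z \<inter> ?N)))"
    using N by (intro set_integral_card_events[OF fin]) auto
  also have "\<dots> = (\<Sum>v\<in>?J. prob (exc (x n) v \<inter> ?N))"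
  proof (rule sum.cong[OF refl])
    fix v
    assume "v \<in> ?J"
    then have "exc (x n) v \<inter> (hit_box n z \<inter> ?N) = exc (x n) v \<inter> ?N"
      by (auto simp: hit_eq_UN)
    then show "prob (exc (x n) v \<inter> (hit_box n z \<inter> ?N)) = prob (exc (x n) v \<inter> ?N)"
      by simp
  qed
  finally show ?thesis
    unfolding cond_expect_def ev by simp
qed

text \<open>The conditioning event of a single box has probability of order \<open>1/k\<close>,
  while the error \<open>rate\<close> is o(1/k). Neither bound depends on z, which gives the
  maximum.\<close>

lemma max_cond_expect_lim:
  assumes "1 \<le> l"
  shows "(\<lambda>n. Max ((\<lambda>z. \<bar>cond_expect M (\<lambda>\<omega>. real (Ycount \<xi> c x k n z \<omega>))
      (\<lambda>\<omega>. Ycount \<xi> c x k n z \<omega> > 0 \<and> Ncount \<xi> c x k n C \<omega> = l) - 1 / \<theta>\<bar>) ` Q n)) \<longlonglongrightarrow> 0"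
proof -
  obtain j where j: "l = j + 1"
    using assms by (metis Suc_eq_plus1 not0_implies_Suc not_one_le_zero)
  obtain \<eta> where \<eta>: "0 < \<eta>" "\<forall>\<^sub>F n in sequentially. \<eta> \<le> P_count j n"
    using P_count_bounded_below by blast
  obtain a b where ab: "0 < a" "0 < b" "\<forall>\<^sub>F n in sequentially. a \<le> real (k n) * h n"
      "\<forall>\<^sub>F n in sequentially. real (k n) * h n \<le> b"
    by (rule kh_bounds)
  obtain a' b' where ab': "0 < a'" "0 < b'" "\<forall>\<^sub>F n in sequentially. a' * real (k n) \<le> real (card (Q n))"
    "\<forall>\<^sub>F n in sequentially. real (card (Q n)) \<le> b' * real (k n)"
    by (rule card_Q_bounds)
  \<comment> \<open>The main part of \<open>k\<close> times the denominator is at least a \<eta> / 2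
    = 2 \<rho>, and the error \<open>k \<epsilon>\<close> takes away less than \<rho>.\<close>
  define \<rho> where "\<rho> = a * \<eta> / 4"
  have \<rho>: "0 < \<rho>"
    using ab(1) \<eta>(1) by (simp add: \<rho>_def)
  have small_h: "\<forall>\<^sub>F n in sequentially. h n < \<eta> / 2"
    using order_tendstoD(2)[OF h_tendsto_0, of "\<eta> / 2"] \<eta>(1) by simp
  have small_\<epsilon>: "\<forall>\<^sub>F n in sequentially. real (k n) * \<epsilon> n < \<rho>"
    using order_tendstoD(2)[OF k_\<epsilon>_lim \<rho>] .
  let ?f = "\<lambda>n z. \<bar>cond_expect M (\<lambda>\<omega>. real (Ycount \<xi> c x k n z \<omega>))
      (\<lambda>\<omega>. Ycount \<xi> c x k n z \<omega> > 0 \<and> Ncount \<xi> c x k n C \<omega> = l) - 1 / \<theta>\<bar>"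
  show ?thesis
  proof (rule tendsto_0_le[OF k_rate_lim])
    show "\<forall>\<^sub>F n in sequentially. norm (Max (?f n ` Q n)) \<le> norm (real (k n) * rate n) * (1 / \<rho>)"
      using eventually_good \<eta>(2) ab(3) small_h small_\<epsilon> ab'(3)
    proof eventually_elim
      case (elim n)
      \<comment> \<open>\<open>Max\<close> is attained only on a nonempty set.\<close>
      have Qne: "Q n \<noteq> {}"
      proof
        assume "Q n = {}"
        then show False
          using elim(6) mult_pos_pos[OF ab'(1), of "real (k n)"] k_pos[of n] by simp
      qed
      have bound: "?f n z \<le> real (k n) * rate n * (1 / \<rho>)" if z: "z \<in> Q n" for z
      proof -
        let ?N = "{\<omega> \<in> space M. card (hit_boxes n (Q n) \<omega>) = j + 1}"
        let ?num = "\<Sum>v\<in>Jbox c k n z. prob (exc (x n) v \<inter> ?N)" and ?den = "prob (hit_box n z \<inter> ?N)"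
        have "\<rho> * 2 \<le> real (k n) * h n * (\<eta> / 2)"
          unfolding \<rho>_def using elim(3) \<eta>(1) by simp
        also have "\<dots> \<le> real (k n) * h n * (P_count j n - h n)"
          using elim(2,4) h_nonneg[of n] by (intro mult_left_mono) auto
        finally have "\<rho> \<le> real (k n) * (h n * (P_count j n - h n) - \<epsilon> n)"
          using elim(5) by (simp add: right_diff_distrib mult.assoc)
        also have "\<dots> \<le> real (k n) * ?den"
          using box_numerator(2)[OF elim(1) z, of j] by (intro mult_left_mono) auto
        finally have den: "\<rho> \<le> real (k n) * ?den" .
        then have kden: "0 < real (k n) * ?den"
          using \<rho> by linarith
        then have den_pos: "0 < ?den"
          by (simp add: zero_less_mult_iff)
        have "?f n z = \<bar>?num / ?den - 1 / \<theta>\<bar>"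
          using cond_expect_Ycount_count[OF elim(1) z, of l] by (simp add: j)
        also have "\<dots> = \<bar>?num - ?den / \<theta>\<bar> / ?den"
        proof -
          have "?num / ?den - 1 / \<theta> = (?num - ?den / \<theta>) / ?den"
            using den_pos by (simp add: diff_divide_distrib)
          then show ?thesis
            using den_pos by (simp add: abs_divide)
        qed
        also have "\<dots> \<le> rate n / ?den"
          using box_numerator(1)[OF elim(1) z, of j] den_pos by (intro divide_right_mono) auto
        also have "\<dots> = real (k n) * rate n / (real (k n) * ?den)"
          using k_pos[of n] by simp
        also have "\<dots> \<le> real (k n) * rate n / \<rho>"
        proof -
          have "0 \<le> rate n"
            using box_numerator(1)[OF elim(1) z, of j] by linarith
          then show ?thesis
            using den \<rho> mult_pos_pos[OF kden \<rho>] by (intro divide_left_mono mult_nonneg_nonneg) auto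
        qed
        finally show ?thesis
          by simp
      qed
      have fin: "finite (?f n ` Q n)"
        using finite_Q[OF elim(1)] by simp
      have "Max (?f n ` Q n) \<in> ?f n ` Q n"
        using Max_in[OF fin] Qne by blast
      then obtain z where z: "z \<in> Q n" "Max (?f n ` Q n) = ?f n z"
        by blast
      have "norm (Max (?f n ` Q n)) = ?f n z"
        unfolding z(2) by simp
      also have "\<dots> \<le> real (k n) * rate n * (1 / \<rho>)"
        by (rule bound[OF z(1)])
      also have "\<dots> \<le> norm (real (k n) * rate n) * (1 / \<rho>)"
        using \<rho> by (intro mult_right_mono) auto
      finally show ?case .
    qed
  qed
qed

end

section \<open>Neighbouring and boundary boxes\<close>

context cluster_asymptotics
begin

text \<open>A grid point in C does not force the rescaled sites of its box into C. As long as none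
  of these boxes is hit, every cluster point lies in C.\<close>

definition Q_bd :: "nat \<Rightarrow> (int ^ 'd) set" where
  "Q_bd n = {z \<in> Q n. \<exists>v\<in>Jbox c k n z. vec_divide (real_vec v) (c n) \<notin> C}"

text \<open>A predicate on sets of hit boxes, so that badness of the remaining boxes is an
  admissible event in the mixing lemmas.\<close>

definition bad_hits :: "nat \<Rightarrow> (int ^ 'd) set \<Rightarrow> bool" where
  "bad_hits n G \<longleftrightarrow> (\<exists>z\<in>G. \<exists>z'\<in>G. z \<noteq> z' \<and> near z z') \<or> G \<inter> Q_bd n \<noteq> {}"

definition bad :: "nat \<Rightarrow> 'a set" where
  "bad n = {\<omega> \<in> space M. bad_hits n (hit_boxes n (Q n) \<omega>)}"

lemma bad_events: "good n \<Longrightarrow> bad n \<in> events"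
  unfolding bad_def by (intro hit_boxes_events finite_Q)

text \<open>The closed cell of such a box contains points of C and of its complement; being
  connected, it meets the frontier, which is compact and null. Cells have volume of order
  \<open>1/k\<close>.\<close>

lemma card_Q_bd_lim: "(\<lambda>n. real (card (Q_bd n)) / real (k n)) \<longlonglongrightarrow> 0"
proof -
  have "(\<lambda>n. real (card (Q_bd n)) * (\<Prod>i\<in>UNIV. cell_vec c k n $ i)) \<longlonglongrightarrow> 0"
  proof (rule negligible_imp_grid_cells_small[OF compact_frontier[OF C(1)] C(3) eventually_cell_pos cell_lim])
    fix n
    assume pos: "\<And>i. 0 < cell_vec c k n $ i"
    have good: "good n"
    proof
      fix i
      show "0 < side c k n i"
        using pos[of i] c_pos[of n i] by (simp add: cell_vec_nth zero_less_divide_iff)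
    qed
    show "finite (Q_bd n)"
      using finite_Q[OF good] by (simp add: Q_bd_def)
    fix z
    assume z: "z \<in> Q_bd n"
    let ?I = "cbox (real_vec z * cell_vec c k n) (real_vec z * cell_vec c k n + cell_vec c k n)"
    have "real_vec z * cell_vec c k n \<in> C"
      using z by (simp add: Q_bd_def Qminus_eq_grid_index grid_index_def)
    moreover have "real_vec z * cell_vec c k n \<in> ?I"
      using pos by (simp add: mem_box_cart less_imp_le)
    moreover obtain v where v: "v \<in> Jbox c k n z" "vec_divide (real_vec v) (c n) \<notin> C"
      using z by (auto simp: Q_bd_def)
    moreover have "vec_divide (real_vec v) (c n) \<in> ?I"
      unfolding mem_box_cart
    proof
      fix i
      have "real_of_int (z $ i * side c k n i) \<le> v $ i" "real_of_int (v $ i) \<le> real_of_int ((z $ i + 1) * side c k n i)"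
        using v(1) good c_pos k_pos unfolding of_int_le_iff by (simp_all add: mem_Jbox less_imp_le)
      then show "(real_vec z * cell_vec c k n) $ i \<le> vec_divide (real_vec v) (c n) $ i \<and>
          vec_divide (real_vec v) (c n) $ i \<le> (real_vec z * cell_vec c k n + cell_vec c k n) $ i"
        using c_pos[of n i]
        by (simp add: vec_divide_def real_vec_def cell_vec_nth divide_right_mono distrib_right flip: add_divide_distrib)
    qed
    ultimately have "?I \<inter> C \<noteq> {}" "?I - C \<noteq> {}"
      by blast+
    then show "?I \<inter> frontier C \<noteq> {}"
      by (intro connected_Int_frontier convex_connected convex_box)
  qed
  then have "(\<lambda>n. real (card (Q_bd n)) * (m n / volume n)) \<longlonglongrightarrow> 0"
    by (simp only: prod_cell)
  moreover have "\<forall>\<^sub>F n in sequentially. \<bar>volume n / (real (k n) * m n)\<bar> \<le> 2 ^ CARD('d)"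
    using eventually_good
  proof eventually_elim
    case (elim n)
    then show ?case
      using volume_le_km[OF elim] volume_pos[of n] m_pos[OF elim] k_pos[of n]
      by (simp add: pos_divide_le_eq abs_mult)
  qed
  ultimately have "(\<lambda>n. real (card (Q_bd n)) * (m n / volume n) * (volume n / (real (k n) * m n))) \<longlonglongrightarrow> 0"
    by (rule tendsto_zero_mult_bounded)
  then show ?thesis
  proof (rule Lim_transform_eventually)
    show "\<forall>\<^sub>F n in sequentially. real (card (Q_bd n)) * (m n / volume n) * (volume n / (real (k n) * m n))
        = real (card (Q_bd n)) / real (k n)"
      using eventually_good
    proof eventually_elim
      case (elim n)
      show ?case
        using volume_pos[of n] m_pos[OF elim] k_pos[of n] by simp
    qed
  qed
qed

lemma card_Q_bd_mult_lim:
  assumes "\<forall>\<^sub>F n in sequentially. \<bar>real (k n) * f n\<bar> \<le> b"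
  shows "(\<lambda>n. real (card (Q_bd n)) * f n) \<longlonglongrightarrow> 0"
proof -
  have "(\<lambda>n. real (card (Q_bd n)) / real (k n) * (real (k n) * f n)) \<longlonglongrightarrow> 0"
    by (rule tendsto_zero_mult_bounded[OF card_Q_bd_lim assms])
  then show ?thesis
    using k_pos by (simp add: less_imp_neq[symmetric])
qed

text \<open>A bound of o(1/k): each of O(k) boxes has boundedly many near ones, so near pairs are
  negligible in total.\<close>

lemma prob_two_boxes_le:
  assumes good: "good n" and z: "z \<in> Q n" "z' \<in> Q n" "z \<noteq> z'"
  shows "prob (hit_box n z \<inter> hit_box n z') \<le> (h n)\<^sup>2 + \<bar>\<epsilon> n\<bar>"
proof -
  have "{\<omega> \<in> space M. z' \<in> hit_boxes n (Q n - {z}) \<omega>} = hit_box n z'"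
    using z by (auto simp: hit_boxes_def hit_def)
  then show ?thesis
    using hit_box_mixing[OF good z(1), of "\<lambda>G. z' \<in> G"] prob_hit_Jbox[OF good, of z']
    by (simp add: power2_eq_square)
qed

lemma prob_bad_le:
  assumes good: "good n"
  shows "prob (bad n) \<le> card (Q n) * (near_card TYPE('d) * ((h n)\<^sup>2 + \<bar>\<epsilon> n\<bar>)) + card (Q_bd n) * h n"
proof -
  let ?A = "\<lambda>z. {z' \<in> Q n - {z}. near z z'}"
  let ?U = "\<Union>z\<in>Q n. \<Union>z'\<in>?A z. hit_box n z \<inter> hit_box n z'" and ?V = "\<Union>z\<in>Q_bd n. hit_box n z"
  have finA: "finite (?A z)" for z
    using finite_Q[OF good] by simp
  have finB: "finite (Q_bd n)"
    using finite_Q[OF good] by (simp add: Q_bd_def)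
  have "bad n \<subseteq> ?U \<union> ?V"
    by (auto simp: bad_def bad_hits_def hit_boxes_def)
  then have "prob (bad n) \<le> prob (?U \<union> ?V)"
    using finite_Q[OF good] finA finB by (intro finite_measure_mono sets.Un sets.finite_UN) auto
  also have "\<dots> \<le> prob ?U + prob ?V"
    using finite_Q[OF good] finA finB by (intro measure_Un_le sets.finite_UN) auto
  also have "prob ?U \<le> (\<Sum>z\<in>Q n. prob (\<Union>z'\<in>?A z. hit_box n z \<inter> hit_box n z'))"
    using finite_Q[OF good] finA by (intro finite_measure_subadditive_finite image_subsetI sets.finite_UN) auto
  also have "\<dots> \<le> (\<Sum>z\<in>Q n. near_card TYPE('d) * ((h n)\<^sup>2 + \<bar>\<epsilon> n\<bar>))"
  proof (rule sum_mono)
    fix z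
    assume z: "z \<in> Q n"
    have "prob (\<Union>z'\<in>?A z. hit_box n z \<inter> hit_box n z') \<le> (\<Sum>z'\<in>?A z. prob (hit_box n z \<inter> hit_box n z'))"
      using finA by (intro finite_measure_subadditive_finite) auto
    also have "\<dots> \<le> (\<Sum>z'\<in>?A z. (h n)\<^sup>2 + \<bar>\<epsilon> n\<bar>)"
      using z by (intro sum_mono prob_two_boxes_le[OF good]) auto
    also have "\<dots> \<le> near_card TYPE('d) * ((h n)\<^sup>2 + \<bar>\<epsilon> n\<bar>)"
      using card_mono[OF near_finite_card(1), of "?A z" z] near_finite_card(2)[of z]
      by (simp add: mult_right_mono subset_iff)
    finally show "prob (\<Union>z'\<in>?A z. hit_box n z \<inter> hit_box n z') \<le> near_card TYPE('d) * ((h n)\<^sup>2 + \<bar>\<epsilon> n\<bar>)" .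
  qed
  also have "prob ?V \<le> (\<Sum>z\<in>Q_bd n. prob (hit_box n z))"
    using finB by (intro finite_measure_subadditive_finite) auto
  finally show ?thesis
    using prob_hit_Jbox[OF good] by simp
qed

lemma k_abs_\<epsilon>_lim: "(\<lambda>n. real (k n) * \<bar>\<epsilon> n\<bar>) \<longlonglongrightarrow> 0"
  using tendsto_rabs_zero[OF k_\<epsilon>_lim] by (simp add: abs_mult)

lemma prob_bad_lim: "(\<lambda>n. prob (bad n)) \<longlonglongrightarrow> 0"
proof (rule tendsto_sandwich[OF _ _ tendsto_const])
  let ?g = "\<lambda>n. card (Q n) * (near_card TYPE('d) * ((h n)\<^sup>2 + \<bar>\<epsilon> n\<bar>)) + card (Q_bd n) * h n"
  show "\<forall>\<^sub>F n in sequentially. 0 \<le> prob (bad n)"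
    by simp
  show "\<forall>\<^sub>F n in sequentially. prob (bad n) \<le> ?g n"
    using eventually_good by eventually_elim (rule prob_bad_le)
  obtain a b where ab: "0 < a" "0 < b" "\<forall>\<^sub>F n in sequentially. a \<le> real (k n) * h n"
      "\<forall>\<^sub>F n in sequentially. real (k n) * h n \<le> b"
    by (rule kh_bounds)
  have bd: "\<forall>\<^sub>F n in sequentially. \<bar>real (k n) * h n\<bar> \<le> b"
    using ab(4) by eventually_elim (simp add: h_nonneg)
  have "(\<lambda>n. near_card TYPE('d) * (real (k n) * (h n)\<^sup>2 + real (k n) * \<bar>\<epsilon> n\<bar>)) \<longlonglongrightarrow> 0"
    using tendsto_mult_left[OF tendsto_add[OF k_h2_lim k_abs_\<epsilon>_lim], of "near_card TYPE('d)"] by simp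
  then have "(\<lambda>n. real (card (Q n)) * (near_card TYPE('d) * ((h n)\<^sup>2 + \<bar>\<epsilon> n\<bar>))) \<longlonglongrightarrow> 0"
    by (intro card_Q_mult_lim) (simp add: algebra_simps)
  from tendsto_add[OF this card_Q_bd_mult_lim[OF bd]] show "?g \<longlonglongrightarrow> 0"
    by simp
qed

text \<open>Away from the boundary, badness is replaced by an event \<open>?E\<close> of the boxes
  other than z, which is nearly independent of the exceedances in z and not much more likely than
  \<open>bad n\<close>. Boundary boxes are few and get the trivial bound \<open>m p\<close>.\<close>

lemma exceedances_bad_le:
  assumes good: "good n"
  shows "(\<Sum>z\<in>Q n. \<Sum>v\<in>Jbox c k n z. prob (exc (x n) v \<inter> bad n))
    \<le> card (Q n) * (m n * p n * (prob (bad n) + near_card TYPE('d) * h n) + \<bar>\<delta> n\<bar>) + card (Q_bd n) * (m n * p n)"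
proof -
  let ?b = "m n * p n * (prob (bad n) + near_card TYPE('d) * h n) + \<bar>\<delta> n\<bar>"
  have mp: "0 \<le> m n * p n"
    using m_pos[OF good] p_nonneg by simp
  have "(\<Sum>v\<in>Jbox c k n z. prob (exc (x n) v \<inter> bad n)) \<le> ?b + (if z \<in> Q_bd n then m n * p n else 0)"
    if z: "z \<in> Q n" for z
  proof (cases "z \<in> Q_bd n")
    case True
    have "(\<Sum>v\<in>Jbox c k n z. prob (exc (x n) v \<inter> bad n)) \<le> (\<Sum>v\<in>Jbox c k n z. p n)"
    proof (rule sum_mono)
      fix v
      have "prob (exc (x n) v \<inter> bad n) \<le> prob (exc (x n) v)"
        by (intro finite_measure_mono) auto
      then show "prob (exc (x n) v \<inter> bad n) \<le> p n"
        using prob_exc[of "x n" v] by (simp add: p_def)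
    qed
    also have "\<dots> = m n * p n"
      using card_Jbox_m[OF good, of z] by simp
    finally show ?thesis
      using True mp h_nonneg[of n] by (simp add: add_increasing)
  next
    case False
    \<comment> \<open>Removing z from the hit boxes can lose only a near pair containing z, and the
      second alternative keeps its partner; a hit boundary box is not lost, as z is none.\<close>
    let ?S = "\<lambda>G. bad_hits n G \<or> (\<exists>z'\<in>G. near z z')"
    let ?E = "{\<omega> \<in> space M. ?S (hit_boxes n (Q n - {z}) \<omega>)}"
    let ?A = "{z' \<in> Q n. near z z'}"
    have fin: "finite (Q n - {z})" "finite ?A"
      using finite_Q[OF good] by auto
    have E: "?E \<in> events"
      using hit_boxes_events[OF good fin(1), of ?S] .
    have sub: "exc (x n) v \<inter> bad n \<subseteq> exc (x n) v \<inter> ?E" for v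
    proof -
      have "?S (hit_boxes n (Q n - {z}) \<omega>)" if "bad_hits n (hit_boxes n (Q n) \<omega>)" for \<omega>
        using that False near_sym[of z] unfolding bad_hits_def hit_boxes_def by blast
      then show ?thesis
        by (auto simp: bad_def)
    qed
    have "?E \<subseteq> bad n \<union> (\<Union>z'\<in>?A. hit_box n z')"
      by (auto simp: bad_def bad_hits_def hit_boxes_def)
    then have "prob ?E \<le> prob (bad n \<union> (\<Union>z'\<in>?A. hit_box n z'))"
      using bad_events[OF good] fin by (intro finite_measure_mono) auto
    also have "\<dots> \<le> prob (bad n) + prob (\<Union>z'\<in>?A. hit_box n z')"
      using bad_events[OF good] fin by (intro measure_Un_le) auto
    also have "prob (\<Union>z'\<in>?A. hit_box n z') \<le> (\<Sum>z'\<in>?A. prob (hit_box n z'))"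
      using fin by (intro finite_measure_subadditive_finite) auto
    also have "\<dots> \<le> near_card TYPE('d) * h n"
      using card_mono[OF near_finite_card(1), of ?A z] near_finite_card(2)[of z] h_nonneg[of n]
      by (simp add: prob_hit_Jbox[OF good] mult_right_mono subset_iff)
    finally have PE: "prob ?E \<le> prob (bad n) + near_card TYPE('d) * h n"
      by simp
    have "(\<Sum>v\<in>Jbox c k n z. prob (exc (x n) v \<inter> bad n)) \<le> (\<Sum>v\<in>Jbox c k n z. prob (exc (x n) v \<inter> ?E))"
      using E by (intro sum_mono finite_measure_mono sub) auto
    also have "\<dots> \<le> m n * p n * prob ?E + \<bar>\<delta> n\<bar>"
      using exceedances_mixing[OF good z, of ?S] by linarith
    also have "\<dots> \<le> ?b"
      using mult_left_mono[OF PE mp] by simp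
    finally show ?thesis
      using False by simp
  qed
  then have "(\<Sum>z\<in>Q n. \<Sum>v\<in>Jbox c k n z. prob (exc (x n) v \<inter> bad n))
      \<le> (\<Sum>z\<in>Q n. ?b + (if z \<in> Q_bd n then m n * p n else 0))"
    by (rule sum_mono)
  also have "\<dots> = card (Q n) * ?b + card (Q n \<inter> Q_bd n) * (m n * p n)"
    using finite_Q[OF good] by (simp add: sum.distrib sum.If_cases)
  also have "Q n \<inter> Q_bd n = Q_bd n"
    by (auto simp: Q_bd_def)
  finally show ?thesis .
qed

lemma exceedances_bad_lim: "(\<lambda>n. \<Sum>z\<in>Q n. \<Sum>v\<in>Jbox c k n z. prob (exc (x n) v \<inter> bad n)) \<longlonglongrightarrow> 0"
proof (rule tendsto_sandwich[OF _ _ tendsto_const])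
  let ?g = "\<lambda>n. card (Q n) * (m n * p n * (prob (bad n) + near_card TYPE('d) * h n) + \<bar>\<delta> n\<bar>) + card (Q_bd n) * (m n * p n)"
  show "\<forall>\<^sub>F n in sequentially. 0 \<le> (\<Sum>z\<in>Q n. \<Sum>v\<in>Jbox c k n z. prob (exc (x n) v \<inter> bad n))"
    by (simp add: sum_nonneg)
  show "\<forall>\<^sub>F n in sequentially. (\<Sum>z\<in>Q n. \<Sum>v\<in>Jbox c k n z. prob (exc (x n) v \<inter> bad n)) \<le> ?g n"
    using eventually_good by eventually_elim (rule exceedances_bad_le)
  obtain a b where ab: "0 < a" "0 < b" "\<forall>\<^sub>F n in sequentially. a \<le> real (k n) * (m n * p n)"
      "\<forall>\<^sub>F n in sequentially. real (k n) * (m n * p n) \<le> b"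
    by (rule kmp_bounds)
  have bd: "\<forall>\<^sub>F n in sequentially. \<bar>real (k n) * (m n * p n)\<bar> \<le> b"
    using ab(3,4) by eventually_elim (use ab(1) in auto)
  have "(\<lambda>n. prob (bad n) + near_card TYPE('d) * h n) \<longlonglongrightarrow> 0"
    using tendsto_add[OF prob_bad_lim tendsto_mult_left[OF h_tendsto_0, of "near_card TYPE('d)"]] by simp
  from tendsto_add[OF tendsto_zero_mult_bounded[OF this bd] tendsto_rabs_zero[OF k_\<delta>_lim]]
  have "(\<lambda>n. real (k n) * (m n * p n * (prob (bad n) + near_card TYPE('d) * h n) + \<bar>\<delta> n\<bar>)) \<longlonglongrightarrow> 0"
    by (simp add: abs_mult algebra_simps)
  from tendsto_add[OF card_Q_mult_lim[OF this] card_Q_bd_mult_lim[OF bd]] show "?g \<longlonglongrightarrow> 0"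
    by simp
qed

end

section \<open>The mean cluster size\<close>

context cluster_asymptotics
begin

definition exceed :: "nat \<Rightarrow> 'a \<Rightarrow> (int ^ 'd) set" where
  "exceed n \<omega> = {v \<in> Dtilde C c k n. \<xi> v \<omega> > x n}"

lemma finite_Dtilde: "good n \<Longrightarrow> finite (Dtilde C c k n)"
  unfolding Dtilde_def using finite_Q fin_Jbox by blast

lemma finite_exceed: "good n \<Longrightarrow> finite (exceed n \<omega>)"
  unfolding exceed_def using finite_Dtilde by simp

lemma card_exceed_le: "good n \<Longrightarrow> card (exceed n \<omega>) \<le> card (Dtilde C c k n)"
  unfolding exceed_def by (intro card_mono finite_Dtilde) auto

lemma sum_Dtilde: "good n \<Longrightarrow> (\<Sum>v\<in>Dtilde C c k n. f v) = (\<Sum>z\<in>Q n. \<Sum>v\<in>Jbox c k n z. f v)"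
  unfolding Dtilde_def using finite_Q fin_Jbox Jbox_disjoint[of c k n] c_pos k_pos
  by (subst sum.UNION_disjoint) auto

lemma Phi_eq: "Phi \<xi> C c x k n \<omega> = scaled_points (c n) (exceed n \<omega>)"
  by (simp add: Phi_def scaled_points_def exceed_def)

lemma Ntilde_eq: "Ntilde q \<xi> C c x k n C \<omega> = cluster_count q k n C (scaled_points (c n) (exceed n \<omega>))"
  by (simp add: Ntilde_def Phi_eq)

lemma exceed_events: "good n \<Longrightarrow> {\<omega> \<in> space M. S (exceed n \<omega>)} \<in> events"
  unfolding exceed_def by (intro exceedance_pattern_events finite_Dtilde)

text \<open>The exceedance set takes finitely many values, so the sum of the absolute values of
  \<open>g\<close> over all subsets is a bound.\<close>

lemma exceed_integrable:
  fixes g :: "(int ^ 'd) set \<Rightarrow> real"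
  assumes good: "good n"
  shows "integrable M (\<lambda>\<omega>. g (exceed n \<omega>))"
proof (rule integrable_const_bound)
  let ?B = "\<Sum>G\<in>Pow (Dtilde C c k n). \<bar>g G\<bar>"
  show "AE \<omega> in M. norm (g (exceed n \<omega>)) \<le> ?B"
    using finite_Dtilde[OF good]
    by (intro AE_I2) (auto simp: exceed_def intro!: member_le_sum[where f = "\<lambda>G. \<bar>g G\<bar>"])
  show "(\<lambda>\<omega>. g (exceed n \<omega>)) \<in> borel_measurable M"
    unfolding exceed_def
    by (rule measurable_compose[OF exceedance_pattern_measurable[OF finite_Dtilde[OF good]]]) simp
qed

lemma exceed_set_integrable:
  fixes g :: "(int ^ 'd) set \<Rightarrow> real"
  assumes "good n" "A \<in> events"
  shows "set_integrable M A (\<lambda>\<omega>. g (exceed n \<omega>))"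
  unfolding set_integrable_def by (intro integrable_mult_indicator exceed_integrable assms)

lemma integral_card_exceed:
  assumes good: "good n" and A: "A \<in> events"
  shows "(LINT \<omega>:A|M. real (card (exceed n \<omega>))) = (\<Sum>z\<in>Q n. \<Sum>v\<in>Jbox c k n z. prob (exc (x n) v \<inter> A))"
proof -
  let ?D = "Dtilde C c k n"
  have "(LINT \<omega>:A|M. real (card (exceed n \<omega>))) = (LINT \<omega>:A|M. real (card {v \<in> ?D. \<omega> \<in> exc (x n) v}))"
    using A sets.sets_into_space[OF A]
    by (intro set_lebesgue_integral_cong) (auto simp: exceed_def exc_def intro!: arg_cong[where f = card])
  also have "\<dots> = (\<Sum>v\<in>?D. prob (exc (x n) v \<inter> A))"
    by (rule set_integral_card_events[OF finite_Dtilde[OF good] _ A]) auto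
  finally show ?thesis
    by (simp add: sum_Dtilde[OF good])
qed

text \<open>The two alternatives in \<open>bad_hits\<close> negate exactly what
  \<open>clusters_eq_boxes\<close> asks: distinct hit boxes are not near, and hit boxes stay within
  C.\<close>

lemma clusters_off_bad:
  assumes good: "good n" and q: "cluster_point_rule q" and \<omega>: "\<omega> \<in> space M" "\<omega> \<notin> bad n"
  shows "cluster_count q k n C (scaled_points (c n) (exceed n \<omega>)) = card (hit_boxes n (Q n) \<omega>)"
    and "cluster_mass q k n C (scaled_points (c n) (exceed n \<omega>)) = card (exceed n \<omega>)"
proof -
  note pos = good[rule_format] c_pos k_pos
  have not_bad: "\<not> bad_hits n (hit_boxes n (Q n) \<omega>)"
    using \<omega> by (simp add: bad_def)
  have hit: "z \<in> hit_boxes n (Q n) \<omega>" if v: "v \<in> exceed n \<omega>" "v \<in> Jbox c k n z" for v z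
  proof -
    obtain z' where z': "z' \<in> Q n" "v \<in> Jbox c k n z'"
      using v(1) by (auto simp: exceed_def Dtilde_def)
    then have "z = z'"
      using Jbox_disjoint[OF pos, of z z'] v(2) by blast
    then show ?thesis
      using z' v \<omega>(1) by (auto simp: hit_boxes_def hit_def exceed_def)
  qed
  have far: "z = z'" if "v \<in> exceed n \<omega>" "v' \<in> exceed n \<omega>" "v \<in> Jbox c k n z" "v' \<in> Jbox c k n z'" "near z z'"
    for v v' z z'
    using not_bad hit[OF that(1,3)] hit[OF that(2,4)] that(5) by (auto simp: bad_hits_def)
  have inC: "vec_divide (real_vec v) (c n) \<in> C" if v: "v \<in> exceed n \<omega>" for v
  proof -
    obtain z where z: "z \<in> Q n" "v \<in> Jbox c k n z"
      using v by (auto simp: exceed_def Dtilde_def)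
    have "z \<notin> Q_bd n"
      using not_bad hit[OF v z(2)] by (auto simp: bad_hits_def)
    then show ?thesis
      using z by (auto simp: Q_bd_def)
  qed
  have "{z. Jbox c k n z \<inter> exceed n \<omega> \<noteq> {}} = hit_boxes n (Q n) \<omega>"
  proof
    show "{z. Jbox c k n z \<inter> exceed n \<omega> \<noteq> {}} \<subseteq> hit_boxes n (Q n) \<omega>"
      using hit by blast
    show "hit_boxes n (Q n) \<omega> \<subseteq> {z. Jbox c k n z \<inter> exceed n \<omega> \<noteq> {}}"
      by (auto simp: hit_boxes_def hit_def exceed_def Dtilde_def)
  qed
  then show "cluster_count q k n C (scaled_points (c n) (exceed n \<omega>)) = card (hit_boxes n (Q n) \<omega>)"
    "cluster_mass q k n C (scaled_points (c n) (exceed n \<omega>)) = card (exceed n \<omega>)"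
    using clusters_eq_boxes[OF pos q finite_exceed[OF good] far inC] by simp_all
qed

definition mass_mean :: "(nat \<Rightarrow> (real ^ 'd) set \<Rightarrow> real ^ 'd) \<Rightarrow> nat \<Rightarrow> nat \<Rightarrow> real" where
  "mass_mean q l n = (LINT \<omega>:{\<omega> \<in> space M. Ntilde q \<xi> C c x k n C \<omega> = l}|M.
     real (cluster_mass q k n C (scaled_points (c n) (exceed n \<omega>))))"

definition P_cluster :: "(nat \<Rightarrow> (real ^ 'd) set \<Rightarrow> real ^ 'd) \<Rightarrow> nat \<Rightarrow> nat \<Rightarrow> real" where
  "P_cluster q l n = prob {\<omega> \<in> space M. Ntilde q \<xi> C c x k n C \<omega> = l}"

lemma Ntilde_events: "good n \<Longrightarrow> {\<omega> \<in> space M. S (Ntilde q \<xi> C c x k n C \<omega>)} \<in> events"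
  unfolding Ntilde_eq by (rule exceed_events)

lemma P_cluster_diff_lim:
  assumes q: "cluster_point_rule q"
  shows "(\<lambda>n. P_cluster q l n - P_count l n) \<longlonglongrightarrow> 0"
proof (rule tendsto_0_le[OF prob_bad_lim, where K = 1])
  show "\<forall>\<^sub>F n in sequentially. norm (P_cluster q l n - P_count l n) \<le> norm (prob (bad n)) * 1"
    using eventually_good
  proof eventually_elim
    case (elim n)
    let ?A = "{\<omega> \<in> space M. Ntilde q \<xi> C c x k n C \<omega> = l}"
      and ?B = "{\<omega> \<in> space M. card (hit_boxes n (Q n) \<omega>) = l}"
    have ev: "?A \<in> events" "?B \<in> events" "bad n \<in> events"
      using Ntilde_events[OF elim, of "\<lambda>i. i = l" q]
        hit_boxes_events[OF elim finite_Q[OF elim], of "\<lambda>G. card G = l"] bad_events[OF elim] by auto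
    have eq: "\<omega> \<in> ?A \<longleftrightarrow> \<omega> \<in> ?B" if "\<omega> \<in> space M" "\<omega> \<notin> bad n" for \<omega>
      using clusters_off_bad(1)[OF elim q that] that by (simp add: Ntilde_eq)
    have "prob ?A \<le> prob (?B \<union> bad n)" "prob ?B \<le> prob (?A \<union> bad n)"
      using ev eq by (intro finite_measure_mono; blast)+
    then have "prob ?A \<le> prob ?B + prob (bad n)" "prob ?B \<le> prob ?A + prob (bad n)"
      using measure_Un_le[of ?B M "bad n"] measure_Un_le[of ?A M "bad n"] ev by linarith+
    then show ?case
      by (simp add: P_cluster_def P_count_def)
  qed
qed

text \<open>Off \<open>bad n\<close> the two integrands agree; on it each lies between 0 and the
  total number of exceedances, so their difference does not exceed it.\<close>

lemma mass_mean_diff_le: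
  assumes good: "good n" and q: "cluster_point_rule q"
  shows "\<bar>mass_mean q l n - (LINT \<omega>:{\<omega> \<in> space M. card (hit_boxes n (Q n) \<omega>) = l}|M. real (card (exceed n \<omega>)))\<bar>
    \<le> (\<Sum>z\<in>Q n. \<Sum>v\<in>Jbox c k n z. prob (exc (x n) v \<inter> bad n))"
proof -
  let ?A = "{\<omega> \<in> space M. Ntilde q \<xi> C c x k n C \<omega> = l}"
    and ?B = "{\<omega> \<in> space M. card (hit_boxes n (Q n) \<omega>) = l}"
  let ?T = "\<lambda>\<omega>. real (cluster_mass q k n C (scaled_points (c n) (exceed n \<omega>)))"
    and ?W = "\<lambda>\<omega>. real (card (exceed n \<omega>))"
  have ev: "?A \<in> events" "?B \<in> events" "bad n \<in> events"
    using Ntilde_events[OF good, of "\<lambda>i. i = l" q]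
      hit_boxes_events[OF good finite_Q[OF good], of "\<lambda>G. card G = l"] bad_events[OF good] by auto
  have intT: "set_integrable M ?A ?T"
    by (rule exceed_set_integrable[OF good ev(1)])
  have intW: "set_integrable M E ?W" if "E \<in> events" for E
    by (rule exceed_set_integrable[OF good that])
  have T_le: "?T \<omega> \<le> ?W \<omega>" for \<omega>
    using cluster_mass_le[of "scaled_points (c n) (exceed n \<omega>)" q k n C] finite_exceed[OF good, of \<omega>]
      card_scaled_points[OF c_pos, of n "exceed n \<omega>"] by (simp add: scaled_points_def)
  have "\<bar>mass_mean q l n - (LINT \<omega>:?B|M. ?W \<omega>)\<bar>
      = \<bar>LINT \<omega>|M. indicator ?A \<omega> *\<^sub>R ?T \<omega> - indicator ?B \<omega> *\<^sub>R ?W \<omega>\<bar>"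
    unfolding mass_mean_def set_lebesgue_integral_def
    using intT intW[OF ev(2)] by (subst Bochner_Integration.integral_diff) (auto simp: set_integrable_def)
  also have "\<dots> \<le> (LINT \<omega>|M. \<bar>indicator ?A \<omega> *\<^sub>R ?T \<omega> - indicator ?B \<omega> *\<^sub>R ?W \<omega>\<bar>)"
    by (rule integral_abs_bound)
  also have "\<dots> \<le> (LINT \<omega>|M. indicator (bad n) \<omega> *\<^sub>R ?W \<omega>)"
  proof (rule integral_mono)
    show "integrable M (\<lambda>\<omega>. \<bar>indicator ?A \<omega> *\<^sub>R ?T \<omega> - indicator ?B \<omega> *\<^sub>R ?W \<omega>\<bar>)"
      using intT intW[OF ev(2)] unfolding set_integrable_def
      by (intro integrable_abs Bochner_Integration.integrable_diff)
    show "integrable M (\<lambda>\<omega>. indicator (bad n) \<omega> *\<^sub>R ?W \<omega>)"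
      using intW[OF ev(3)] by (simp add: set_integrable_def)
    fix \<omega>
    assume \<omega>: "\<omega> \<in> space M"
    show "\<bar>indicator ?A \<omega> *\<^sub>R ?T \<omega> - indicator ?B \<omega> *\<^sub>R ?W \<omega>\<bar> \<le> indicator (bad n) \<omega> *\<^sub>R ?W \<omega>"
    proof (cases "\<omega> \<in> bad n")
      case True
      have "0 \<le> ?T \<omega>"
        by simp
      then show ?thesis
        using True T_le[of \<omega>] by (cases "\<omega> \<in> ?A"; cases "\<omega> \<in> ?B") auto
    next
      case False
      then show ?thesis
        using clusters_off_bad[OF good q \<omega> False] by (simp add: indicator_def Ntilde_eq)
    qed
  qed
  also have "\<dots> = (\<Sum>z\<in>Q n. \<Sum>v\<in>Jbox c k n z. prob (exc (x n) v \<inter> bad n))"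
    using integral_card_exceed[OF good ev(3)] by (simp add: set_lebesgue_integral_def)
  finally show ?thesis .
qed

text \<open>\<open>box_numerator\<close> summed over the boxes. The probabilities that box z is hit
  while j + 1 boxes are hit add up to (j + 1) \<open>P_count (j + 1) n\<close>, and the errors to
  \<open>rate\<close> times the number of boxes.\<close>

lemma exceed_count_mean_lim:
  "(\<lambda>n. (LINT \<omega>:{\<omega> \<in> space M. card (hit_boxes n (Q n) \<omega>) = j + 1}|M. real (card (exceed n \<omega>)))
    - real (j + 1) * P_count (j + 1) n / \<theta>) \<longlonglongrightarrow> 0"
proof (rule tendsto_0_le[OF card_Q_mult_lim[OF k_rate_lim], where K = 1])
  show "\<forall>\<^sub>F n in sequentially. norm ((LINT \<omega>:{\<omega> \<in> space M. card (hit_boxes n (Q n) \<omega>) = j + 1}|M. real (card (exceed n \<omega>)))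
    - real (j + 1) * P_count (j + 1) n / \<theta>) \<le> norm (real (card (Q n)) * rate n) * 1"
    using eventually_good
  proof eventually_elim
    case (elim n)
    let ?N = "{\<omega> \<in> space M. card (hit_boxes n (Q n) \<omega>) = j + 1}"
    have N: "?N \<in> events"
      using hit_boxes_events[OF elim finite_Q[OF elim], of "\<lambda>G. card G = j + 1"] .
    have "real (j + 1) * P_count (j + 1) n = (LINT \<omega>:?N|M. real (j + 1))"
      using N by (simp add: P_count_def set_integral_const emeasure_eq_measure)
    also have "\<dots> = (LINT \<omega>:?N|M. real (card {z \<in> Q n. \<omega> \<in> hit_box n z}))"
      using N by (intro set_lebesgue_integral_cong) (auto simp: hit_boxes_def)
    also have "\<dots> = (\<Sum>z\<in>Q n. prob (hit_box n z \<inter> ?N))"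
      by (rule set_integral_card_events[OF finite_Q[OF elim] _ N]) auto
    finally have count: "real (j + 1) * P_count (j + 1) n = (\<Sum>z\<in>Q n. prob (hit_box n z \<inter> ?N))" .
    have "\<bar>(LINT \<omega>:?N|M. real (card (exceed n \<omega>))) - real (j + 1) * P_count (j + 1) n / \<theta>\<bar>
        = \<bar>\<Sum>z\<in>Q n. (\<Sum>v\<in>Jbox c k n z. prob (exc (x n) v \<inter> ?N)) - prob (hit_box n z \<inter> ?N) / \<theta>\<bar>"
      unfolding integral_card_exceed[OF elim N] count by (simp only: sum_subtractf sum_divide_distrib)
    also have "\<dots> \<le> (\<Sum>z\<in>Q n. rate n)"
      by (intro order_trans[OF sum_abs] sum_mono box_numerator(1)[OF elim])
    finally show ?case
      by (simp only: real_norm_def sum_constant mult_1_right)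
  qed
qed

lemma mass_mean_lim:
  assumes q: "cluster_point_rule q" and l: "1 \<le> l"
  shows "(\<lambda>n. mass_mean q l n - real l * P_cluster q l n * (1 / \<theta>)) \<longlonglongrightarrow> 0"
proof -
  obtain j where j: "l = j + 1"
    using l by (metis Suc_eq_plus1 not0_implies_Suc not_one_le_zero)
  let ?EW = "\<lambda>n. LINT \<omega>:{\<omega> \<in> space M. card (hit_boxes n (Q n) \<omega>) = l}|M. real (card (exceed n \<omega>))"
  have 1: "(\<lambda>n. mass_mean q l n - ?EW n) \<longlonglongrightarrow> 0"
  proof (rule tendsto_0_le[OF exceedances_bad_lim, where K = 1])
    show "\<forall>\<^sub>F n in sequentially. norm (mass_mean q l n - ?EW n)
        \<le> norm (\<Sum>z\<in>Q n. \<Sum>v\<in>Jbox c k n z. prob (exc (x n) v \<inter> bad n)) * 1"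
      using eventually_good
    proof eventually_elim
      case (elim n)
      show ?case
        using mass_mean_diff_le[OF elim q, of l] by simp
    qed
  qed
  have 2: "(\<lambda>n. ?EW n - real l * P_count l n / \<theta>) \<longlonglongrightarrow> 0"
    unfolding j by (rule exceed_count_mean_lim)
  have 3: "(\<lambda>n. real l / \<theta> * (P_cluster q l n - P_count l n)) \<longlonglongrightarrow> 0"
    using tendsto_mult_left[OF P_cluster_diff_lim[OF q, of l], of "real l / \<theta>"] by simp
  have "(\<lambda>n. (mass_mean q l n - ?EW n) + (?EW n - real l * P_count l n / \<theta>)
      - real l / \<theta> * (P_cluster q l n - P_count l n)) \<longlonglongrightarrow> 0 + 0 - 0"
    by (intro tendsto_add tendsto_diff 1 2 3)
  then show ?thesis
    by (simp add: algebra_simps)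
qed

lemma P_cluster_bounded_below:
  assumes q: "cluster_point_rule q"
  shows "\<exists>\<eta>>0. \<forall>\<^sub>F n in sequentially. \<eta> \<le> P_cluster q l n"
proof -
  obtain \<eta> where \<eta>: "0 < \<eta>" "\<forall>\<^sub>F n in sequentially. \<eta> \<le> P_count l n"
    using P_count_bounded_below by blast
  have "\<forall>\<^sub>F n in sequentially. - (\<eta> / 2) < P_cluster q l n - P_count l n"
    using order_tendstoD(1)[OF P_cluster_diff_lim[OF q, of l], of "- (\<eta> / 2)"] \<eta>(1) by simp
  then have "\<forall>\<^sub>F n in sequentially. \<eta> / 2 \<le> P_cluster q l n"
    using \<eta>(2) by eventually_elim linarith
  then show ?thesis
    using \<eta>(1) by (intro exI[of _ "\<eta> / 2"]) auto
qed

section \<open>The randomly chosen cluster under the two kinds of conditioning\<close>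

context
  fixes q :: "nat \<Rightarrow> (real ^ 'd) set \<Rightarrow> real ^ 'd" and e :: "nat \<Rightarrow> (real ^ 'd) set \<Rightarrow> nat \<Rightarrow> (real ^ 'd) set"
    and S :: "nat \<Rightarrow> 'a \<Rightarrow> nat"
  assumes q: "cluster_point_rule q" and e: "cluster_enumeration q C k e"
    and S: "\<And>n. uniform_index M \<xi> (Ntilde q \<xi> C c x k n C) (S n)"
begin

lemma random_cluster_integral:
  assumes good: "good n" and l: "1 \<le> l"
  shows "set_integrable M {\<omega> \<in> space M. Ntilde q \<xi> C c x k n C \<omega> = l}
      (\<lambda>\<omega>. real (random_cluster_size e S \<xi> C c x k n \<omega>))"
    and "(LINT \<omega>:{\<omega> \<in> space M. Ntilde q \<xi> C c x k n C \<omega> = l}|M. real (random_cluster_size e S \<xi> C c x k n \<omega>))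
      = mass_mean q l n / l"
proof -
  let ?s = "scaled_points (c n)"
  have "uniform_index M \<xi> (\<lambda>\<omega>. cluster_count q k n C (?s (exceed n \<omega>))) (S n)"
    using S[of n] by (simp add: Ntilde_eq[abs_def])
  note rand = random_index_integral[OF this[unfolded exceed_def] finite_Dtilde[OF good] l,
      where g = "\<lambda>G i. real (card (e n (?s G) i))", folded exceed_def]
  show "set_integrable M {\<omega> \<in> space M. Ntilde q \<xi> C c x k n C \<omega> = l}
      (\<lambda>\<omega>. real (random_cluster_size e S \<xi> C c x k n \<omega>))"
    using rand(1) by (simp add: Ntilde_eq random_cluster_size_def Phi_eq)
  have A: "{\<omega> \<in> space M. Ntilde q \<xi> C c x k n C \<omega> = l} \<in> events"
    using Ntilde_events[OF good, of "\<lambda>i. i = l" q] .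
  have "(LINT \<omega>:{\<omega> \<in> space M. Ntilde q \<xi> C c x k n C \<omega> = l}|M. real (random_cluster_size e S \<xi> C c x k n \<omega>))
      = (LINT \<omega>:{\<omega> \<in> space M. Ntilde q \<xi> C c x k n C \<omega> = l}|M. \<Sum>i = 1..l. real (card (e n (?s (exceed n \<omega>)) i))) / l"
    using rand(2) by (simp add: Ntilde_eq random_cluster_size_def Phi_eq)
  also have "(LINT \<omega>:{\<omega> \<in> space M. Ntilde q \<xi> C c x k n C \<omega> = l}|M. \<Sum>i = 1..l. real (card (e n (?s (exceed n \<omega>)) i)))
      = mass_mean q l n"
    unfolding mass_mean_def
  proof (rule set_lebesgue_integral_cong[OF A], intro allI impI)
    fix \<omega>
    assume "\<omega> \<in> {\<omega> \<in> space M. Ntilde q \<xi> C c x k n C \<omega> = l}"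
    then have l_eq: "l = cluster_count q k n C (?s (exceed n \<omega>))"
      by (simp add: Ntilde_eq)
    have fin: "finite (?s (exceed n \<omega>))"
      using finite_exceed[OF good] by (simp add: scaled_points_def)
    show "(\<Sum>i = 1..l. real (card (e n (?s (exceed n \<omega>)) i))) = real (cluster_mass q k n C (?s (exceed n \<omega>)))"
      unfolding sum_enumerated_clusters[OF e fin, symmetric] l_eq by simp
  qed
  finally show "(LINT \<omega>:{\<omega> \<in> space M. Ntilde q \<xi> C c x k n C \<omega> = l}|M. real (random_cluster_size e S \<xi> C c x k n \<omega>))
      = mass_mean q l n / l" .
qed

lemma cond_expect_cluster_eq_lim:
  assumes l: "1 \<le> l"
  shows "(\<lambda>n. cond_expect M (\<lambda>\<omega>. real (random_cluster_size e S \<xi> C c x k n \<omega>))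
    (\<lambda>\<omega>. Ntilde q \<xi> C c x k n C \<omega> = l)) \<longlonglongrightarrow> 1 / \<theta>"
proof -
  obtain \<eta> where \<eta>: "0 < \<eta>" "\<forall>\<^sub>F n in sequentially. \<eta> \<le> P_cluster q l n"
    using P_cluster_bounded_below[OF q] by blast
  have "\<forall>\<^sub>F n in sequentially. \<eta> \<le> real l * P_cluster q l n"
    using \<eta>(2)
  proof eventually_elim
    case (elim n)
    have "1 * \<eta> \<le> real l * P_cluster q l n"
      using elim l \<eta>(1) by (intro mult_mono) auto
    then show ?case
      by simp
  qed
  from ratio_tendsto[OF mass_mean_lim[OF q l] \<eta>(1) this]
  show ?thesis
  proof (rule Lim_transform_eventually)
    show "\<forall>\<^sub>F n in sequentially. mass_mean q l n / (real l * P_cluster q l n) =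
        cond_expect M (\<lambda>\<omega>. real (random_cluster_size e S \<xi> C c x k n \<omega>)) (\<lambda>\<omega>. Ntilde q \<xi> C c x k n C \<omega> = l)"
      using eventually_good
    proof eventually_elim
      case (elim n)
      show ?case
        unfolding cond_expect_def random_cluster_integral(2)[OF elim l] P_cluster_def by simp
    qed
  qed
qed

text \<open>The share of the event with l clusters in the difference between the mean size on the
  event of a positive count and 1 / \<theta> times its probability.\<close>

definition gap :: "nat \<Rightarrow> nat \<Rightarrow> real" where
  "gap n l = mass_mean q l n / l - P_cluster q l n / \<theta>"

text \<open>Both terms of \<open>gap\<close> are nonnegative and controlled by the exceedances on
  the event with l clusters, divided by L + 1: clusters are disjoint sets of exceedances, and l
  nonempty clusters need at least l of them.\<close>

lemma abs_gap_le:
  assumes good: "good n" and l: "L < l"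
  shows "\<bar>gap n l\<bar> \<le> (1 + 1 / \<theta>) / (real L + 1) *
    (LINT \<omega>:{\<omega> \<in> space M. Ntilde q \<xi> C c x k n C \<omega> = l}|M. real (card (exceed n \<omega>)))"
proof -
  let ?A = "{\<omega> \<in> space M. Ntilde q \<xi> C c x k n C \<omega> = l}"
  let ?I = "LINT \<omega>:?A|M. real (card (exceed n \<omega>))"
  have A: "?A \<in> events"
    using Ntilde_events[OF good, of "\<lambda>i. i = l" q] .
  have fin: "finite (scaled_points (c n) (exceed n \<omega>))" for \<omega>
    using finite_exceed[OF good] by (simp add: scaled_points_def)
  have mass: "mass_mean q l n \<le> ?I"
    unfolding mass_mean_def
  proof (rule set_integral_mono[OF exceed_set_integrable[OF good A] exceed_set_integrable[OF good A]])
    fix \<omega>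
    show "real (cluster_mass q k n C (scaled_points (c n) (exceed n \<omega>))) \<le> real (card (exceed n \<omega>))"
      using cluster_mass_le[OF fin, of q k n C \<omega>] card_scaled_points[OF c_pos, of n "exceed n \<omega>"] by simp
  qed
  have mass0: "0 \<le> mass_mean q l n"
    unfolding mass_mean_def set_lebesgue_integral_def by (intro integral_nonneg_AE) auto
  have "real l * P_cluster q l n = (LINT \<omega>:?A|M. real l)"
    using A by (simp add: P_cluster_def set_integral_const emeasure_eq_measure)
  also have "\<dots> \<le> ?I"
  proof (rule set_integral_mono[OF _ exceed_set_integrable[OF good A]])
    show "set_integrable M ?A (\<lambda>_. real l)"
      using A by (simp add: set_integrable_def emeasure_eq_measure)
    fix \<omega>
    assume "\<omega> \<in> ?A"
    then show "real l \<le> real (card (exceed n \<omega>))"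
      using cluster_count_le[OF fin, of q k n C \<omega>] card_scaled_points[OF c_pos, of n "exceed n \<omega>"]
      by (simp add: Ntilde_eq)
  qed
  finally have prob: "real l * P_cluster q l n \<le> ?I" .
  have P0: "0 \<le> P_cluster q l n"
    by (simp add: P_cluster_def)
  have Ll: "real L + 1 \<le> real l" "0 < real l"
    using l by linarith+
  have "mass_mean q l n / l \<le> ?I / (real L + 1)"
    using mass mass0 Ll by (intro frac_le) auto
  moreover have "P_cluster q l n \<le> ?I / (real L + 1)"
  proof -
    have "(real L + 1) * P_cluster q l n \<le> real l * P_cluster q l n"
      using Ll P0 by (intro mult_right_mono) auto
    then show ?thesis
      using prob by (simp add: pos_le_divide_eq mult.commute)
  qed
  then have "P_cluster q l n / \<theta> \<le> ?I / (real L + 1) / \<theta>"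
    using \<theta>(1) by (intro divide_right_mono) auto
  moreover have "0 \<le> mass_mean q l n / l" "0 \<le> P_cluster q l n / \<theta>"
    using mass0 P0 \<theta>(1) by simp_all
  ultimately have "\<bar>gap n l\<bar> \<le> ?I / (real L + 1) + ?I / (real L + 1) / \<theta>"
    unfolding gap_def by linarith
  also have "\<dots> = (1 + 1 / \<theta>) / (real L + 1) * ?I"
    by (simp add: distrib_right add_divide_distrib) (simp add: algebra_simps)
  finally show ?thesis .
qed

text \<open>There are never more clusters than sites, so the sum over l is finite. \<open>B\<close>
  is left free in order to reach beyond any cut-off.\<close>

lemma positive_count_decomposition:
  assumes good: "good n" and B: "card (Dtilde C c k n) \<le> B"
  shows "(LINT \<omega>:{\<omega> \<in> space M. Ntilde q \<xi> C c x k n C \<omega> > 0}|M. real (random_cluster_size e S \<xi> C c x k n \<omega>))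
      - prob {\<omega> \<in> space M. Ntilde q \<xi> C c x k n C \<omega> > 0} / \<theta> = (\<Sum>l = 1..B. gap n l)"
proof -
  let ?A = "\<lambda>l. {\<omega> \<in> space M. Ntilde q \<xi> C c x k n C \<omega> = l}"
  have ev: "?A l \<in> events" for l
    using Ntilde_events[OF good, of "\<lambda>i. i = l" q] .
  have le: "Ntilde q \<xi> C c x k n C \<omega> \<le> B" for \<omega>
  proof -
    have "Ntilde q \<xi> C c x k n C \<omega> \<le> card (scaled_points (c n) (exceed n \<omega>))"
      unfolding Ntilde_eq using finite_exceed[OF good] by (intro cluster_count_le) (simp add: scaled_points_def)
    also have "\<dots> = card (exceed n \<omega>)"
      by (rule card_scaled_points[OF c_pos])
    finally show ?thesis
      using card_exceed_le[OF good, of \<omega>] B by linarith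
  qed
  have A_eq: "{\<omega> \<in> space M. Ntilde q \<xi> C c x k n C \<omega> > 0} = (\<Union>l\<in>{1..B}. ?A l)"
    using le by (auto simp: Suc_le_eq)
  have disj: "disjoint_family_on ?A {1..B}"
    by (auto simp: disjoint_family_on_def)
  have "(LINT \<omega>:(\<Union>l\<in>{1..B}. ?A l)|M. real (random_cluster_size e S \<xi> C c x k n \<omega>))
      = (\<Sum>l = 1..B. LINT \<omega>:?A l|M. real (random_cluster_size e S \<xi> C c x k n \<omega>))"
    by (rule set_integral_finite_Union[OF _ disj]) (use random_cluster_integral(1)[OF good] ev in auto)
  also have "\<dots> = (\<Sum>l = 1..B. mass_mean q l n / l)"
    by (intro sum.cong refl random_cluster_integral(2)[OF good]) auto
  finally have 1: "(LINT \<omega>:(\<Union>l\<in>{1..B}. ?A l)|M. real (random_cluster_size e S \<xi> C c x k n \<omega>))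
      = (\<Sum>l = 1..B. mass_mean q l n / l)" .
  have "prob (\<Union>l\<in>{1..B}. ?A l) = (\<Sum>l = 1..B. prob (?A l))"
    by (rule finite_measure_finite_Union[OF _ _ disj]) (use ev in auto)
  then have 2: "prob (\<Union>l\<in>{1..B}. ?A l) = (\<Sum>l = 1..B. P_cluster q l n)"
    by (simp add: P_cluster_def)
  show ?thesis
    unfolding A_eq 1 2 by (simp only: gap_def sum_subtractf sum_divide_distrib)
qed

text \<open>The events with exactly l clusters are disjoint, so at every site the sum over l is at
  most \<open>p\<close>. This leaves the mean number of exceedances in all boxes of
  \<open>Q n\<close>.\<close>

lemma sum_gap_tail_le:
  assumes good: "good n"
  shows "\<bar>\<Sum>l = L + 1..B. gap n l\<bar> \<le> (1 + 1 / \<theta>) / (real L + 1) * (card (Q n) * (m n * p n))"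
proof -
  let ?A = "\<lambda>l. {\<omega> \<in> space M. Ntilde q \<xi> C c x k n C \<omega> = l}"
  let ?K = "(1 + 1 / \<theta>) / (real L + 1)"
  have ev: "?A l \<in> events" for l
    using Ntilde_events[OF good, of "\<lambda>i. i = l" q] .
  have "\<bar>\<Sum>l = L + 1..B. gap n l\<bar> \<le> (\<Sum>l = L + 1..B. \<bar>gap n l\<bar>)"
    by (rule sum_abs)
  also have "\<dots> \<le> (\<Sum>l = L + 1..B. ?K * (LINT \<omega>:?A l|M. real (card (exceed n \<omega>))))"
    by (intro sum_mono abs_gap_le[OF good]) auto
  also have "\<dots> = ?K * (\<Sum>l = L + 1..B. \<Sum>z\<in>Q n. \<Sum>v\<in>Jbox c k n z. prob (exc (x n) v \<inter> ?A l))"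
    unfolding integral_card_exceed[OF good ev] by (rule sum_distrib_left[symmetric])
  also have "\<dots> = ?K * (\<Sum>z\<in>Q n. \<Sum>v\<in>Jbox c k n z. \<Sum>l = L + 1..B. prob (exc (x n) v \<inter> ?A l))"
    by (subst sum.swap, subst sum.swap) (rule refl)
  also have "\<dots> \<le> ?K * (\<Sum>z\<in>Q n. \<Sum>v\<in>Jbox c k n z. p n)"
  proof (intro mult_left_mono sum_mono)
    fix v
    have "(\<Sum>l = L + 1..B. prob (exc (x n) v \<inter> ?A l)) = prob (\<Union>l\<in>{L + 1..B}. exc (x n) v \<inter> ?A l)"
      by (rule finite_measure_finite_Union[symmetric]) (use ev in \<open>auto simp: disjoint_family_on_def\<close>)
    also have "\<dots> \<le> prob (exc (x n) v)"
      by (intro finite_measure_mono) auto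
    finally show "(\<Sum>l = L + 1..B. prob (exc (x n) v \<inter> ?A l)) \<le> p n"
      using prob_exc[of "x n" v] by (simp add: p_def)
  qed (use \<theta>(1) in auto)
  also have "(\<Sum>z\<in>Q n. \<Sum>v\<in>Jbox c k n z. p n) = card (Q n) * (m n * p n)"
    using card_Jbox_m[OF good] by simp
  finally show ?thesis .
qed

lemma cond_expect_cluster_pos_lim:
  "(\<lambda>n. cond_expect M (\<lambda>\<omega>. real (random_cluster_size e S \<xi> C c x k n \<omega>))
    (\<lambda>\<omega>. Ntilde q \<xi> C c x k n C \<omega> > 0)) \<longlonglongrightarrow> 1 / \<theta>"
proof -
  let ?E = "\<lambda>n. LINT \<omega>:{\<omega> \<in> space M. Ntilde q \<xi> C c x k n C \<omega> > 0}|M. real (random_cluster_size e S \<xi> C c x k n \<omega>)"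
    and ?P = "\<lambda>n. prob {\<omega> \<in> space M. Ntilde q \<xi> C c x k n C \<omega> > 0}"
  obtain a b where ab: "0 < a" "0 < b" "\<forall>\<^sub>F n in sequentially. a \<le> real (card (Q n)) * h n"
    "\<forall>\<^sub>F n in sequentially. real (card (Q n)) * h n \<le> b"
    "\<forall>\<^sub>F n in sequentially. real (card (Q n)) * (m n * p n) \<le> b"
    by (rule card_Q_h_bounds)
  have "(\<lambda>n. ?E n - ?P n / \<theta>) \<longlonglongrightarrow> 0"
  proof (rule tail_sum_tendsto_zero[where e = gap and B = "(1 + 1 / \<theta>) * b"])
    fix l :: nat
    assume l: "1 \<le> l"
    have "(\<lambda>n. (mass_mean q l n - real l * P_cluster q l n * (1 / \<theta>)) * (1 / real l)) \<longlonglongrightarrow> 0"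
      using tendsto_mult_right[OF mass_mean_lim[OF q l], of "1 / real l"] by simp
    moreover have "(mass_mean q l n - real l * P_cluster q l n * (1 / \<theta>)) * (1 / real l) = gap n l" for n
      using l by (simp add: gap_def diff_divide_distrib)
    ultimately show "(\<lambda>n. gap n l) \<longlonglongrightarrow> 0"
      by simp
  next
    fix L :: nat
    show "\<forall>\<^sub>F n in sequentially. \<bar>?E n - ?P n / \<theta> - (\<Sum>l = 1..L. gap n l)\<bar> \<le> (1 + 1 / \<theta>) * b / (real L + 1)"
      using eventually_good ab(5)
    proof eventually_elim
      case (elim n)
      \<comment> \<open>Adding L allows the sum to be split at L even if there are fewer sites than
        that.\<close>
      let ?B = "L + card (Dtilde C c k n)"
      have "?E n - ?P n / \<theta> = (\<Sum>l = 1..?B. gap n l)"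
        by (rule positive_count_decomposition[OF elim(1)]) simp
      also have "\<dots> = (\<Sum>l = 1..L. gap n l) + (\<Sum>l = L + 1..?B. gap n l)"
        by (rule sum.ub_add_nat) simp
      finally have "\<bar>?E n - ?P n / \<theta> - (\<Sum>l = 1..L. gap n l)\<bar> = \<bar>\<Sum>l = L + 1..?B. gap n l\<bar>"
        by simp
      also have "\<dots> \<le> (1 + 1 / \<theta>) / (real L + 1) * (card (Q n) * (m n * p n))"
        by (rule sum_gap_tail_le[OF elim(1)])
      also have "\<dots> \<le> (1 + 1 / \<theta>) / (real L + 1) * b"
        using elim(2) \<theta>(1) by (intro mult_left_mono) auto
      finally show ?case
        by simp
    qed
  qed
  then have lim: "(\<lambda>n. ?E n - ?P n * (1 / \<theta>)) \<longlonglongrightarrow> 0"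
    by simp
  obtain \<eta> where \<eta>: "0 < \<eta>" "\<forall>\<^sub>F n in sequentially. \<eta> \<le> P_cluster q 1 n"
    using P_cluster_bounded_below[OF q] by blast
  \<comment> \<open>Exactly one cluster already has probability bounded away from 0.\<close>
  have "\<forall>\<^sub>F n in sequentially. \<eta> \<le> ?P n"
    using \<eta>(2) eventually_good
  proof eventually_elim
    case (elim n)
    have "P_cluster q 1 n \<le> ?P n"
      unfolding P_cluster_def using Ntilde_events[OF elim(2), of "\<lambda>i. i > 0" q]
      by (intro finite_measure_mono) auto
    then show ?case
      using elim(1) by linarith
  qed
  from ratio_tendsto[OF lim \<eta>(1) this] show ?thesis
    by (simp add: cond_expect_def)
qed

end

end

section \<open>The theorem\<close>

text \<open>A convex body has a null frontier, and the frontier of a finite union lies in the union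
  of the frontiers. Measure 1 excludes the empty union, so some body supplies an interior
  point.\<close>

lemma p_convex_regular:
  assumes C: "p_convex p C" and "measure lebesgue C = 1"
  shows "compact C" "interior C \<noteq> {}" "negligible (frontier C)"
proof -
  obtain K where K: "\<And>i. i < p \<Longrightarrow> convex_body (K i)" "C = (\<Union>i<p. K i)"
    using C by (auto simp: p_convex_def)
  show "compact C"
    unfolding K(2) using K(1) by (intro compact_UN) (auto simp: convex_body_def)
  have "0 < p"
    using assms(2) K(2) by (cases p) auto
  then have "interior (K 0) \<subseteq> interior C" "interior (K 0) \<noteq> {}"
    using K(1)[of 0] by (auto simp: K(2) convex_body_def intro!: interior_mono)
  then show "interior C \<noteq> {}"
    by blast
  have "frontier C \<subseteq> \<Union>(frontier ` (K ` {..<p}))"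
    unfolding K(2) by (rule frontier_Union_subset) simp
  moreover have "negligible (\<Union>(frontier ` (K ` {..<p})))"
    using K(1) by (intro negligible_Union) (auto simp: convex_body_def intro: negligible_convex_frontier)
  ultimately show "negligible (frontier C)"
    using negligible_subset by blast
qed

theorem theorem5p1:
  fixes M :: "'a measure"
    and \<xi> :: "int ^ 'd \<Rightarrow> 'a \<Rightarrow> real"
    and C :: "(real ^ 'd) set"
    and p :: nat
    and c :: "nat \<Rightarrow> real ^ 'd"
    and \<kappa> \<theta> \<tau> :: real
    and x :: "nat \<Rightarrow> real"
    and k :: "nat \<Rightarrow> nat"
    and \<gamma> :: "nat \<Rightarrow> real ^ 'd"
    and \<alpha> :: "nat \<Rightarrow> real"
    and R :: "(int ^ 'd) rel"
    and q :: "nat \<Rightarrow> (real ^ 'd) set \<Rightarrow> real ^ 'd"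
    and e :: "nat \<Rightarrow> (real ^ 'd) set \<Rightarrow> nat \<Rightarrow> (real ^ 'd) set"
  assumes "prob_space M"
    and "p_convex p C"
    and "measure lebesgue C = 1"
    and "\<And>n l. 0 < c n $ l"
    and "\<And>l. filterlim (\<lambda>n. c n $ l) at_top sequentially"
    and "translation_invariant_total_order R"
    and "cluster_point_rule q"
    and "cluster_enumeration q C k e"
    and "\<And>n. 0 < k n"
    and "filterlim k at_top sequentially"
    and "\<And>l. (\<lambda>n. root CARD('d) (real (k n)) / c n $ l) \<longlonglongrightarrow> 0"
    and "0 < \<kappa>"
    and "\<And>n. Dplus C c k n \<subseteq> Kset c \<kappa> n"
    and "stationary_field M \<xi>"
    and "cond_D M \<xi> c x (Kset c \<kappa>) \<gamma> \<alpha>"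
    and "(\<lambda>n. real (k n) * \<alpha> n) \<longlonglongrightarrow> 0"
    and "vec_smallo (\<lambda>n. root CARD('d) (real (k n)) *\<^sub>R \<gamma> n) c"
    and "0 < \<theta>" and "\<theta> \<le> 1"
    and "cond_Dl M \<xi> R c x k \<theta>"
    and "0 < \<tau>"
    and "(\<lambda>n. real (card (lattice_points (scale_set (c n) C)))
             * measure M {\<omega> \<in> space M. \<xi> 0 \<omega> > x n}) \<longlonglongrightarrow> \<tau>"
  shows "(\<lambda>n. cond_expect M (\<lambda>\<omega>. real (Ycount \<xi> c x k n 0 \<omega>)) (\<lambda>\<omega>. Ycount \<xi> c x k n 0 \<omega> > 0))
           \<longlonglongrightarrow> 1 / \<theta>
       \<and> (cond_Dbar M \<xi> c x k (Kset c \<kappa>) \<longrightarrow>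
            (\<forall>S :: nat \<Rightarrow> 'a \<Rightarrow> nat.
               (\<forall>n. uniform_index M \<xi> (Ntilde q \<xi> C c x k n C) (S n)) \<longrightarrow>
               (\<lambda>n. cond_expect M (\<lambda>\<omega>. real (random_cluster_size e S \<xi> C c x k n \<omega>))
                      (\<lambda>\<omega>. Ntilde q \<xi> C c x k n C \<omega> > 0)) \<longlonglongrightarrow> 1 / \<theta>
               \<and> (\<forall>l\<ge>1.
                   (\<lambda>n. cond_expect M (\<lambda>\<omega>. real (random_cluster_size e S \<xi> C c x k n \<omega>))
                          (\<lambda>\<omega>. Ntilde q \<xi> C c x k n C \<omega> = l)) \<longlonglongrightarrow> 1 / \<theta>))
            \<and> (\<forall>l\<ge>1.
                 (\<lambda>n. Max ((\<lambda>z. \<bar>cond_expect M (\<lambda>\<omega>. real (Ycount \<xi> c x k n z \<omega>))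
                                    (\<lambda>\<omega>. Ycount \<xi> c x k n z \<omega> > 0 \<and> Ncount \<xi> c x k n C \<omega> = l)
                                  - 1 / \<theta>\<bar>) ` Qminus C c k n)) \<longlonglongrightarrow> 0))"
proof -
  interpret prob_space M
    by fact
  interpret exceedances M \<xi>
    by unfold_locales fact
  interpret box: box_asymptotics M \<xi> C c \<kappa> \<theta> \<tau> x k R
    by unfold_locales (rule assms p_convex_regular[OF assms(2,3)] | unfold exc_def, rule assms)+
  have h_lim: "(\<lambda>n. box.h n / (box.m n * box.p n)) \<longlonglongrightarrow> \<theta>"
    by (rule box.prob_hit_ratio_lim[OF assms(15,16,17)])
  have mixing: "(\<forall>S :: nat \<Rightarrow> 'a \<Rightarrow> nat. (\<forall>n. uniform_index M \<xi> (Ntilde q \<xi> C c x k n C) (S n)) \<longrightarrow>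
      (\<lambda>n. cond_expect M (\<lambda>\<omega>. real (random_cluster_size e S \<xi> C c x k n \<omega>))
        (\<lambda>\<omega>. Ntilde q \<xi> C c x k n C \<omega> > 0)) \<longlonglongrightarrow> 1 / \<theta>
      \<and> (\<forall>l\<ge>1. (\<lambda>n. cond_expect M (\<lambda>\<omega>. real (random_cluster_size e S \<xi> C c x k n \<omega>))
        (\<lambda>\<omega>. Ntilde q \<xi> C c x k n C \<omega> = l)) \<longlonglongrightarrow> 1 / \<theta>))
    \<and> (\<forall>l\<ge>1. (\<lambda>n. Max ((\<lambda>z. \<bar>cond_expect M (\<lambda>\<omega>. real (Ycount \<xi> c x k n z \<omega>))
        (\<lambda>\<omega>. Ycount \<xi> c x k n z \<omega> > 0 \<and> Ncount \<xi> c x k n C \<omega> = l) - 1 / \<theta>\<bar>) ` Qminus C c k n)) \<longlonglongrightarrow> 0)"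
    if Dbar: "cond_Dbar M \<xi> c x k (Kset c \<kappa>)"
  proof -
    obtain \<gamma>' \<alpha>1 \<alpha>2 where \<gamma>': "vec_smallo (\<lambda>n. root CARD('d) (real (k n)) *\<^sub>R \<gamma>' n) c"
      and \<alpha>1: "(\<lambda>n. real (k n) * \<alpha>1 n) \<longlonglongrightarrow> 0" and \<alpha>2: "\<alpha>2 \<in> o(\<lambda>n. prob {\<omega> \<in> space M. \<xi> 0 \<omega> > x n})"
      and max_mix: "\<forall>n A B E. A \<subseteq> Kset c \<kappa> n \<and> B \<subseteq> Kset c \<kappa> n \<and> separated (\<gamma>' n) A B \<and>
          E \<in> exceedance_sigma M \<xi> (x n) B \<longrightarrow>
        \<bar>prob ({\<omega> \<in> space M. field_max \<xi> A \<omega> \<le> ereal (x n)} \<inter> E)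
          - prob {\<omega> \<in> space M. field_max \<xi> A \<omega> \<le> ereal (x n)} * prob E\<bar> \<le> \<alpha>1 n"
      and exc_mix: "\<forall>n v B E. v \<in> Kset c \<kappa> n \<and> B \<subseteq> Kset c \<kappa> n \<and> separated (\<gamma>' n) {v} B \<and>
          E \<in> exceedance_sigma M \<xi> (x n) B \<longrightarrow>
        \<bar>prob ({\<omega> \<in> space M. \<xi> v \<omega> > x n} \<inter> E) - prob {\<omega> \<in> space M. \<xi> v \<omega> > x n} * prob E\<bar> \<le> \<alpha>2 n"
      using Dbar unfolding cond_Dbar_def by (elim exE conjE) (rule that)
    have p_eq: "box.p = (\<lambda>n. prob {\<omega> \<in> space M. \<xi> 0 \<omega> > x n})"
      by (simp add: box.p_def exc_def fun_eq_iff)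
    \<comment> \<open>From here on mixing uses the witnesses of \<open>cond_Dbar\<close>; what was
      derived from \<open>cond_D\<close> enters through \<open>h_lim\<close>.\<close>
    interpret clusters: cluster_asymptotics M \<xi> C c \<kappa> \<theta> \<tau> x k R \<gamma>' \<alpha>1 \<alpha>2
    proof unfold_locales
      show "\<alpha>2 \<in> o(box.p)"
        unfolding p_eq by (rule \<alpha>2)
    qed (use h_lim \<gamma>' \<alpha>1 max_mix exc_mix in \<open>simp_all add: exc_def\<close>)
    show ?thesis
      by (intro conjI allI impI)
        (rule clusters.cond_expect_cluster_pos_lim[OF assms(7,8)] clusters.cond_expect_cluster_eq_lim[OF assms(7,8)]
          clusters.max_cond_expect_lim | assumption | erule spec)+
  qed
  show ?thesis
    by (rule conjI[OF box.cond_expect_Ycount_lim[OF h_lim] impI[OF mixing]])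
qed

end
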